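(* The isometry classes $\{\mu\in\mathcal{B}: X_\mu$ has $P\}$, for $P$ each of LD2P, SD2P, DLD2P, DD2P and the Daugavet property, are all $G_\delta$-complete in $\mathcal{B}$.
   Context: $V$ is the set of finitely supported rational sequences; $\mathcal{P}\subset\mathbb{R}^V$ the seminorms on $V$ with pointwise convergence topology; for $\mu\in\mathcal{P}$, $\bar\mu$ is its seminorm extension to $c_{00}$ and $X_\mu$ the completion of $c_{00}/\{\bar\mu=0\}$; $\mathcal{B}$ is the set of $\mu\in\mathcal{P}$ with $X_\mu$ infinite-dimensional and $\bar\mu$ a norm on $c_{00}$, with the subspace topology. A set $A$ in a Polish space $Z$ is $G_\delta$-complete if it is $G_\delta$ and every $G_\delta$ subset of every zero-dimensional Polish space is a continuous preimage of $A$. A slice of $B_X$ is $S(B_X,f,\alpha)=\{x\in B_X:f(x)>1-\alpha\}$, $f\in S_{X^*}$, $\alpha>0$. LD2P: every slice of $B_X$ has diameter 2. SD2P: every convex combination of slices of $B_X$ has diameter 2. DLD2P: for every $\varepsilon>0$, slice $S$ and $x\in S\cap S_X$ there is $y\in S$ with $\|x-y\|>2-\varepsilon$. DD2P: for every $\varepsilon>0$, nonempty relatively weakly open $U\subset B_X$ and $x\in U\cap S_X$ there is $y\in U$ with $\|x-y\|>2-\varepsilon$. Daugavet property: for every $\varepsilon>0$, $x\in S_X$ and slice $S$ there is $y\in S$ with $\|x-y\|>2-\varepsilon$. *)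

theory Defs
  imports "HOL-Analysis.Analysis" "HOL-Library.Function_Algebras"
begin

instantiation "fun" :: (type, real_vector) real_vector
begin
definition scaleR_fun :: "real \<Rightarrow> ('a \<Rightarrow> 'b) \<Rightarrow> 'a \<Rightarrow> 'b"
  where "scaleR_fun c f = (\<lambda>x. c *\<^sub>R f x)"
instance
  by standard (simp_all add: scaleR_fun_def fun_eq_iff scaleR_add_right scaleR_add_left)
end

text \<open>S plays the role of a Banach space X (possibly with null vectors, which is harmless:
all notions below only depend on the Hausdorff quotient).\<close>

definition unit_ball :: "'a::real_vector set \<Rightarrow> ('a \<Rightarrow> real) \<Rightarrow> 'a set" where
  "unit_ball S N = {x \<in> S. N x \<le> 1}"

definition unit_sphere :: "'a::real_vector set \<Rightarrow> ('a \<Rightarrow> real) \<Rightarrow> 'a set" where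
  "unit_sphere S N = {x \<in> S. N x = 1}"

definition dual_space :: "'a::real_vector set \<Rightarrow> ('a \<Rightarrow> real) \<Rightarrow> ('a \<Rightarrow> real) set" where
  "dual_space S N = {f. (\<forall>x\<in>S. \<forall>y\<in>S. f (x + y) = f x + f y) \<and>
                        (\<forall>c. \<forall>x\<in>S. f (c *\<^sub>R x) = c * f x) \<and>
                        (\<exists>C. \<forall>x\<in>S. \<bar>f x\<bar> \<le> C * N x)}"

definition dual_norm :: "'a::real_vector set \<Rightarrow> ('a \<Rightarrow> real) \<Rightarrow> ('a \<Rightarrow> real) \<Rightarrow> real" where
  "dual_norm S N f = Sup {\<bar>f x\<bar> | x. x \<in> unit_ball S N}"

definition dual_sphere :: "'a::real_vector set \<Rightarrow> ('a \<Rightarrow> real) \<Rightarrow> ('a \<Rightarrow> real) set" where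
  "dual_sphere S N = {f \<in> dual_space S N. dual_norm S N f = 1}"

definition slice :: "'a::real_vector set \<Rightarrow> ('a \<Rightarrow> real) \<Rightarrow> ('a \<Rightarrow> real) \<Rightarrow> real \<Rightarrow> 'a set" where
  "slice S N f \<alpha> = {x \<in> unit_ball S N. f x > 1 - \<alpha>}"

definition ndiam :: "('a::real_vector \<Rightarrow> real) \<Rightarrow> 'a set \<Rightarrow> real" where
  "ndiam N A = Sup {N (x - y) | x y. x \<in> A \<and> y \<in> A}"

definition weakly_open :: "'a::real_vector set \<Rightarrow> ('a \<Rightarrow> real) \<Rightarrow> 'a set \<Rightarrow> bool" where
  "weakly_open S N W \<longleftrightarrow> W \<subseteq> S \<and>
     (\<forall>x\<in>W. \<exists>F \<delta>. finite F \<and> F \<subseteq> dual_space S N \<and> \<delta> > 0 \<and>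
                 {y \<in> S. \<forall>f\<in>F. \<bar>f y - f x\<bar> < \<delta>} \<subseteq> W)"

definition LD2P :: "'a::real_vector set \<Rightarrow> ('a \<Rightarrow> real) \<Rightarrow> bool" where
  "LD2P S N \<longleftrightarrow> (\<forall>f \<in> dual_sphere S N. \<forall>\<alpha>>0. ndiam N (slice S N f \<alpha>) = 2)"

definition SD2P :: "'a::real_vector set \<Rightarrow> ('a \<Rightarrow> real) \<Rightarrow> bool" where
  "SD2P S N \<longleftrightarrow> (\<forall>(n::nat) (l::nat \<Rightarrow> real) f \<alpha>.
      n \<ge> 1 \<and> (\<forall>i<n. l i \<ge> 0) \<and> (\<Sum>i<n. l i) = 1 \<and>
      (\<forall>i<n. f i \<in> dual_sphere S N \<and> \<alpha> i > 0) \<longrightarrow>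
      ndiam N {\<Sum>i<n. l i *\<^sub>R x i | x. \<forall>i<n. x i \<in> slice S N (f i) (\<alpha> i)} = 2)"

definition DLD2P :: "'a::real_vector set \<Rightarrow> ('a \<Rightarrow> real) \<Rightarrow> bool" where
  "DLD2P S N \<longleftrightarrow> (\<forall>\<epsilon>>0. \<forall>f \<in> dual_sphere S N. \<forall>\<alpha>>0.
      \<forall>x \<in> slice S N f \<alpha> \<inter> unit_sphere S N. \<exists>y \<in> slice S N f \<alpha>. N (x - y) > 2 - \<epsilon>)"

definition DD2P :: "'a::real_vector set \<Rightarrow> ('a \<Rightarrow> real) \<Rightarrow> bool" where
  "DD2P S N \<longleftrightarrow> (\<forall>\<epsilon>>0. \<forall>W. weakly_open S N W \<longrightarrow>
      (\<forall>x \<in> W \<inter> unit_ball S N \<inter> unit_sphere S N. \<exists>y \<in> W \<inter> unit_ball S N. N (x - y) > 2 - \<epsilon>))"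

definition Daugavet :: "'a::real_vector set \<Rightarrow> ('a \<Rightarrow> real) \<Rightarrow> bool" where
  "Daugavet S N \<longleftrightarrow> (\<forall>\<epsilon>>0. \<forall>x \<in> unit_sphere S N. \<forall>f \<in> dual_sphere S N. \<forall>\<alpha>>0.
      \<exists>y \<in> slice S N f \<alpha>. N (x - y) > 2 - \<epsilon>)"

text \<open>Infinite dimensionality of the Hausdorff quotient of (S, N)\<close>
definition infinite_dim :: "'a::real_vector set \<Rightarrow> ('a \<Rightarrow> real) \<Rightarrow> bool" where
  "infinite_dim S N \<longleftrightarrow> \<not> (\<exists>F. finite F \<and> F \<subseteq> S \<and> (\<forall>x\<in>S. \<exists>y\<in>span F. N (x - y) = 0))"

definition Vset :: "(nat \<Rightarrow> rat) set" where
  "Vset = {v. finite {n. v n \<noteq> 0}}"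

definition c00 :: "(nat \<Rightarrow> real) set" where
  "c00 = {x. finite {n. x n \<noteq> 0}}"

definition seminorm_on_V :: "((nat \<Rightarrow> rat) \<Rightarrow> real) \<Rightarrow> bool" where
  "seminorm_on_V \<mu> \<longleftrightarrow>
     (\<forall>v\<in>Vset. \<forall>w\<in>Vset. \<mu> (\<lambda>n. v n + w n) \<le> \<mu> v + \<mu> w) \<and>
     (\<forall>q. \<forall>v\<in>Vset. \<mu> (\<lambda>n. q * v n) = \<bar>real_of_rat q\<bar> * \<mu> v)"

text \<open>R^V with the topology of pointwise convergence (functions extensional outside V)\<close>
definition RV :: "((nat \<Rightarrow> rat) \<Rightarrow> real) topology" where
  "RV = product_topology (\<lambda>_. euclideanreal) Vset"

definition Pset :: "((nat \<Rightarrow> rat) \<Rightarrow> real) set" where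
  "Pset = {\<mu> \<in> topspace RV. seminorm_on_V \<mu>}"

definition seminorm_on_c00 :: "((nat \<Rightarrow> real) \<Rightarrow> real) \<Rightarrow> bool" where
  "seminorm_on_c00 g \<longleftrightarrow>
     (\<forall>x\<in>c00. \<forall>y\<in>c00. g (x + y) \<le> g x + g y) \<and>
     (\<forall>c. \<forall>x\<in>c00. g (c *\<^sub>R x) = \<bar>c\<bar> * g x)"

definition mubar :: "((nat \<Rightarrow> rat) \<Rightarrow> real) \<Rightarrow> (nat \<Rightarrow> real) \<Rightarrow> real" where
  "mubar \<mu> = (THE g. seminorm_on_c00 g \<and> (\<forall>v\<in>Vset. g (\<lambda>n. real_of_rat (v n)) = \<mu> v) \<and>
                     (\<forall>x. x \<notin> c00 \<longrightarrow> g x = 0))"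

text \<open>X_mu: completion of (c00, mubar mu), realised as the space of mubar-Cauchy sequences
  in c00 with seminorm the limit of the norms (the quotient by null vectors is implicit).\<close>
definition Xcar :: "((nat \<Rightarrow> rat) \<Rightarrow> real) \<Rightarrow> (nat \<Rightarrow> nat \<Rightarrow> real) set" where
  "Xcar \<mu> = {s. (\<forall>k. s k \<in> c00) \<and>
               (\<forall>\<epsilon>>0. \<exists>M. \<forall>m\<ge>M. \<forall>k\<ge>M. mubar \<mu> (s m - s k) < \<epsilon>)}"

definition Xnorm :: "((nat \<Rightarrow> rat) \<Rightarrow> real) \<Rightarrow> (nat \<Rightarrow> nat \<Rightarrow> real) \<Rightarrow> real" where
  "Xnorm \<mu> s = lim (\<lambda>k. mubar \<mu> (s k))"

definition Bset :: "((nat \<Rightarrow> rat) \<Rightarrow> real) set" where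
  "Bset = {\<mu> \<in> Pset. infinite_dim (Xcar \<mu>) (Xnorm \<mu>) \<and> (\<forall>x\<in>c00. mubar \<mu> x = 0 \<longrightarrow> x = 0)}"

definition Btop :: "((nat \<Rightarrow> rat) \<Rightarrow> real) topology" where
  "Btop = subtopology RV Bset"

definition Polish_space :: "'a topology \<Rightarrow> bool" where
  "Polish_space X \<longleftrightarrow> completely_metrizable_space X \<and> separable_space X"

definition zero_dimensional :: "'a topology \<Rightarrow> bool" where
  "zero_dimensional X \<longleftrightarrow> (\<forall>U x. openin X U \<and> x \<in> U \<longrightarrow>
      (\<exists>W. openin X W \<and> closedin X W \<and> x \<in> W \<and> W \<subseteq> U))"

text \<open>G_delta-completeness; the type argument ranges over the carrier type of the test spaces,
  which in a theorem with a free type variable is universally quantified.\<close>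
definition Gdelta_complete :: "'y itself \<Rightarrow> 'a topology \<Rightarrow> 'a set \<Rightarrow> bool" where
  "Gdelta_complete (_::'y itself) Z A \<longleftrightarrow> gdelta_in Z A \<and>
     (\<forall>(Y::'y topology) C. Polish_space Y \<and> zero_dimensional Y \<and> gdelta_in Y C \<longrightarrow>
        (\<exists>f. continuous_map Y Z f \<and> C = {y \<in> topspace Y. f y \<in> A}))"

end

theory Submission
  imports Defs
begin

text \<open>
  Upper bound. Failure of each property is witnessed by finitely many functionals in the dual ball
  together with closed conditions that only involve vectors of \<open>V\<close>, once the remaining parameters
  have been perturbed into a countable set. As functionals dominated by \<open>\<mu>\<close> form a compact
  set, the set of \<open>\<mu>\<close> where the property fails is a countable union of projections of closed sets
  along a compact factor, hence \<open>F\<^sub>\<sigma>\<close>; no Hahn-Banach theorem is needed.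

  Hardness. Step functions on a dyadic tree, with an \<open>L\<^sub>1\<close> norm in which the masses \<open>m k\<close> of the
  leftmost branch are prescribed, form a copy of \<open>c\<^sub>0\<^sub>0\<close> whose norm depends continuously on \<open>m\<close>.
  If \<open>m\<close> tends to \<open>0\<close> the measure is atomless and all five properties hold: a vector \<open>z\<close> can be moved,
  almost without changing finitely many functionals, to a vector of the same norm carried by a set
  of tiny measure (keep one representative atom for each cell of values of the functionals). If the
  limit of \<open>m\<close> is positive, the branch is an atom, and evaluation there defines a slice of small
  diameter. For a \<open>G\<^sub>\<delta>\<close> set \<open>C\<close>, the intersection of decreasing cozero sets, \<open>m\<close> is chosen
  continuously in \<open>y\<close> with limit \<open>0\<close> exactly when \<open>y \<in> C\<close>.
\<close>

section \<open>Seminormed spaces and diameter two properties\<close>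

text \<open>The definitions cut slices with functionals of norm exactly 1, a condition that
  pointwise limits do not preserve. The gap predicates therefore admit every functional of the dual
  ball and measure the depth of a slice from a vector \<open>z\<close>, as
  \<open>F z - \<delta> < F y\<close>, so that no normalisation of \<open>F\<close> appears. One
  number \<open>\<delta>\<close> is at once the depth of the slice and the shortfall from 2.
  Premises are strict and conclusions weak, which makes the conditions closed in the seminorm and
  the functionals; halving \<open>\<delta>\<close> pays for replacing vectors by rational ones.

  For hardness it is enough to treat two extremes: failure of LD2P refutes all five properties, and
  diffuseness implies all five, so one continuous map serves every class. Diffuseness, rather than
  the Daugavet property, is the target because it handles several functionals at once, as DD2P
  demands, and vectors \<open>x\<close> of any norm, as the induction over the summands in SD2P
  demands.\<close>

definition dual_ball :: "'a::real_vector set \<Rightarrow> ('a \<Rightarrow> real) \<Rightarrow> ('a \<Rightarrow> real) set" where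
  "dual_ball S N = {f \<in> dual_space S N. \<forall>x\<in>S. \<bar>f x\<bar> \<le> N x}"

text \<open>A seminorm on a subspace of a type fits both \<open>c00\<close> with its various norms
  and the space of Cauchy sequences, whose null vectors are not factored out.\<close>

locale seminormed_space =
  fixes S :: "'a::real_vector set" and N :: "'a \<Rightarrow> real"
  assumes subspace_S: "subspace S"
    and N_add: "x \<in> S \<Longrightarrow> y \<in> S \<Longrightarrow> N (x + y) \<le> N x + N y"
    and N_scale: "x \<in> S \<Longrightarrow> N (c *\<^sub>R x) = \<bar>c\<bar> * N x"
begin

abbreviation "B\<^sub>X \<equiv> unit_ball S N"
abbreviation "S\<^sub>X \<equiv> unit_sphere S N"
abbreviation "D\<^sub>X \<equiv> dual_ball S N"

lemma zero_mem [simp]: "0 \<in> S"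
  and add_mem [simp]: "x \<in> S \<Longrightarrow> y \<in> S \<Longrightarrow> x + y \<in> S"
  and scale_mem [simp]: "x \<in> S \<Longrightarrow> c *\<^sub>R x \<in> S"
  and diff_mem [simp]: "x \<in> S \<Longrightarrow> y \<in> S \<Longrightarrow> x - y \<in> S"
  and uminus_mem [simp]: "x \<in> S \<Longrightarrow> - x \<in> S"
  and sum_mem: "(\<And>i. i \<in> I \<Longrightarrow> h i \<in> S) \<Longrightarrow> sum h I \<in> S"
  using subspace_S by (auto simp: subspace_0 subspace_add subspace_mul subspace_diff subspace_neg
      intro: subspace_sum)

lemma N_zero [simp]: "N 0 = 0"
  using N_scale[of 0 0] by simp

lemma N_uminus: "x \<in> S \<Longrightarrow> N (- x) = N x"
  using N_scale[of x "-1"] by simp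

lemma N_nonneg: "x \<in> S \<Longrightarrow> 0 \<le> N x"
  using N_add[of x "- x"] by (simp add: N_uminus)

lemma N_diff: "x \<in> S \<Longrightarrow> y \<in> S \<Longrightarrow> N (x - y) \<le> N x + N y"
  using N_add[of x "- y"] by (simp add: N_uminus)

lemma N_minus_commute: "x \<in> S \<Longrightarrow> y \<in> S \<Longrightarrow> N (x - y) = N (y - x)"
  using N_uminus[of "x - y"] by simp

lemma N_diff_trans: "x \<in> S \<Longrightarrow> y \<in> S \<Longrightarrow> z \<in> S \<Longrightarrow> N (x - z) \<le> N (x - y) + N (y - z)"
  using N_add[of "x - y" "y - z"] by simp

lemma N_abs_diff: "x \<in> S \<Longrightarrow> y \<in> S \<Longrightarrow> \<bar>N x - N y\<bar> \<le> N (x - y)"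
  using N_add[of "x - y" y] N_add[of "y - x" x] N_minus_commute[of x y] by simp

lemma N_sum: "(\<And>i. i \<in> I \<Longrightarrow> h i \<in> S) \<Longrightarrow> N (sum h I) \<le> (\<Sum>i\<in>I. N (h i))"
proof (induction I rule: infinite_finite_induct)
  case (insert i I)
  then show ?case
    using N_add[of "h i" "sum h I"] by (simp add: sum_mem)
qed auto

lemma unit_sphere_subset_ball: "x \<in> S\<^sub>X \<Longrightarrow> x \<in> B\<^sub>X"
  by (simp add: unit_sphere_def unit_ball_def)

lemma normalize_in_sphere: "x \<in> S \<Longrightarrow> N x > 0 \<Longrightarrow> (1 / N x) *\<^sub>R x \<in> S\<^sub>X"
  by (simp add: unit_sphere_def N_scale)

section \<open>Functionals: dual space, dual ball and dual sphere\<close>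

lemma dual_add: "f \<in> dual_space S N \<Longrightarrow> x \<in> S \<Longrightarrow> y \<in> S \<Longrightarrow> f (x + y) = f x + f y"
  and dual_scale: "f \<in> dual_space S N \<Longrightarrow> x \<in> S \<Longrightarrow> f (c *\<^sub>R x) = c * f x"
  by (auto simp: dual_space_def)

lemma dual_uminus: "f \<in> dual_space S N \<Longrightarrow> x \<in> S \<Longrightarrow> f (- x) = - f x"
  using dual_scale[of f x "-1"] by simp

lemma dual_diff: "f \<in> dual_space S N \<Longrightarrow> x \<in> S \<Longrightarrow> y \<in> S \<Longrightarrow> f (x - y) = f x - f y"
  using dual_add[of f x "- y"] by (simp add: dual_uminus)

lemma dual_ball_space: "f \<in> D\<^sub>X \<Longrightarrow> f \<in> dual_space S N"
  and dual_ball_le: "f \<in> D\<^sub>X \<Longrightarrow> x \<in> S \<Longrightarrow> \<bar>f x\<bar> \<le> N x"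
  by (auto simp: dual_ball_def)

lemma dual_ball_diff_le:
  "f \<in> D\<^sub>X \<Longrightarrow> x \<in> S \<Longrightarrow> y \<in> S \<Longrightarrow> \<bar>f x - f y\<bar> \<le> N (x - y)"
  using dual_ball_le[of f "x - y"] by (simp add: dual_diff dual_ball_space)

lemma bdd_above_dual:
  assumes "f \<in> dual_space S N" shows "bdd_above {\<bar>f x\<bar> | x. x \<in> B\<^sub>X}"
proof -
  from assms obtain C where C: "\<forall>x\<in>S. \<bar>f x\<bar> \<le> C * N x" by (auto simp: dual_space_def)
  have "\<bar>f x\<bar> \<le> \<bar>C\<bar>" if "x \<in> B\<^sub>X" for x
  proof -
    have "x \<in> S" "N x \<le> 1" using that by (auto simp: unit_ball_def)
    then have "\<bar>f x\<bar> \<le> C * N x" "C * N x \<le> \<bar>C\<bar> * N x" "\<bar>C\<bar> * N x \<le> \<bar>C\<bar>"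
      using C N_nonneg[of x] by (auto intro!: mult_right_mono mult_left_le)
    then show ?thesis by simp
  qed
  then show ?thesis by (auto simp: bdd_above_def)
qed

lemma dual_norm_upper:
  assumes "f \<in> dual_space S N" "x \<in> B\<^sub>X" shows "\<bar>f x\<bar> \<le> dual_norm S N f"
  unfolding dual_norm_def using assms by (intro cSup_upper bdd_above_dual) auto

lemma dual_le_norm:
  assumes f: "f \<in> dual_space S N" and x: "x \<in> S" shows "\<bar>f x\<bar> \<le> dual_norm S N f * N x"
proof (cases "N x = 0")
  case True
  \<comment> \<open>A null vector cannot be normalised; the bound \<open>C * N x\<close> in
    \<open>dual_space\<close> gives \<open>f x = 0\<close> instead.\<close>
  then show ?thesis using f x by (force simp: dual_space_def)
next
  case False
  then have p: "N x > 0" using N_nonneg[OF x] by simp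
  have "(1 / N x) *\<^sub>R x \<in> B\<^sub>X"
    using normalize_in_sphere[OF x p] unit_sphere_subset_ball by blast
  then have "\<bar>f ((1 / N x) *\<^sub>R x)\<bar> \<le> dual_norm S N f" by (rule dual_norm_upper[OF f])
  then show ?thesis using p f x by (simp add: dual_scale abs_mult field_simps)
qed

lemma dual_sphere_subset_ball: "f \<in> dual_sphere S N \<Longrightarrow> f \<in> D\<^sub>X"
  using dual_le_norm by (fastforce simp: dual_sphere_def dual_ball_def)

text \<open>\<open>dual_norm\<close> is a supremum of absolute values, so a vector on which
  \<open>f\<close> is negative is replaced by its opposite.\<close>

lemma dual_sphere_nearly_attained:
  assumes f: "f \<in> dual_sphere S N" and c: "c < 1"
  obtains z where "z \<in> B\<^sub>X" "f z > c"
proof -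
  have fs: "f \<in> dual_space S N" and n1: "dual_norm S N f = 1"
    using f by (auto simp: dual_sphere_def)
  have ne: "{\<bar>f x\<bar> | x. x \<in> B\<^sub>X} \<noteq> {}"
    by (auto simp: unit_ball_def intro!: exI[of _ 0])
  have "c < Sup {\<bar>f x\<bar> | x. x \<in> B\<^sub>X}" using n1 c by (simp add: dual_norm_def)
  then obtain z where z: "z \<in> B\<^sub>X" "c < \<bar>f z\<bar>"
    using less_cSup_iff[OF ne bdd_above_dual[OF fs]] by auto
  have zS: "z \<in> S" using z by (simp add: unit_ball_def)
  have "- z \<in> B\<^sub>X" using z zS by (simp add: unit_ball_def N_uminus)
  moreover have "f (- z) = - f z" using fs zS by (rule dual_uminus)
  ultimately show ?thesis using z that by (metis abs_real_def)
qed

lemma dual_sphere_nearly_attained_sphere: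
  assumes f: "f \<in> dual_sphere S N" and c: "c < 1"
  obtains z where "z \<in> S\<^sub>X" "f z > c"
proof -
  \<comment> \<open>The maximum with 0 makes \<open>f z\<close> positive: only then does dividing by
    \<open>N z \<le> 1\<close> not lower the value.\<close>
  obtain z where z: "z \<in> B\<^sub>X" "f z > max c 0"
    using dual_sphere_nearly_attained[OF f, of "max c 0"] c by auto
  have zS: "z \<in> S" and le: "N z \<le> 1" using z by (auto simp: unit_ball_def)
  have fb: "f \<in> D\<^sub>X" by (rule dual_sphere_subset_ball[OF f])
  have p: "N z > 0" using dual_ball_le[OF fb zS] z by auto
  have "f ((1 / N z) *\<^sub>R z) = f z / N z" using dual_scale[OF dual_ball_space[OF fb] zS] by simp
  moreover have "f z \<le> f z / N z" using p le z by (simp add: field_simps)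
  ultimately show ?thesis using that[OF normalize_in_sphere[OF zS p]] z by auto
qed

text \<open>The way back from the dual ball to the norm-one functionals of the definitions:
  \<open>t\<close> is the dual norm. Its bound on the unit ball later shows that the rescaled slice
  has a positive \<open>\<alpha>\<close>.\<close>

lemma dual_normalize:
  assumes f: "f \<in> D\<^sub>X" and x: "x \<in> S" "f x \<noteq> 0"
  obtains t where "t > 0" "(\<lambda>x. f x / t) \<in> dual_sphere S N" "\<And>y. y \<in> B\<^sub>X \<Longrightarrow> f y \<le> t"
proof
  let ?t = "dual_norm S N f"
  have fs: "f \<in> dual_space S N" using f by (rule dual_ball_space)
  show t: "?t > 0"
    using dual_le_norm[OF fs x(1)] x N_nonneg[OF x(1)]
    by (metis abs_le_zero_iff abs_of_nonneg linorder_not_le mult_nonpos_nonneg order_trans)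
  show "f y \<le> ?t" if "y \<in> B\<^sub>X" for y
    using dual_norm_upper[OF fs that] by simp
  have g: "(\<lambda>x. f x / ?t) \<in> dual_space S N"
  proof -
    have "\<bar>f x / ?t\<bar> \<le> 1 * N x" if "x \<in> S" for x
      using dual_le_norm[OF fs that] t by (simp add: abs_divide pos_divide_le_eq mult.commute)
    then show ?thesis using fs unfolding dual_space_def
      by (intro CollectI conjI exI[of _ 1]) (auto simp: add_divide_distrib)
  qed
  have "dual_norm S N (\<lambda>x. f x / ?t) = 1"
    unfolding dual_norm_def[of S N "\<lambda>x. f x / ?t"]
  proof (rule cSup_eq_non_empty)
    show "{\<bar>f x / ?t\<bar> |x. x \<in> B\<^sub>X} \<noteq> {}"
      by (auto simp: unit_ball_def intro!: exI[of _ 0])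
    show "a \<le> 1" if "a \<in> {\<bar>f x / ?t\<bar> |x. x \<in> B\<^sub>X}" for a
      using that dual_norm_upper[OF fs] t by (auto simp: abs_divide)
    fix b assume b: "\<And>a. a \<in> {\<bar>f x / ?t\<bar> |x. x \<in> B\<^sub>X} \<Longrightarrow> a \<le> b"
    have "?t \<le> b * ?t"
    proof -
      have "Sup {\<bar>f x\<bar> | x. x \<in> B\<^sub>X} \<le> b * ?t"
      proof (rule cSup_least)
        show "{\<bar>f x\<bar> | x. x \<in> B\<^sub>X} \<noteq> {}"
          by (auto simp: unit_ball_def intro!: exI[of _ 0])
        fix a assume "a \<in> {\<bar>f x\<bar> | x. x \<in> B\<^sub>X}"
        then obtain x where "x \<in> B\<^sub>X" "a = \<bar>f x\<bar>" by auto
        then show "a \<le> b * ?t" using b[of "\<bar>f x / ?t\<bar>"] t by (auto simp: abs_divide pos_divide_le_eq)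
      qed
      then show ?thesis by (simp add: dual_norm_def)
    qed
    then show "1 \<le> b" using t by simp
  qed
  with g show "(\<lambda>x. f x / ?t) \<in> dual_sphere S N" by (simp add: dual_sphere_def)
qed

text \<open>Here \<open>x\<close> is the point that lacks a nearly opposite partner and
  \<open>z\<close> locates the slices. With \<open>z = x\<close>, one functional describes failure
  of DLD2P and finitely many describe failure of DD2P; with \<open>z\<close> free and one functional
  it is failure of the Daugavet property.\<close>

definition point_gap :: "'a \<Rightarrow> 'a \<Rightarrow> nat \<Rightarrow> real \<Rightarrow> bool" where
  "point_gap x z n \<delta> \<longleftrightarrow> (\<exists>F. (\<forall>i<n. F i \<in> D\<^sub>X) \<and>
     (\<forall>y\<in>B\<^sub>X. (\<forall>i<n. F i z - \<delta> < F i y) \<longrightarrow> N (x - y) \<le> 2 - \<delta>))"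

text \<open>Natural weights replace convex coefficients, to leave countably many choices, and their
  sum on the right replaces the normalisation. For positive \<open>\<delta>\<close>, the bound
  \<open>\<delta> \<le> F i (z i)\<close> keeps every functional nonzero, which the norm estimate
  cannot do where \<open>l i = 0\<close>.\<close>

definition slices_gap :: "(nat \<Rightarrow> 'a) \<Rightarrow> nat \<Rightarrow> (nat \<Rightarrow> nat) \<Rightarrow> real \<Rightarrow> bool" where
  "slices_gap z n l \<delta> \<longleftrightarrow> (\<exists>F. (\<forall>i<n. F i \<in> D\<^sub>X \<and> \<delta> \<le> F i (z i)) \<and>
     (\<forall>x y. (\<forall>i<n. x i \<in> B\<^sub>X \<and> F i (z i) - \<delta> < F i (x i) \<and>
                    y i \<in> B\<^sub>X \<and> F i (z i) - \<delta> < F i (y i)) \<longrightarrow>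
        N (\<Sum>i<n. real (l i) *\<^sub>R (x i - y i)) \<le> (2 - \<delta>) * (\<Sum>i<n. real (l i))))"

lemma point_gap_mono:
  assumes "point_gap x z n \<delta>" "\<delta>' \<le> \<delta>" shows "point_gap x z n \<delta>'"
proof -
  obtain F where F: "\<forall>i<n. F i \<in> D\<^sub>X"
    "\<forall>y\<in>B\<^sub>X. (\<forall>i<n. F i z - \<delta> < F i y) \<longrightarrow> N (x - y) \<le> 2 - \<delta>"
    using assms(1) unfolding point_gap_def by blast
  have "N (x - y) \<le> 2 - \<delta>'" if "y \<in> B\<^sub>X" "\<forall>i<n. F i z - \<delta>' < F i y" for y
  proof -
    have "\<forall>i<n. F i z - \<delta> < F i y" using that assms(2) by (auto intro: order.strict_trans1[rotated])
    then show ?thesis using F(2) that assms(2) by fastforce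
  qed
  then show ?thesis unfolding point_gap_def using F(1) by blast
qed

text \<open>Functionals of the dual ball are contractions, so moving \<open>z\<close> by
  \<open>\<delta> / 2\<close> costs at most that much depth, and moving \<open>x\<close> costs as
  much distance. Hence the centres can be taken from a countable dense set.\<close>

lemma point_gap_perturb:
  assumes "point_gap x z n \<delta>" "x \<in> S" "x' \<in> S" "z \<in> S" "z' \<in> S"
    and "N (x - x') \<le> \<delta> / 2" "N (z - z') \<le> \<delta> / 2"
  shows "point_gap x' z' n (\<delta> / 2)"
proof -
  obtain F where F: "\<forall>i<n. F i \<in> D\<^sub>X"
    "\<forall>y\<in>B\<^sub>X. (\<forall>i<n. F i z - \<delta> < F i y) \<longrightarrow> N (x - y) \<le> 2 - \<delta>"
    using assms(1) unfolding point_gap_def by blast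
  have "N (x' - y) \<le> 2 - \<delta> / 2" if y: "y \<in> B\<^sub>X" "\<forall>i<n. F i z' - \<delta> / 2 < F i y" for y
  proof -
    have "F i z - \<delta> < F i y" if "i < n" for i
      using dual_ball_diff_le[of "F i" z z'] F(1) y(2) that assms by fastforce
    then have "N (x - y) \<le> 2 - \<delta>" using F(2) y by blast
    moreover have "y \<in> S" using y by (simp add: unit_ball_def)
    ultimately show ?thesis
      using N_diff_trans[of x' x y] N_minus_commute[of x x'] assms by simp
  qed
  then show ?thesis unfolding point_gap_def using F(1) by blast
qed

lemma slices_gap_mono:
  assumes "slices_gap z n l \<delta>" "\<delta>' \<le> \<delta>" shows "slices_gap z n l \<delta>'"
proof -
  obtain F where F: "\<forall>i<n. F i \<in> D\<^sub>X \<and> \<delta> \<le> F i (z i)"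
    "\<And>x y. \<forall>i<n. x i \<in> B\<^sub>X \<and> F i (z i) - \<delta> < F i (x i) \<and>
                    y i \<in> B\<^sub>X \<and> F i (z i) - \<delta> < F i (y i) \<Longrightarrow>
        N (\<Sum>i<n. real (l i) *\<^sub>R (x i - y i)) \<le> (2 - \<delta>) * (\<Sum>i<n. real (l i))"
    using assms(1) unfolding slices_gap_def by blast
  have le: "(2 - \<delta>) * (\<Sum>i<n. real (l i)) \<le> (2 - \<delta>') * (\<Sum>i<n. real (l i))"
    using assms(2) by (intro mult_right_mono sum_nonneg) auto
  have "N (\<Sum>i<n. real (l i) *\<^sub>R (x i - y i)) \<le> (2 - \<delta>') * (\<Sum>i<n. real (l i))"
    if "\<forall>i<n. x i \<in> B\<^sub>X \<and> F i (z i) - \<delta>' < F i (x i) \<and>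
              y i \<in> B\<^sub>X \<and> F i (z i) - \<delta>' < F i (y i)" for x y
    using F(2)[of x y] le that assms(2) by fastforce
  moreover have "\<forall>i<n. F i \<in> D\<^sub>X \<and> \<delta>' \<le> F i (z i)" using F(1) assms(2) by fastforce
  ultimately show ?thesis unfolding slices_gap_def by blast
qed

lemma slices_gap_perturb:
  assumes "slices_gap z n l \<delta>" "\<And>i. i < n \<Longrightarrow> z i \<in> S \<and> z' i \<in> S \<and> N (z i - z' i) \<le> \<delta> / 2"
  shows "slices_gap z' n l (\<delta> / 2)"
proof (cases "\<delta> \<ge> 0")
  case True
  obtain F where F: "\<forall>i<n. F i \<in> D\<^sub>X \<and> \<delta> \<le> F i (z i)"
    "\<And>x y. \<forall>i<n. x i \<in> B\<^sub>X \<and> F i (z i) - \<delta> < F i (x i) \<and>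
                    y i \<in> B\<^sub>X \<and> F i (z i) - \<delta> < F i (y i) \<Longrightarrow>
        N (\<Sum>i<n. real (l i) *\<^sub>R (x i - y i)) \<le> (2 - \<delta>) * (\<Sum>i<n. real (l i))"
    using assms(1) unfolding slices_gap_def by blast
  have le: "(2 - \<delta>) * (\<Sum>i<n. real (l i)) \<le> (2 - \<delta> / 2) * (\<Sum>i<n. real (l i))"
    using True by (intro mult_right_mono sum_nonneg) auto
  have d: "\<bar>F i (z i) - F i (z' i)\<bar> \<le> \<delta> / 2" if "i < n" for i
    using dual_ball_diff_le[of "F i" "z i" "z' i"] F(1) assms(2) that by fastforce
  have "N (\<Sum>i<n. real (l i) *\<^sub>R (x i - y i)) \<le> (2 - \<delta> / 2) * (\<Sum>i<n. real (l i))"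
    if xy: "\<forall>i<n. x i \<in> B\<^sub>X \<and> F i (z' i) - \<delta> / 2 < F i (x i) \<and>
              y i \<in> B\<^sub>X \<and> F i (z' i) - \<delta> / 2 < F i (y i)" for x y
  proof -
    have "F i (z i) - \<delta> < F i (x i) \<and> F i (z i) - \<delta> < F i (y i)" if "i < n" for i
      using d[OF that] xy that by (smt (verit) field_sum_of_halves)
    then show ?thesis using F(2)[of x y] le xy by auto
  qed
  moreover have "\<delta> / 2 \<le> F i (z' i)" if "i < n" for i
    using F(1) d[OF that] that by (smt (verit) field_sum_of_halves)
  ultimately show ?thesis unfolding slices_gap_def using F(1) by blast
next
  case False
  \<comment> \<open>A negative \<open>\<delta>\<close> contradicts the distance assumption at index
    0, so there are no indices and both sums are empty.\<close>
  then have "n = 0" using assms(2)[of 0] N_nonneg[of "z 0 - z' 0"] by (cases n) auto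
  then show ?thesis unfolding slices_gap_def by auto
qed

text \<open>Dividing by the dual norm \<open>t\<close> turns the condition
  \<open>f z - \<delta> < f y\<close> into a slice in the sense of the definitions, with
  \<open>1 - \<alpha> = (f z - \<delta>) / t\<close>.\<close>

lemma point_gap_slice:
  assumes g: "point_gap x z 1 \<delta>" and x: "x \<in> S\<^sub>X" and z: "z \<in> S\<^sub>X" and d: "\<delta> > 0"
  obtains f \<alpha> where "f \<in> dual_sphere S N" "\<alpha> > 0" "z \<in> slice S N f \<alpha>"
    "\<And>y. y \<in> slice S N f \<alpha> \<Longrightarrow> N (x - y) \<le> 2 - \<delta>"
proof -
  obtain f where f: "f \<in> D\<^sub>X"
    "\<And>y. y \<in> B\<^sub>X \<Longrightarrow> f z - \<delta> < f y \<Longrightarrow> N (x - y) \<le> 2 - \<delta>"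
    using g unfolding point_gap_def by auto
  have xS: "x \<in> S" "N x = 1" and zb: "z \<in> S" "z \<in> B\<^sub>X" using x z by (auto simp: unit_sphere_def unit_ball_def)
  \<comment> \<open>A vanishing functional would put \<open>- x\<close>, at distance \<open>2\<close> from \<open>x\<close>, into the slice.\<close>
  have "\<exists>y\<in>S. f y \<noteq> 0"
  proof (rule ccontr)
    assume n: "\<not> ?thesis"
    have "- x \<in> B\<^sub>X" using xS by (simp add: unit_ball_def N_uminus)
    moreover have "f z - \<delta> < f (- x)" using n xS zb d by auto
    ultimately have "N (x - (- x)) \<le> 2 - \<delta>" by (rule f(2))
    moreover have "N (x - (- x)) = 2" using N_scale[of x 2] xS by (simp add: scaleR_2)
    ultimately show False using d by simp
  qed
  then obtain t where t: "t > 0" "(\<lambda>x. f x / t) \<in> dual_sphere S N" "\<And>y. y \<in> B\<^sub>X \<Longrightarrow> f y \<le> t"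
    using dual_normalize[OF f(1)] by metis
  show ?thesis
  proof (rule that[OF t(2), of "1 - (f z - \<delta>) / t"])
    show "1 - (f z - \<delta>) / t > 0" using t(3)[OF zb(2)] t(1) d by simp
    show "z \<in> slice S N (\<lambda>x. f x / t) (1 - (f z - \<delta>) / t)"
      using zb t(1) d by (simp add: slice_def divide_less_cancel)
    show "N (x - y) \<le> 2 - \<delta>" if "y \<in> slice S N (\<lambda>x. f x / t) (1 - (f z - \<delta>) / t)" for y
      using f(2)[of y] that t(1) by (simp add: slice_def divide_less_cancel)
  qed
qed

lemma not_Daugavet_iff:
  "\<not> Daugavet S N \<longleftrightarrow>
    (\<exists>x\<in>S\<^sub>X. \<exists>z\<in>S\<^sub>X. \<exists>\<delta>>0. point_gap x z 1 \<delta>)" (is "?L \<longleftrightarrow> ?R")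
proof
  assume ?L
  then obtain \<epsilon> x f \<alpha> where *: "\<epsilon> > 0" "x \<in> S\<^sub>X" "f \<in> dual_sphere S N" "\<alpha> > 0"
    "\<And>y. y \<in> slice S N f \<alpha> \<Longrightarrow> N (x - y) \<le> 2 - \<epsilon>"
    unfolding Daugavet_def by (meson not_le)
  obtain z where z: "z \<in> S\<^sub>X" "f z > 1 - \<alpha>"
    using dual_sphere_nearly_attained_sphere[OF *(3), of "1 - \<alpha>"] *(4) by auto
  \<comment> \<open>The depth of \<open>z\<close> inside the slice, capped by the gap
    \<open>\<epsilon>\<close>.\<close>
  define \<delta> where "\<delta> = min \<epsilon> (f z - (1 - \<alpha>))"
  have "N (x - y) \<le> 2 - \<delta>" if "y \<in> B\<^sub>X" "f z - \<delta> < f y" for y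
    using *(5)[of y] that by (force simp: slice_def \<delta>_def)
  then have "point_gap x z 1 \<delta>"
    unfolding point_gap_def using dual_sphere_subset_ball[OF *(3)]
    by (intro exI[of _ "\<lambda>_. f"]) auto
  moreover have "\<delta> > 0" using * z by (simp add: \<delta>_def)
  ultimately show ?R using * z by blast
next
  assume ?R
  then obtain x z \<delta> where *: "x \<in> S\<^sub>X" "z \<in> S\<^sub>X" "\<delta> > 0" "point_gap x z 1 \<delta>"
    by blast
  obtain f \<alpha> where f: "f \<in> dual_sphere S N" "\<alpha> > 0" "\<And>y. y \<in> slice S N f \<alpha> \<Longrightarrow> N (x - y) \<le> 2 - \<delta>"
    using point_gap_slice[OF *(4,1,2,3)] by blast
  show ?L
  proof
    assume "Daugavet S N"
    then obtain y where "y \<in> slice S N f \<alpha>" "N (x - y) > 2 - \<delta>" unfolding Daugavet_def using * f(1,2) by blast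
    then show False using f(3)[of y] by simp
  qed
qed

lemma not_DLD2P_iff:
  "\<not> DLD2P S N \<longleftrightarrow> (\<exists>x\<in>S\<^sub>X. \<exists>\<delta>>0. point_gap x x 1 \<delta>)" (is "?L \<longleftrightarrow> ?R")
proof
  assume ?L
  then obtain \<epsilon> x f \<alpha> where *: "\<epsilon> > 0" "x \<in> S\<^sub>X" "f \<in> dual_sphere S N" "\<alpha> > 0"
    "x \<in> slice S N f \<alpha>" "\<And>y. y \<in> slice S N f \<alpha> \<Longrightarrow> N (x - y) \<le> 2 - \<epsilon>"
    unfolding DLD2P_def by (auto simp: not_less)
  define \<delta> where "\<delta> = min \<epsilon> (f x - (1 - \<alpha>))"
  have "N (x - y) \<le> 2 - \<delta>" if "y \<in> B\<^sub>X" "f x - \<delta> < f y" for y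
    using *(6)[of y] that by (force simp: slice_def \<delta>_def)
  then have "point_gap x x 1 \<delta>"
    unfolding point_gap_def using dual_sphere_subset_ball[OF *(3)]
    by (intro exI[of _ "\<lambda>_. f"]) auto
  moreover have "\<delta> > 0" using * by (simp add: \<delta>_def slice_def)
  ultimately show ?R using * by blast
next
  assume ?R
  then obtain x \<delta> where *: "x \<in> S\<^sub>X" "\<delta> > 0" "point_gap x x 1 \<delta>"
    by blast
  obtain f \<alpha> where f: "f \<in> dual_sphere S N" "\<alpha> > 0" "x \<in> slice S N f \<alpha>"
    "\<And>y. y \<in> slice S N f \<alpha> \<Longrightarrow> N (x - y) \<le> 2 - \<delta>"
    using point_gap_slice[OF *(3,1,1,2)] by blast
  show ?L
  proof
    assume "DLD2P S N"
    then obtain y where "y \<in> slice S N f \<alpha>" "N (x - y) > 2 - \<delta>" unfolding DLD2P_def using * f(1-3) by blast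
    then show False using f(4)[of y] by simp
  qed
qed

lemma not_DD2P_iff:
  "\<not> DD2P S N \<longleftrightarrow> (\<exists>x\<in>S\<^sub>X. \<exists>n. \<exists>\<delta>>0. point_gap x x n \<delta>)" (is "?L \<longleftrightarrow> ?R")
proof
  assume ?L
  then obtain \<epsilon> W x where *: "\<epsilon> > 0" "weakly_open S N W" "x \<in> W" "x \<in> S\<^sub>X"
    "\<And>y. y \<in> W \<Longrightarrow> y \<in> B\<^sub>X \<Longrightarrow> N (x - y) \<le> 2 - \<epsilon>"
    unfolding DD2P_def by (auto simp: not_less)
  have xS: "x \<in> S" using *(4) by (simp add: unit_sphere_def)
  obtain G \<delta>0 where G: "finite G" "G \<subseteq> dual_space S N" "\<delta>0 > 0"
    "{y \<in> S. \<forall>f\<in>G. \<bar>f y - f x\<bar> < \<delta>0} \<subseteq> W"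
    using *(2,3) unfolding weakly_open_def by blast
  \<comment> \<open>The leading 1 makes \<open>C\<close> positive even for empty \<open>G\<close>;
    dividing by \<open>C\<close> puts every functional of \<open>G\<close> into the dual
    ball.\<close>
  define C where "C = 1 + (\<Sum>f\<in>G. \<bar>dual_norm S N f\<bar>)"
  have C1: "C \<ge> 1" unfolding C_def by (simp add: sum_nonneg)
  have Cf: "dual_norm S N f \<le> C" if "f \<in> G" for f
    using member_le_sum[OF that, of "\<lambda>f. \<bar>dual_norm S N f\<bar>"] G(1) unfolding C_def by force
  \<comment> \<open>Both signs occur because a gap only imposes lower bounds, while a basic weak
    neighbourhood is two-sided.\<close>
  define H where "H = (\<lambda>(f, s) y. s * f y / C) ` (G \<times> {1::real, -1})"
  have "finite H" unfolding H_def using G(1) by simp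
  then obtain n F where Fn: "H = F ` {i::nat. i < n}"
    using finite_imp_nat_seg_image_inj_on by blast
  have Hb: "h \<in> D\<^sub>X" if h: "h \<in> H" for h
  proof -
    obtain f s where f: "f \<in> G" "s = 1 \<or> s = -1" "h = (\<lambda>y. s * f y / C)"
      using h unfolding H_def by auto
    have fd: "f \<in> dual_space S N" using f(1) G(2) by auto
    have le: "\<bar>h y\<bar> \<le> N y" if "y \<in> S" for y
    proof -
      have "\<bar>f y\<bar> \<le> dual_norm S N f * N y" by (rule dual_le_norm[OF fd that])
      also have "\<dots> \<le> C * N y" using Cf[OF f(1)] N_nonneg[OF that] by (rule mult_right_mono)
      finally show ?thesis using C1 f(2) unfolding f(3)
        by (auto simp: abs_divide pos_divide_le_eq mult.commute)
    qed
    moreover have "h \<in> dual_space S N"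
      unfolding dual_space_def
    proof (intro CollectI conjI ballI allI exI[of _ 1])
      show "h (u + v) = h u + h v" if "u \<in> S" "v \<in> S" for u v
        using dual_add[OF fd that] by (simp add: f(3) add_divide_distrib ring_distribs)
      show "h (c *\<^sub>R u) = c * h u" if "u \<in> S" for c u
        using dual_scale[OF fd that] by (simp add: f(3))
    qed (use le in auto)
    ultimately show ?thesis by (simp add: dual_ball_def)
  qed
  define \<delta> where "\<delta> = min \<epsilon> (\<delta>0 / C)"
  have d: "\<delta> > 0" using *(1) G(3) C1 by (simp add: \<delta>_def)
  have "point_gap x x n \<delta>"
    unfolding point_gap_def
  proof (intro exI[of _ F] conjI ballI allI impI)
    show "F i \<in> D\<^sub>X" if "i < n" for i using that Hb Fn by blast
    fix y assume y: "y \<in> B\<^sub>X" "\<forall>i<n. F i x - \<delta> < F i y"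
    have yS: "y \<in> S" using y by (simp add: unit_ball_def)
    have H: "h x - \<delta> < h y" if "h \<in> H" for h using y(2) that Fn by auto
    have "\<bar>f y - f x\<bar> < \<delta>0" if "f \<in> G" for f
    proof -
      have "(\<lambda>y. 1 * f y / C) \<in> H" "(\<lambda>y. (-1) * f y / C) \<in> H"
        using that unfolding H_def by force+
      then have "f x / C - \<delta> < f y / C" "- f x / C - \<delta> < - f y / C" using H by fastforce+
      then have "\<bar>f y / C - f x / C\<bar> < \<delta>0 / C" unfolding \<delta>_def by (smt (verit) minus_divide_left)
      then show ?thesis using C1
        by (simp add: diff_divide_distrib[symmetric] abs_divide divide_less_cancel)
    qed
    then have "N (x - y) \<le> 2 - \<epsilon>" using *(5)[of y] G(4) yS y(1) by auto
    then show "N (x - y) \<le> 2 - \<delta>" by (simp add: \<delta>_def)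
  qed
  then show ?R using *(4) d by blast
next
  assume ?R
  then obtain x n \<delta> where *: "x \<in> S\<^sub>X" "\<delta> > 0" "point_gap x x n \<delta>"
    by blast
  obtain F where F: "\<And>i. i < n \<Longrightarrow> F i \<in> D\<^sub>X"
    "\<And>y. y \<in> B\<^sub>X \<Longrightarrow> \<forall>i<n. F i x - \<delta> < F i y \<Longrightarrow> N (x - y) \<le> 2 - \<delta>"
    using *(3) unfolding point_gap_def by auto
  have xb: "x \<in> B\<^sub>X" using unit_sphere_subset_ball *(1) by blast
  define W where "W = {y \<in> S. \<forall>i<n. F i x - \<delta> < F i y}"
  have "weakly_open S N W"
    unfolding weakly_open_def
  proof (intro conjI ballI)
    show "W \<subseteq> S" by (auto simp: W_def)
    fix u assume u: "u \<in> W"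
    \<comment> \<open>The least slack at \<open>u\<close> in the strict inequalities is the radius
      of a basic neighbourhood inside \<open>W\<close>; the inserted 1 covers
      \<open>n = 0\<close>.\<close>
    define r where "r = Min (insert 1 ((\<lambda>i. F i u - F i x + \<delta>) ` {..<n}))"
    have r: "r > 0" using u by (auto simp: r_def W_def algebra_simps)
    have rle: "r \<le> F i u - F i x + \<delta>" if "i < n" for i
      unfolding r_def using that by (intro Min_le) auto
    have "{y \<in> S. \<forall>f\<in>F ` {..<n}. \<bar>f y - f u\<bar> < r} \<subseteq> W"
    proof
      fix y assume y: "y \<in> {y \<in> S. \<forall>f\<in>F ` {..<n}. \<bar>f y - f u\<bar> < r}"
      have "F i x - \<delta> < F i y" if "i < n" for i
      proof -
        have "\<bar>F i y - F i u\<bar> < r" using y that by auto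
        then show ?thesis using rle[OF that] by linarith
      qed
      then show "y \<in> W" using y by (simp add: W_def)
    qed
    moreover have "F ` {..<n} \<subseteq> dual_space S N" using F(1) dual_ball_space by auto
    ultimately show "\<exists>G \<delta>. finite G \<and> G \<subseteq> dual_space S N \<and> 0 < \<delta> \<and>
        {y \<in> S. \<forall>f\<in>G. \<bar>f y - f u\<bar> < \<delta>} \<subseteq> W"
      using r by (intro exI[of _ "F ` {..<n}"] exI[of _ r]) auto
  qed
  moreover have "x \<in> W" using xb *(2) by (simp add: W_def unit_ball_def)
  moreover have "N (x - y) \<le> 2 - \<delta>" if "y \<in> W \<inter> B\<^sub>X" for y
    using F(2)[of y] that by (auto simp: W_def)
  ultimately show ?L unfolding DD2P_def using * xb by (meson not_le IntI)
qed

section \<open>Diameters of slices and of convex combinations of slices\<close>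

lemma ndiam_unit_ball_le:
  assumes "A \<subseteq> B\<^sub>X" "A \<noteq> {}" shows "ndiam N A \<le> 2"
  unfolding ndiam_def
proof (rule cSup_least)
  show "{N (x - y) |x y. x \<in> A \<and> y \<in> A} \<noteq> {}" using assms(2) by auto
  fix a assume "a \<in> {N (x - y) |x y. x \<in> A \<and> y \<in> A}"
  then obtain x y where "x \<in> B\<^sub>X" "y \<in> B\<^sub>X" "a = N (x - y)" using assms(1) by auto
  then show "a \<le> 2" using N_diff[of x y] by (auto simp: unit_ball_def)
qed

lemma ndiam_upper:
  assumes "A \<subseteq> B\<^sub>X" "x \<in> A" "y \<in> A" shows "N (x - y) \<le> ndiam N A"
  unfolding ndiam_def
proof (rule cSup_upper)
  show "N (x - y) \<in> {N (x - y) |x y. x \<in> A \<and> y \<in> A}" using assms by auto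
  have "N (u - v) \<le> 2" if "u \<in> A" "v \<in> A" for u v
  proof -
    have "u \<in> B\<^sub>X" "v \<in> B\<^sub>X" using that assms(1) by auto
    then show ?thesis using N_diff[of u v] by (auto simp: unit_ball_def)
  qed
  then show "bdd_above {N (x - y) |x y. x \<in> A \<and> y \<in> A}" by (auto simp: bdd_above_def)
qed

text \<open>Inside the unit ball the diameter never exceeds 2, so differing from 2 means falling
  short by a definite amount. Nonemptiness keeps the supremum meaningful.\<close>

lemma ndiam_neq_2_iff:
  assumes A: "A \<subseteq> B\<^sub>X" "A \<noteq> {}"
  shows "ndiam N A \<noteq> 2 \<longleftrightarrow> (\<exists>\<epsilon>>0. \<forall>x\<in>A. \<forall>y\<in>A. N (x - y) \<le> 2 - \<epsilon>)" (is "?L \<longleftrightarrow> ?R")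
proof
  assume ?L
  then have "ndiam N A < 2" using ndiam_unit_ball_le[OF A] by simp
  then show ?R using ndiam_upper[OF A(1)] by (intro exI[of _ "2 - ndiam N A"]) auto
next
  assume ?R
  then obtain \<epsilon> where e: "\<epsilon> > 0" "\<forall>x\<in>A. \<forall>y\<in>A. N (x - y) \<le> 2 - \<epsilon>" by blast
  have "ndiam N A \<le> 2 - \<epsilon>" unfolding ndiam_def
  proof (rule cSup_least)
    show "{N (x - y) |x y. x \<in> A \<and> y \<in> A} \<noteq> {}" using A(2) by auto
  qed (use e(2) in auto)
  then show ?L using e(1) by simp
qed

lemma slice_nonempty: "f \<in> dual_sphere S N \<Longrightarrow> \<alpha> > 0 \<Longrightarrow> slice S N f \<alpha> \<noteq> {}"
proof -
  assume "f \<in> dual_sphere S N" "\<alpha> > 0"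
  then obtain z where "z \<in> B\<^sub>X" "f z > 1 - \<alpha>"
    using dual_sphere_nearly_attained[of f "1 - \<alpha>"] by auto
  then show ?thesis by (auto simp: slice_def)
qed

lemma slice_subset: "slice S N f \<alpha> \<subseteq> B\<^sub>X"
  by (auto simp: slice_def)

lemma not_LD2P_iff:
  "\<not> LD2P S N \<longleftrightarrow> (\<exists>z\<in>S\<^sub>X. \<exists>\<delta>>0. slices_gap (\<lambda>_. z) 1 (\<lambda>_. 1) \<delta>)" (is "?L \<longleftrightarrow> ?R")
proof
  assume ?L
  then obtain f \<alpha> where f: "f \<in> dual_sphere S N" "\<alpha> > 0" "ndiam N (slice S N f \<alpha>) \<noteq> 2"
    by (auto simp: LD2P_def)
  then obtain \<epsilon> where e: "\<epsilon> > 0" "\<And>x y. x \<in> slice S N f \<alpha> \<Longrightarrow> y \<in> slice S N f \<alpha> \<Longrightarrow> N (x - y) \<le> 2 - \<epsilon>"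
    using ndiam_neq_2_iff[OF slice_subset slice_nonempty] by metis
  \<comment> \<open>Besides lying in the slice, \<open>z\<close> must satisfy
    \<open>f z > 0\<close>, since a gap asks for \<open>\<delta> \<le> f z\<close>.\<close>
  obtain z where z: "z \<in> S\<^sub>X" "f z > max (1 - \<alpha>) 0"
    using dual_sphere_nearly_attained_sphere[OF f(1), of "max (1 - \<alpha>) 0"] f(2) by auto
  define \<delta> where "\<delta> = min (min \<epsilon> (f z)) (f z - (1 - \<alpha>))"
  have "slices_gap (\<lambda>_. z) 1 (\<lambda>_. 1) \<delta>"
    unfolding slices_gap_def
  proof (intro exI[of _ "\<lambda>_. f"] conjI allI impI)
    show "f \<in> D\<^sub>X" by (rule dual_sphere_subset_ball[OF f(1)])
    show "\<delta> \<le> f z" by (simp add: \<delta>_def)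
    fix x y :: "nat \<Rightarrow> 'a"
    assume h: "\<forall>i<1. x i \<in> B\<^sub>X \<and> f z - \<delta> < f (x i) \<and> y i \<in> B\<^sub>X \<and> f z - \<delta> < f (y i)"
    then have "x 0 \<in> slice S N f \<alpha>" "y 0 \<in> slice S N f \<alpha>" by (auto simp: slice_def \<delta>_def)
    then have "N (x 0 - y 0) \<le> 2 - \<epsilon>" by (rule e(2))
    then show "N (\<Sum>i<1. real 1 *\<^sub>R (x i - y i)) \<le> (2 - \<delta>) * (\<Sum>i<(1::nat). real 1)"
      by (simp add: \<delta>_def)
  qed
  moreover have "\<delta> > 0" using e z by (simp add: \<delta>_def)
  ultimately show ?R using z by blast
next
  assume ?R
  then obtain z \<delta> where *: "z \<in> S\<^sub>X" "\<delta> > 0" "slices_gap (\<lambda>_. z) 1 (\<lambda>_. 1) \<delta>" by blast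
  have "\<exists>F :: nat \<Rightarrow> 'a \<Rightarrow> real. F 0 \<in> D\<^sub>X \<and> \<delta> \<le> F 0 z \<and>
    (\<forall>(x :: nat \<Rightarrow> 'a) (y :: nat \<Rightarrow> 'a). x 0 \<in> B\<^sub>X \<and> F 0 z - \<delta> < F 0 (x 0) \<and>
            y 0 \<in> B\<^sub>X \<and> F 0 z - \<delta> < F 0 (y 0) \<longrightarrow> N (x 0 - y 0) \<le> 2 - \<delta>)"
    using *(3) by (simp add: slices_gap_def)
  then obtain F :: "nat \<Rightarrow> 'a \<Rightarrow> real" where F: "F 0 \<in> D\<^sub>X" "\<delta> \<le> F 0 z"
    "\<forall>(x :: nat \<Rightarrow> 'a) (y :: nat \<Rightarrow> 'a). x 0 \<in> B\<^sub>X \<and> F 0 z - \<delta> < F 0 (x 0) \<and>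
            y 0 \<in> B\<^sub>X \<and> F 0 z - \<delta> < F 0 (y 0) \<longrightarrow> N (x 0 - y 0) \<le> 2 - \<delta>"
    by blast
  define f where "f = F 0"
  have f: "N (x - y) \<le> 2 - \<delta>" if "x \<in> B\<^sub>X" "f z - \<delta> < f x"
     "y \<in> B\<^sub>X" "f z - \<delta> < f y" for x y
    using F(3)[rule_format, of "\<lambda>_. x" "\<lambda>_. y"] that by (simp add: f_def)
  have zb: "z \<in> B\<^sub>X" by (rule unit_sphere_subset_ball[OF *(1)])
  obtain t where t: "t > 0" "(\<lambda>x. f x / t) \<in> dual_sphere S N" "\<And>y. y \<in> B\<^sub>X \<Longrightarrow> f y \<le> t"
    using dual_normalize[of f z] F(1,2) *(2) zb unfolding f_def by (auto simp: unit_ball_def)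
  define \<alpha> where "\<alpha> = 1 - (f z - \<delta>) / t"
  have "f z \<le> t" using t(3) zb by blast
  then have a: "\<alpha> > 0" using t(1) *(2) by (simp add: \<alpha>_def)
  have "N (x - y) \<le> 2 - \<delta>" if "x \<in> slice S N (\<lambda>x. f x / t) \<alpha>" "y \<in> slice S N (\<lambda>x. f x / t) \<alpha>" for x y
    using f[of x y] that t(1) by (simp add: slice_def \<alpha>_def divide_less_cancel)
  then have "ndiam N (slice S N (\<lambda>x. f x / t) \<alpha>) \<noteq> 2"
    using ndiam_neq_2_iff[OF slice_subset slice_nonempty[OF t(2) a]] *(2) by blast
  then show ?L using t(2) a by (auto simp: LD2P_def)
qed

lemma convex_combination_in_ball:
  assumes "\<And>i. i < n \<Longrightarrow> 0 \<le> (l i :: real)" "(\<Sum>i<n. l i) = 1" "\<And>i. i < (n::nat) \<Longrightarrow> x i \<in> B\<^sub>X"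
  shows "(\<Sum>i<n. l i *\<^sub>R x i) \<in> B\<^sub>X"
proof -
  have "N (\<Sum>i<n. l i *\<^sub>R x i) \<le> (\<Sum>i<n. N (l i *\<^sub>R x i))"
    using assms(3) by (intro N_sum) (auto simp: unit_ball_def)
  also have "\<dots> \<le> (\<Sum>i<n. l i)"
    using assms by (intro sum_mono) (auto simp: unit_ball_def N_scale mult_left_le)
  finally show ?thesis using assms by (auto simp: unit_ball_def intro!: sum_mem)
qed

text \<open>The work lies in replacing real convex coefficients by natural numbers:
  \<open>l i\<close> is approximated by the floor of \<open>K * l i\<close> for a large
  \<open>K\<close>, and the rounding errors are absorbed by giving up half of
  \<open>\<epsilon>\<close>. Conversely, natural weights are divided by their sum.\<close>

lemma not_SD2P_iff:
  "\<not> SD2P S N \<longleftrightarrow> (\<exists>n l z. \<exists>\<delta>>0. (\<forall>i<n. z i \<in> S\<^sub>X) \<and> (\<Sum>i<n. l i) > 0 \<and> slices_gap z n l \<delta>)"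
  (is "?L \<longleftrightarrow> ?R")
proof
  assume ?L
  then obtain n :: nat and l :: "nat \<Rightarrow> real" and f \<alpha> where n1: "n \<ge> 1" and l: "\<And>i. i < n \<Longrightarrow> l i \<ge> 0" "(\<Sum>i<n. l i) = 1"
    and f: "\<And>i. i < n \<Longrightarrow> f i \<in> dual_sphere S N" "\<And>i. i < n \<Longrightarrow> \<alpha> i > 0"
    and nd: "ndiam N {\<Sum>i<n. l i *\<^sub>R x i | x. \<forall>i<n. x i \<in> slice S N (f i) (\<alpha> i)} \<noteq> 2" (is "ndiam N ?A \<noteq> 2")
    unfolding SD2P_def not_all not_imp by blast
  have sub: "?A \<subseteq> B\<^sub>X"
    using convex_combination_in_ball[OF l] slice_subset by blast
  have "\<forall>i. \<exists>x. i < n \<longrightarrow> x \<in> slice S N (f i) (\<alpha> i)" using slice_nonempty[OF f] by blast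
  then obtain x0 where "\<And>i. i < n \<Longrightarrow> x0 i \<in> slice S N (f i) (\<alpha> i)" by metis
  then have ne: "?A \<noteq> {}" by blast
  obtain \<epsilon> where e: "\<epsilon> > 0" "\<And>u v. u \<in> ?A \<Longrightarrow> v \<in> ?A \<Longrightarrow> N (u - v) \<le> 2 - \<epsilon>"
    using ndiam_neq_2_iff[OF sub ne, THEN iffD1, OF nd] by blast
  have conv: "N (\<Sum>i<n. l i *\<^sub>R (x i - y i)) \<le> 2 - \<epsilon>"
    if "\<And>i. i < n \<Longrightarrow> x i \<in> slice S N (f i) (\<alpha> i)" "\<And>i. i < n \<Longrightarrow> y i \<in> slice S N (f i) (\<alpha> i)" for x y
  proof -
    have "(\<Sum>i<n. l i *\<^sub>R (x i - y i)) = (\<Sum>i<n. l i *\<^sub>R x i) - (\<Sum>i<n. l i *\<^sub>R y i)"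
      by (simp add: scaleR_diff_right sum_subtractf)
    moreover have "(\<Sum>i<n. l i *\<^sub>R x i) \<in> ?A" "(\<Sum>i<n. l i *\<^sub>R y i) \<in> ?A"
      using that by blast+
    ultimately show ?thesis using e(2)[of "\<Sum>i<n. l i *\<^sub>R x i" "\<Sum>i<n. l i *\<^sub>R y i"] by simp
  qed
  \<comment> \<open>A common depth of all slices, at most 1: then
    \<open>f i (z i) > 1 - a / 2\<close> leaves \<open>a / 2\<close> of room above
    \<open>1 - \<alpha> i\<close> and is itself at least \<open>a / 2\<close>.\<close>
  define a where "a = Min (insert 1 (\<alpha> ` {..<n}))"
  have a: "a > 0" "a \<le> 1" using f(2) by (auto simp: a_def)
  have ai: "a \<le> \<alpha> i" if "i < n" for i unfolding a_def using that by (intro Min_le) auto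
  have "\<forall>i. \<exists>z. i < n \<longrightarrow> z \<in> S\<^sub>X \<and> f i z > 1 - a / 2"
  proof
    fix i
    have "\<exists>z. z \<in> S\<^sub>X \<and> f i z > 1 - a / 2" if "i < n"
      using dual_sphere_nearly_attained_sphere[OF f(1)[OF that], of "1 - a / 2"] a(1) by auto
    then show "\<exists>z. i < n \<longrightarrow> z \<in> S\<^sub>X \<and> f i z > 1 - a / 2" by blast
  qed
  then obtain z where z: "\<And>i. i < n \<Longrightarrow> z i \<in> S\<^sub>X" "\<And>i. i < n \<Longrightarrow> f i (z i) > 1 - a / 2"
    by metis
  define \<delta> where "\<delta> = min (\<epsilon> / 2) (a / 2)"
  have d: "\<delta> > 0" "\<delta> \<le> \<epsilon> / 2" "\<delta> \<le> a / 2" using e a by (auto simp: \<delta>_def)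
  \<comment> \<open>Rounding costs up to \<open>2 * n\<close> in the norm and up to \<open>n\<close>
    in the total weight. Comparing \<open>K * (2 - \<epsilon>) + 2 * n\<close> with
    \<open>(2 - \<epsilon> / 2) * (K - n)\<close> leads to
    \<open>K * \<epsilon> \<ge> 8 * n\<close>; the bound \<open>K > n\<close> keeps the total weight
    positive.\<close>
  obtain K :: nat where K: "real K > n + 8 * n / \<epsilon>" using reals_Archimedean2 by blast
  have Kn: "real K > n" and Ke: "real K * \<epsilon> \<ge> 8 * n"
  proof -
    have "8 * real n / \<epsilon> \<ge> 0" using e by simp
    then show "real K > n" using K by linarith
    have "8 * real n / \<epsilon> < real K" using K by linarith
    then show "real K * \<epsilon> \<ge> 8 * n" using e by (simp add: field_simps)
  qed
  define k where "k i = nat \<lfloor>K * l i\<rfloor>" for i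
  have k: "\<bar>K * l i - k i\<bar> \<le> 1" "real (k i) \<le> K * l i" if "i < n" for i
  proof -
    have "real (k i) = of_int \<lfloor>K * l i\<rfloor>" unfolding k_def using l(1)[OF that] by simp
    then show "\<bar>K * l i - k i\<bar> \<le> 1" "real (k i) \<le> K * l i" by linarith+
  qed
  have ksum: "(\<Sum>i<n. real (k i)) \<ge> real K - real n"
  proof -
    have "K * l i - 1 \<le> real (k i)" if "i < n" for i using k(1)[OF that] by linarith
    then have "(\<Sum>i<n. K * l i - 1) \<le> (\<Sum>i<n. real (k i))" by (intro sum_mono) auto
    then show ?thesis using l(2) by (simp add: sum_subtractf sum_distrib_left[symmetric])
  qed
  \<comment> \<open>This gives \<open>2 - \<delta> \<ge> 0\<close>, which the last product estimate
    requires.\<close>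
  have e2: "\<epsilon> \<le> 2"
  proof -
    obtain u where u: "u \<in> ?A" using ne by blast
    have "N (u - u) \<le> 2 - \<epsilon>" using e(2)[OF u u] .
    then show ?thesis by simp
  qed
  have "slices_gap z n k \<delta>"
    unfolding slices_gap_def
  proof (intro exI[of _ f] conjI allI impI)
    fix i assume i: "i < n"
    show "f i \<in> D\<^sub>X" by (rule dual_sphere_subset_ball[OF f(1)[OF i]])
    show "\<delta> \<le> f i (z i)" using z(2)[OF i] a(2) d(3) by linarith
  next
    fix x y
    assume xy: "\<forall>i<n. x i \<in> B\<^sub>X \<and> f i (z i) - \<delta> < f i (x i) \<and> y i \<in> B\<^sub>X \<and> f i (z i) - \<delta> < f i (y i)"
    have sl: "x i \<in> slice S N (f i) (\<alpha> i)" "y i \<in> slice S N (f i) (\<alpha> i)" if "i < n" for i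
    proof -
      have "f i (z i) - \<delta> < f i (x i)" "f i (z i) - \<delta> < f i (y i)" using xy that by auto
      then have "1 - \<alpha> i < f i (x i)" "1 - \<alpha> i < f i (y i)"
        using z(2)[OF that] ai[OF that] d(3) by linarith+
      then show "x i \<in> slice S N (f i) (\<alpha> i)" "y i \<in> slice S N (f i) (\<alpha> i)" using xy that by (auto simp: slice_def)
    qed
    have xyS: "x i - y i \<in> S" "N (x i - y i) \<le> 2" if "i < n" for i
      using xy that N_diff[of "x i" "y i"] by (force simp: unit_ball_def)+
    have eq: "(\<Sum>i<n. real (k i) *\<^sub>R (x i - y i)) =
        real K *\<^sub>R (\<Sum>i<n. l i *\<^sub>R (x i - y i)) - (\<Sum>i<n. (K * l i - k i) *\<^sub>R (x i - y i))"
      by (simp add: scaleR_sum_right scaleR_diff_left sum_subtractf)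
    have "N (\<Sum>i<n. (K * l i - k i) *\<^sub>R (x i - y i)) \<le> (\<Sum>i<n. N ((K * l i - k i) *\<^sub>R (x i - y i)))"
      using xyS by (intro N_sum) auto
    also have "\<dots> \<le> (\<Sum>i<n. 1 * 2)"
    proof (intro sum_mono)
      fix i assume "i \<in> {..<n}"
      then have i: "i < n" by simp
      have "\<bar>K * l i - k i\<bar> * N (x i - y i) \<le> 1 * 2"
        using k(1)[OF i] xyS[OF i] N_nonneg by (intro mult_mono) auto
      then show "N ((K * l i - k i) *\<^sub>R (x i - y i)) \<le> 1 * 2" using xyS[OF i] by (simp add: N_scale)
    qed
    finally have b: "N (\<Sum>i<n. (K * l i - k i) *\<^sub>R (x i - y i)) \<le> 2 * n" by simp
    have S1: "(\<Sum>i<n. l i *\<^sub>R (x i - y i)) \<in> S" and S2: "(\<Sum>i<n. (K * l i - k i) *\<^sub>R (x i - y i)) \<in> S"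
      using xyS by (auto intro!: sum_mem)
    have "N (\<Sum>i<n. real (k i) *\<^sub>R (x i - y i)) \<le> real K * N (\<Sum>i<n. l i *\<^sub>R (x i - y i)) + 2 * n"
      unfolding eq using N_diff[OF scale_mem[OF S1, of "real K"] S2] b by (simp add: N_scale[OF S1])
    also have "\<dots> \<le> real K * (2 - \<epsilon>) + 2 * n"
      using conv[of x y] sl by (intro add_right_mono mult_left_mono) auto
    also have "\<dots> \<le> (2 - \<epsilon> / 2) * (real K - real n)"
    proof -
      have "\<epsilon> * n \<ge> 0" using e by simp
      then have "(2 - \<epsilon> / 2) * (real K - real n) \<ge> 2 * K - (K * \<epsilon>) / 2 - 2 * n" by (simp add: algebra_simps)
      moreover have "real K * (2 - \<epsilon>) + 2 * n = 2 * K - K * \<epsilon> + 2 * n" by (simp add: algebra_simps)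
      ultimately show ?thesis using Ke by linarith
    qed
    also have "\<dots> \<le> (2 - \<delta>) * (\<Sum>i<n. real (k i))"
      using d e2 ksum Kn by (intro mult_mono) auto
    finally show "N (\<Sum>i<n. real (k i) *\<^sub>R (x i - y i)) \<le> (2 - \<delta>) * (\<Sum>i<n. real (k i))" .
  qed
  moreover have "(\<Sum>i<n. k i) > 0" using ksum Kn by (simp flip: of_nat_sum)
  ultimately show ?R using d(1) z(1) by blast
next
  assume ?R
  then obtain n l z \<delta> where d: "\<delta> > 0" and z: "\<And>i. i < n \<Longrightarrow> z i \<in> S\<^sub>X" and lp: "(\<Sum>i<n. l i) > (0::nat)"
    and g: "slices_gap z n l \<delta>" by blast
  obtain F where F: "\<And>i. i < n \<Longrightarrow> F i \<in> D\<^sub>X" "\<And>i. i < n \<Longrightarrow> \<delta> \<le> F i (z i)"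
    "\<And>x y. \<forall>i<n. x i \<in> B\<^sub>X \<and> F i (z i) - \<delta> < F i (x i) \<and>
                    y i \<in> B\<^sub>X \<and> F i (z i) - \<delta> < F i (y i) \<Longrightarrow>
        N (\<Sum>i<n. real (l i) *\<^sub>R (x i - y i)) \<le> (2 - \<delta>) * (\<Sum>i<n. real (l i))"
    using g unfolding slices_gap_def by blast
  define L where "L = (\<Sum>i<n. real (l i))"
  have L: "L > 0" using lp by (simp add: L_def flip: of_nat_sum)
  have zS: "z i \<in> S" "z i \<in> B\<^sub>X" if "i < n" for i
    using z[OF that] by (auto simp: unit_sphere_def unit_ball_def)
  have "\<forall>i. \<exists>t. i < n \<longrightarrow> t > 0 \<and> (\<lambda>x. F i x / t) \<in> dual_sphere S N \<and> F i (z i) \<le> t"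
  proof (intro allI)
    fix i show "\<exists>t. i < n \<longrightarrow> t > 0 \<and> (\<lambda>x. F i x / t) \<in> dual_sphere S N \<and> F i (z i) \<le> t"
      using dual_normalize[OF F(1)[of i] zS(1)[of i]] F(2)[of i] d zS(2)[of i] by (metis not_le)
  qed
  then obtain t where t: "\<And>i. i < n \<Longrightarrow> t i > 0" "\<And>i. i < n \<Longrightarrow> (\<lambda>x. F i x / t i) \<in> dual_sphere S N"
    "\<And>i. i < n \<Longrightarrow> F i (z i) \<le> t i" by metis
  define \<alpha> where "\<alpha> i = 1 - (F i (z i) - \<delta>) / t i" for i
  have a: "\<alpha> i > 0" if "i < n" for i using t(1,3)[OF that] d by (simp add: \<alpha>_def)
  have cap: "x \<in> B\<^sub>X \<and> F i (z i) - \<delta> < F i x" if "i < n" "x \<in> slice S N (\<lambda>x. F i x / t i) (\<alpha> i)" for i x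
    using that(2) t(1)[OF that(1)] by (simp add: slice_def \<alpha>_def divide_less_cancel)
  let ?A = "{\<Sum>i<n. (l i / L) *\<^sub>R x i | x. \<forall>i<n. x i \<in> slice S N (\<lambda>x. F i x / t i) (\<alpha> i)}"
  have l1: "(\<Sum>i<n. l i / L) = 1" using L by (simp add: L_def sum_divide_distrib[symmetric])
  have sub: "?A \<subseteq> B\<^sub>X"
    using convex_combination_in_ball[of n "\<lambda>i. l i / L"] l1 L cap by fastforce
  have "z i \<in> slice S N (\<lambda>x. F i x / t i) (\<alpha> i)" if "i < n" for i
    using zS[OF that] t(1)[OF that] d by (simp add: slice_def \<alpha>_def divide_less_cancel)
  then have ne: "?A \<noteq> {}" by blast
  have "N (u - v) \<le> 2 - \<delta>" if uv: "u \<in> ?A" "v \<in> ?A" for u v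
  proof -
    obtain x where x: "u = (\<Sum>i<n. (l i / L) *\<^sub>R x i)" "\<And>i. i < n \<Longrightarrow> x i \<in> slice S N (\<lambda>x. F i x / t i) (\<alpha> i)"
      using uv(1) by blast
    obtain y where y: "v = (\<Sum>i<n. (l i / L) *\<^sub>R y i)" "\<And>i. i < n \<Longrightarrow> y i \<in> slice S N (\<lambda>x. F i x / t i) (\<alpha> i)"
      using uv(2) by blast
    have eq: "u - v = (1 / L) *\<^sub>R (\<Sum>i<n. real (l i) *\<^sub>R (x i - y i))"
      by (simp add: x(1) y(1) scaleR_sum_right scaleR_diff_right sum_subtractf)
    have m: "(\<Sum>i<n. real (l i) *\<^sub>R (x i - y i)) \<in> S"
      using x(2) y(2) cap by (fastforce intro!: sum_mem simp: unit_ball_def)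
    have "N (\<Sum>i<n. real (l i) *\<^sub>R (x i - y i)) \<le> (2 - \<delta>) * L"
      unfolding L_def using x(2) y(2) cap by (intro F(3)) blast
    then show ?thesis unfolding eq using L by (simp add: N_scale[OF m] pos_divide_le_eq)
  qed
  then have "ndiam N ?A \<noteq> 2" using ndiam_neq_2_iff[OF sub ne] d by blast
  moreover have "n \<ge> 1" using lp by (cases n) auto
  ultimately show ?L
    unfolding SD2P_def not_all not_imp using l1 L t(2) a
    by (intro exI[of _ n] exI[of _ "\<lambda>i. l i / L"] exI[of _ "\<lambda>i x. F i x / t i"] exI[of _ \<alpha>]) auto
qed

text \<open>A common strengthening of the five properties: every weak neighbourhood of
  \<open>z\<close> in the ball contains a \<open>y\<close> whose norm almost adds up with that of
  \<open>x\<close>. The vector \<open>x\<close> is not normalised, so that partial sums can take its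
  place.\<close>

definition diffuse :: bool where
  "diffuse \<longleftrightarrow> (\<forall>x\<in>S. \<forall>z\<in>B\<^sub>X. \<forall>G \<delta> \<epsilon>. finite G \<and> G \<subseteq> dual_space S N \<and> \<delta> > 0 \<and> \<epsilon> > 0 \<longrightarrow>
     (\<exists>y\<in>B\<^sub>X. (\<forall>f\<in>G. \<bar>f y - f z\<bar> < \<delta>) \<and> N x + N z - \<epsilon> < N (x + y)))"

lemma diffuseD:
  assumes "diffuse" "x \<in> S" "z \<in> B\<^sub>X" "finite G" "G \<subseteq> dual_space S N" "\<delta> > 0" "\<epsilon> > 0"
  obtains y where "y \<in> B\<^sub>X" "\<And>f. f \<in> G \<Longrightarrow> \<bar>f y - f z\<bar> < \<delta>" "N x + N z - \<epsilon> < N (x + y)"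
proof -
  have "\<exists>y\<in>B\<^sub>X. (\<forall>f\<in>G. \<bar>f y - f z\<bar> < \<delta>) \<and> N x + N z - \<epsilon> < N (x + y)"
    using assms unfolding diffuse_def by blast
  then show ?thesis using that by blast
qed

lemma diffuse_not_point_gap:
  assumes "diffuse" "x \<in> S\<^sub>X" "z \<in> S\<^sub>X" "\<delta> > 0"
  shows "\<not> point_gap x z n \<delta>"
proof
  assume "point_gap x z n \<delta>"
  then obtain F where F: "\<And>i. i < n \<Longrightarrow> F i \<in> D\<^sub>X"
    "\<And>y. y \<in> B\<^sub>X \<Longrightarrow> \<forall>i<n. F i z - \<delta> < F i y \<Longrightarrow> N (x - y) \<le> 2 - \<delta>"
    unfolding point_gap_def by auto
  have xS: "x \<in> S" "N x = 1" "z \<in> S" "N z = 1" using assms by (auto simp: unit_sphere_def)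
  \<comment> \<open>Diffuseness is applied to \<open>- x\<close>: the norm of \<open>- x + y\<close>
    is the distance from \<open>x\<close> to \<open>y\<close>.\<close>
  obtain y where y: "y \<in> B\<^sub>X" "\<And>f. f \<in> F ` {..<n} \<Longrightarrow> \<bar>f y - f z\<bar> < \<delta>" "N (- x) + N z - \<delta> < N (- x + y)"
  proof (rule diffuseD[OF assms(1), of "- x" z "F ` {..<n}" \<delta> \<delta>])
    show "F ` {..<n} \<subseteq> dual_space S N" using F(1) dual_ball_space by auto
  qed (use xS unit_sphere_subset_ball[OF assms(3)] assms(4) in auto)
  have "F i z - \<delta> < F i y" if "i < n" for i using y(2)[of "F i"] that by force
  then have "N (x - y) \<le> 2 - \<delta>" using F(2) y(1) by blast
  moreover have "N (- x + y) = N (x - y)" using N_minus_commute[of y x] y(1) xS by (simp add: unit_ball_def)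
  ultimately show False using y(3) xS by (simp add: N_uminus)
qed

text \<open>A summand of weight \<open>l > 0\<close> is reduced to weight 1 by dividing
  \<open>h\<close> by \<open>l\<close>; this is possible because \<open>diffuse\<close> puts no
  restriction on the norm of its first vector.\<close>

lemma diffuse_extend:
  assumes "diffuse" "h \<in> S" "z \<in> S\<^sub>X" "f \<in> dual_space S N" "\<delta> > 0" "\<epsilon> > 0" "l \<ge> 0"
  obtains y where "y \<in> B\<^sub>X" "\<bar>f y - f z\<bar> < \<delta>" "N h + l - \<epsilon> < N (h + l *\<^sub>R y)"
proof (cases "l = 0")
  case True
  then show ?thesis using assms that[of z] unit_sphere_subset_ball by auto
next
  case False
  then have l: "l > 0" using assms by simp
  obtain y where y: "y \<in> B\<^sub>X" "\<bar>f y - f z\<bar> < \<delta>"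
    "N ((1/l) *\<^sub>R h) + N z - \<epsilon> / l < N ((1/l) *\<^sub>R h + y)"
    using diffuseD[OF assms(1) scale_mem[OF assms(2), of "1/l"] unit_sphere_subset_ball[OF assms(3)], of "{f}" \<delta> "\<epsilon> / l"]
      assms l by auto
  have yS: "y \<in> S" using y by (simp add: unit_ball_def)
  have eq: "h + l *\<^sub>R y = l *\<^sub>R ((1/l) *\<^sub>R h + y)" using l by (simp add: scaleR_add_right)
  have "N (h + l *\<^sub>R y) = l * N ((1/l) *\<^sub>R h + y)"
    unfolding eq using l N_scale[OF add_mem[OF scale_mem[OF assms(2), of "1/l"] yS], of l] by simp
  moreover have "l * (N ((1/l) *\<^sub>R h) + N z - \<epsilon> / l) = N h + l - \<epsilon>"
    using l assms(2,3) by (simp add: N_scale unit_sphere_def field_simps)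
  ultimately show ?thesis using that[OF y(1,2)] y(3) l by (metis mult_strict_left_mono)
qed

text \<open>The difference of the two combinations is built one index at a time. Index
  \<open>k\<close> contributes \<open>a\<close>, close to \<open>z k\<close> under
  \<open>F k\<close>, and then \<open>b\<close>, close to \<open>- z k\<close>; each raises the norm
  by almost \<open>l k\<close>. Taking \<open>x k = a\<close> and \<open>y k = - b\<close>, the sum
  reaches almost twice the total weight.\<close>

lemma diffuse_not_slices_gap:
  assumes D: "diffuse" and z: "\<And>i. i < n \<Longrightarrow> z i \<in> S\<^sub>X" and d: "\<delta> > 0" and l: "(\<Sum>i<n. l i) > (0::nat)"
  shows "\<not> slices_gap z n l \<delta>"
proof
  assume "slices_gap z n l \<delta>"
  then obtain F where F: "\<And>i. i < n \<Longrightarrow> F i \<in> D\<^sub>X"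
    "\<And>x y. \<forall>i<n. x i \<in> B\<^sub>X \<and> F i (z i) - \<delta> < F i (x i) \<and>
                    y i \<in> B\<^sub>X \<and> F i (z i) - \<delta> < F i (y i) \<Longrightarrow>
        N (\<Sum>i<n. real (l i) *\<^sub>R (x i - y i)) \<le> (2 - \<delta>) * (\<Sum>i<n. real (l i))"
    unfolding slices_gap_def by blast
  have "\<exists>x y. (\<forall>i<k. x i \<in> B\<^sub>X \<and> F i (z i) - \<delta> < F i (x i) \<and>
                    y i \<in> B\<^sub>X \<and> F i (z i) - \<delta> < F i (y i)) \<and>
      N (\<Sum>i<k. real (l i) *\<^sub>R (x i - y i)) > 2 * (\<Sum>i<k. real (l i)) - \<epsilon>"
    if "k \<le> n" "\<epsilon> > 0" for k \<epsilon>
    using that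
  proof (induction k arbitrary: \<epsilon>)
    case 0
    then show ?case by simp
  next
    case (Suc k)
    obtain x y where xy: "\<forall>i<k. x i \<in> B\<^sub>X \<and> F i (z i) - \<delta> < F i (x i) \<and>
                    y i \<in> B\<^sub>X \<and> F i (z i) - \<delta> < F i (y i)"
      "N (\<Sum>i<k. real (l i) *\<^sub>R (x i - y i)) > 2 * (\<Sum>i<k. real (l i)) - \<epsilon> / 3"
      using Suc.IH[of "\<epsilon> / 3"] Suc.prems by auto
    let ?h = "\<Sum>i<k. real (l i) *\<^sub>R (x i - y i)"
    have h: "?h \<in> S" using xy(1) by (intro sum_mem) (auto simp: unit_ball_def)
    have fd: "F k \<in> dual_space S N" using F(1)[of k] Suc.prems dual_ball_space by auto
    have zk: "z k \<in> S\<^sub>X" "- z k \<in> S\<^sub>X" "z k \<in> S"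
      using z[of k] Suc.prems by (auto simp: unit_sphere_def N_uminus)
    obtain a where a: "a \<in> B\<^sub>X" "\<bar>F k a - F k (z k)\<bar> < \<delta>" "N ?h + l k - \<epsilon> / 3 < N (?h + real (l k) *\<^sub>R a)"
      using diffuse_extend[OF D h zk(1) fd d, of "\<epsilon> / 3" "real (l k)"] Suc.prems by auto
    have aS: "a \<in> S" using a by (simp add: unit_ball_def)
    obtain b where b: "b \<in> B\<^sub>X" "\<bar>F k b - F k (- z k)\<bar> < \<delta>"
       "N (?h + real (l k) *\<^sub>R a) + l k - \<epsilon> / 3 < N (?h + real (l k) *\<^sub>R a + real (l k) *\<^sub>R b)"
      using diffuse_extend[OF D add_mem[OF h scale_mem[OF aS, of "l k"]] zk(2) fd d, of "\<epsilon> / 3" "real (l k)"] Suc.prems by auto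
    have bS: "b \<in> S" using b by (simp add: unit_ball_def)
    let ?x = "x(k := a)" and ?y = "y(k := - b)"
    have "\<forall>i<Suc k. ?x i \<in> B\<^sub>X \<and> F i (z i) - \<delta> < F i (?x i) \<and>
                    ?y i \<in> B\<^sub>X \<and> F i (z i) - \<delta> < F i (?y i)"
    proof (intro allI impI)
      fix i assume "i < Suc k"
      then consider "i < k" | "i = k" by linarith
      then show "?x i \<in> B\<^sub>X \<and> F i (z i) - \<delta> < F i (?x i) \<and>
                    ?y i \<in> B\<^sub>X \<and> F i (z i) - \<delta> < F i (?y i)"
      proof cases
        case 2
        then show ?thesis using a b dual_uminus[OF fd zk(3)] dual_uminus[OF fd bS] bS
          by (auto simp: unit_ball_def N_uminus)
      qed (use xy in auto)
    qed
    moreover have eq: "(\<Sum>i<Suc k. real (l i) *\<^sub>R (?x i - ?y i)) = ?h + real (l k) *\<^sub>R a + real (l k) *\<^sub>R b"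
    proof -
      have "(\<Sum>i<k. real (l i) *\<^sub>R (?x i - ?y i)) = ?h" by (intro sum.cong) auto
      then show ?thesis by (simp add: scaleR_add_right)
    qed
    moreover have "N (\<Sum>i<Suc k. real (l i) *\<^sub>R (?x i - ?y i)) > 2 * (\<Sum>i<Suc k. real (l i)) - \<epsilon>"
      proof -
      have "p > 2 * (s + m) - \<epsilon>"
        if "p' + m - \<epsilon> / 3 < p" "p'' + m - \<epsilon> / 3 < p'" "p'' > 2 * s - \<epsilon> / 3" for p p' p'' s m :: real
        using that by argo
      from this[OF b(3) a(3) xy(2)] show ?thesis unfolding eq unfolding sum.lessThan_Suc .
    qed
    ultimately show ?case by blast
  qed
  moreover have "\<delta> * (\<Sum>i<n. real (l i)) > 0" using d l by (simp flip: of_nat_sum)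
  ultimately obtain x y where "\<forall>i<n. x i \<in> B\<^sub>X \<and> F i (z i) - \<delta> < F i (x i) \<and>
                    y i \<in> B\<^sub>X \<and> F i (z i) - \<delta> < F i (y i)"
      "N (\<Sum>i<n. real (l i) *\<^sub>R (x i - y i)) > 2 * (\<Sum>i<n. real (l i)) - \<delta> * (\<Sum>i<n. real (l i))"
    by blast
  then show False using F(2)[of x y] by (auto simp: algebra_simps)
qed

lemma diffuse_imp:
  assumes "diffuse"
  shows "LD2P S N" "SD2P S N" "DLD2P S N" "DD2P S N" "Daugavet S N"
proof -
  show "LD2P S N" using not_LD2P_iff diffuse_not_slices_gap[OF assms, of 1 _ _ "\<lambda>_. 1"] by auto
  show "SD2P S N" using not_SD2P_iff diffuse_not_slices_gap[OF assms] by metis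
  show "DLD2P S N" using not_DLD2P_iff diffuse_not_point_gap[OF assms] by blast
  show "DD2P S N" using not_DD2P_iff diffuse_not_point_gap[OF assms] by blast
  show "Daugavet S N" using not_Daugavet_iff diffuse_not_point_gap[OF assms] by blast
qed

text \<open>LD2P is the weakest of the five: fixing one of the two points of a slice at
  \<open>z\<close> turns its small diameter into a point gap at \<open>z\<close>, and a single slice
  is a convex combination of slices.\<close>

lemma not_LD2P_imp:
  assumes "\<not> LD2P S N"
  shows "\<not> SD2P S N" "\<not> DLD2P S N" "\<not> DD2P S N" "\<not> Daugavet S N"
proof -
  obtain z \<delta> where z: "z \<in> S\<^sub>X" "\<delta> > 0" "slices_gap (\<lambda>_. z) 1 (\<lambda>_. 1) \<delta>"
    using assms not_LD2P_iff by blast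
  then show "\<not> SD2P S N"
    unfolding not_SD2P_iff by (intro exI[of _ 1] exI[of _ "\<lambda>_. 1"] exI[of _ "\<lambda>_. z"] exI[of _ \<delta>]) auto
  obtain F where F: "F 0 \<in> D\<^sub>X"
    "\<And>x y. \<forall>i<(1::nat). x i \<in> B\<^sub>X \<and> F i z - \<delta> < F i (x i) \<and> y i \<in> B\<^sub>X \<and> F i z - \<delta> < F i (y i) \<Longrightarrow>
      N (\<Sum>i<1. real 1 *\<^sub>R (x i - y i)) \<le> (2 - \<delta>) * (\<Sum>i<(1::nat). real 1)"
    using z(3) unfolding slices_gap_def by blast
  have "N (z - y) \<le> 2 - \<delta>" if "y \<in> B\<^sub>X" "F 0 z - \<delta> < F 0 y" for y
    using F(2)[of "\<lambda>_. z" "\<lambda>_. y"] that z(2) unit_sphere_subset_ball[OF z(1)] by simp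
  then have "point_gap z z 1 \<delta>"
    unfolding point_gap_def using F(1) by (intro exI[of _ F]) auto
  then show "\<not> DLD2P S N" "\<not> DD2P S N" "\<not> Daugavet S N"
    unfolding not_DLD2P_iff not_DD2P_iff not_Daugavet_iff using z(1,2) by blast+
qed

end

section \<open>Extension from rational vectors and the completion\<close>

text \<open>Two instances matter: \<open>c00\<close> with a weighted \<open>l1\<close> norm, used to
  construct \<open>mubar\<close>, and the completion, used to extend functionals from
  \<open>Vset\<close>.\<close>

locale dense_rational = seminormed_space S N for S :: "'a::real_vector set" and N +
  fixes \<iota> :: "(nat \<Rightarrow> rat) \<Rightarrow> 'a"
  assumes \<iota>_mem [simp]: "v \<in> Vset \<Longrightarrow> \<iota> v \<in> S"
    and \<iota>_add: "v \<in> Vset \<Longrightarrow> w \<in> Vset \<Longrightarrow> \<iota> (\<lambda>n. v n + w n) = \<iota> v + \<iota> w"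
    and \<iota>_scale: "v \<in> Vset \<Longrightarrow> \<iota> (\<lambda>n. q * v n) = real_of_rat q *\<^sub>R \<iota> v"
    and dense: "s \<in> S \<Longrightarrow> \<epsilon> > 0 \<Longrightarrow> \<exists>v\<in>Vset. N (s - \<iota> v) < \<epsilon>"

lemma Vset_add [simp]: "v \<in> Vset \<Longrightarrow> w \<in> Vset \<Longrightarrow> (\<lambda>n. v n + w n) \<in> Vset"
  and Vset_diff [simp]: "v \<in> Vset \<Longrightarrow> w \<in> Vset \<Longrightarrow> (\<lambda>n. v n - w n) \<in> Vset"
  unfolding Vset_def mem_Collect_eq
  by (erule (1) finite_subset[OF _ finite_UnI, rotated]; auto)+

lemma Vset_scale [simp]: "v \<in> Vset \<Longrightarrow> (\<lambda>n. q * v n) \<in> Vset"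
  unfolding Vset_def mem_Collect_eq by (erule finite_subset[rotated]) auto

lemma Vset_zero [simp]: "(\<lambda>n. 0) \<in> Vset"
  by (simp add: Vset_def)

lemma Vset_sum [simp]: "(\<And>i. i \<in> I \<Longrightarrow> v i \<in> Vset) \<Longrightarrow> (\<lambda>n. \<Sum>i\<in>I. v i n) \<in> Vset"
  by (induction I rule: infinite_finite_induct) auto

context dense_rational
begin

lemma \<iota>_diff: "v \<in> Vset \<Longrightarrow> w \<in> Vset \<Longrightarrow> \<iota> (\<lambda>n. v n - w n) = \<iota> v - \<iota> w"
  using \<iota>_add[of v "\<lambda>n. -1 * w n"] \<iota>_scale[of w "-1"] Vset_scale[of w "-1"] by simp

lemma \<iota>_zero: "\<iota> (\<lambda>n. 0) = 0"
  using \<iota>_scale[of "\<lambda>n. 0" 0] by simp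

lemma \<iota>_sum: "(\<And>i. i \<in> I \<Longrightarrow> v i \<in> Vset) \<Longrightarrow> \<iota> (\<lambda>n. \<Sum>i\<in>I. v i n) = (\<Sum>i\<in>I. \<iota> (v i))"
  by (induction I rule: infinite_finite_induct) (auto simp: \<iota>_zero \<iota>_add)

text \<open>The McShane extension, as a supremum of cones. The one estimate it returns contains
  agreement on \<open>Vset\<close> (take \<open>s = \<iota> v\<close>) and, by density,
  uniqueness.\<close>

lemma lipschitz_extension:
  assumes L: "\<And>v w. v \<in> Vset \<Longrightarrow> w \<in> Vset \<Longrightarrow> \<phi> v - \<phi> w \<le> N (\<iota> v - \<iota> w)"
  obtains \<Phi> :: "'a \<Rightarrow> real" where "\<And>s v. s \<in> S \<Longrightarrow> v \<in> Vset \<Longrightarrow> \<bar>\<Phi> s - \<phi> v\<bar> \<le> N (s - \<iota> v)"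
proof
  fix s v assume s: "s \<in> S" and v: "v \<in> Vset"
  let ?A = "(\<lambda>v. \<phi> v - N (s - \<iota> v)) ` Vset"
  have le: "\<phi> u - N (s - \<iota> u) \<le> \<phi> w + N (s - \<iota> w)" if "u \<in> Vset" "w \<in> Vset" for u w
    using L[OF that] N_diff_trans[of "\<iota> u" s "\<iota> w"] N_minus_commute[of "\<iota> u" s] s that by simp
  have "\<phi> v - N (s - \<iota> v) \<le> Sup ?A" using le[OF _ v] v by (intro cSup_upper) (auto simp: bdd_above_def)
  moreover have "Sup ?A \<le> \<phi> v + N (s - \<iota> v)" using le[OF _ v] v by (intro cSup_least) auto
  ultimately show "\<bar>Sup ((\<lambda>v. \<phi> v - N (s - \<iota> v)) ` Vset) - \<phi> v\<bar> \<le> N (s - \<iota> v)" by linarith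
qed

lemma extension_eq:
  assumes "\<And>s v. s \<in> S \<Longrightarrow> v \<in> Vset \<Longrightarrow> \<bar>\<Phi> s - \<phi> v\<bar> \<le> N (s - \<iota> v)" "v \<in> Vset"
  shows "\<Phi> (\<iota> v) = \<phi> v"
  using assms(1)[of "\<iota> v" v] assms(2) by simp

lemma extension_unique:
  assumes "\<And>s v. s \<in> S \<Longrightarrow> v \<in> Vset \<Longrightarrow> \<bar>\<Phi> s - \<phi> v\<bar> \<le> N (s - \<iota> v)"
    "\<And>s v. s \<in> S \<Longrightarrow> v \<in> Vset \<Longrightarrow> \<bar>\<Psi> s - \<phi> v\<bar> \<le> N (s - \<iota> v)" "s \<in> S"
  shows "\<Phi> s = \<Psi> s"
proof -
  have "\<bar>\<Phi> s - \<Psi> s\<bar> \<le> \<epsilon>" if e: "\<epsilon> > 0" for \<epsilon>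
  proof -
    obtain v where v: "v \<in> Vset" "N (s - \<iota> v) < \<epsilon> / 2" using dense[OF assms(3), of "\<epsilon> / 2"] e by auto
    show ?thesis using assms(1)[OF assms(3) v(1)] assms(2)[OF assms(3) v(1)] v(2) by linarith
  qed
  then have "\<bar>\<Phi> s - \<Psi> s\<bar> \<le> 0" by (rule field_le_epsilon) simp
  then show ?thesis by simp
qed

lemma extension_subadditive:
  assumes \<Phi>: "\<And>s v. s \<in> S \<Longrightarrow> v \<in> Vset \<Longrightarrow> \<bar>\<Phi> s - \<phi> v\<bar> \<le> N (s - \<iota> v)"
    and sub: "\<And>v w. v \<in> Vset \<Longrightarrow> w \<in> Vset \<Longrightarrow> \<phi> (\<lambda>n. v n + w n) \<le> \<phi> v + \<phi> w"
    and st: "s \<in> S" "t \<in> S"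
  shows "\<Phi> (s + t) \<le> \<Phi> s + \<Phi> t"
proof (rule field_le_epsilon)
  fix \<epsilon> :: real assume e: "\<epsilon> > 0"
  obtain v where v: "v \<in> Vset" "N (s - \<iota> v) < \<epsilon> / 4" using dense[OF st(1), of "\<epsilon> / 4"] e by auto
  obtain w where w: "w \<in> Vset" "N (t - \<iota> w) < \<epsilon> / 4" using dense[OF st(2), of "\<epsilon> / 4"] e by auto
  have eq: "s + t - \<iota> (\<lambda>n. v n + w n) = (s - \<iota> v) + (t - \<iota> w)" using v w by (simp add: \<iota>_add)
  have "N (s + t - \<iota> (\<lambda>n. v n + w n)) \<le> \<epsilon> / 4 + \<epsilon> / 4"
    unfolding eq using N_add[of "s - \<iota> v" "t - \<iota> w"] v w st by simp
  then show "\<Phi> (s + t) \<le> \<Phi> s + \<Phi> t + \<epsilon>"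
    using \<Phi>[of "s + t" "\<lambda>n. v n + w n"] \<Phi>[OF st(1) v(1)] \<Phi>[OF st(2) w(1)] sub[OF v(1) w(1)] v w st
    by simp
qed

text \<open>A general 1-Lipschitz \<open>h\<close> with \<open>h 0 = 0\<close> covers seminorms
  (\<open>h = abs\<close>) and functionals (\<open>h\<close> the identity) in one argument.\<close>

lemma extension_homogeneous:
  assumes \<Phi>: "\<And>s v. s \<in> S \<Longrightarrow> v \<in> Vset \<Longrightarrow> \<bar>\<Phi> s - \<phi> v\<bar> \<le> N (s - \<iota> v)"
    and hom: "\<And>q v. v \<in> Vset \<Longrightarrow> \<phi> (\<lambda>n. q * v n) = h (real_of_rat q) * \<phi> v"
    and h: "\<And>a b. \<bar>h a - h b\<bar> \<le> \<bar>a - b\<bar>" "h 0 = 0"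
    and s: "s \<in> S"
  shows "\<Phi> (c *\<^sub>R s) = h c * \<Phi> s"
proof -
  have hle: "\<bar>h a\<bar> \<le> \<bar>a\<bar>" for a using h(1)[of a 0] h(2) by simp
  have "\<bar>\<Phi> (c *\<^sub>R s) - h c * \<Phi> s\<bar> \<le> \<epsilon>" if e: "\<epsilon> > 0" for \<epsilon>
  proof -
    \<comment> \<open>\<open>\<eta>\<close> bounds the errors of both rational approximations, of
      \<open>c\<close> and of \<open>s\<close>; \<open>\<eta> * C\<close> is the sum of the two
      resulting estimates.\<close>
    define C where "C = N s + \<bar>\<Phi> s\<bar> + 2 * (\<bar>c\<bar> + 1)"
    have C: "C > 0" using N_nonneg[OF s] by (simp add: C_def add_nonneg_pos)
    define \<eta> where "\<eta> = min 1 (\<epsilon> / C)"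
    have \<eta>: "\<eta> > 0" "\<eta> \<le> 1" "\<eta> * C \<le> \<epsilon>" using e C by (auto simp: \<eta>_def min_def field_simps)
    obtain q where q: "c - \<eta> < real_of_rat q" "real_of_rat q < c" using of_rat_dense[of "c - \<eta>" c] \<eta> by auto
    obtain v where v: "v \<in> Vset" "N (s - \<iota> v) < \<eta>" using dense[OF s \<eta>(1)] by auto
    let ?q = "real_of_rat q"
    have q1: "\<bar>c - ?q\<bar> \<le> \<eta>" "\<bar>?q\<bar> \<le> \<bar>c\<bar> + 1" using q \<eta> by linarith+
    have qn: "\<bar>?q\<bar> * N (s - \<iota> v) \<le> (\<bar>c\<bar> + 1) * \<eta>" using q1 v N_nonneg[of "s - \<iota> v"] s by (intro mult_mono) auto
    have "N (c *\<^sub>R s - \<iota> (\<lambda>n. q * v n)) \<le> N ((c - ?q) *\<^sub>R s) + N (?q *\<^sub>R (s - \<iota> v))"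
      using N_add[of "(c - ?q) *\<^sub>R s" "?q *\<^sub>R (s - \<iota> v)"] s v
      by (simp add: \<iota>_scale algebra_simps)
    also have "\<dots> \<le> \<eta> * N s + (\<bar>c\<bar> + 1) * \<eta>"
      using q1 qn N_nonneg[OF s] s v by (simp add: N_scale add_mono mult_right_mono)
    finally have 1: "\<bar>\<Phi> (c *\<^sub>R s) - h ?q * \<phi> v\<bar> \<le> \<eta> * N s + (\<bar>c\<bar> + 1) * \<eta>"
      using \<Phi>[of "c *\<^sub>R s" "\<lambda>n. q * v n"] s v by (simp add: hom)
    have "h c * \<Phi> s - h ?q * \<phi> v = (h c - h ?q) * \<Phi> s + h ?q * (\<Phi> s - \<phi> v)" by (simp add: algebra_simps)
    then have "\<bar>h c * \<Phi> s - h ?q * \<phi> v\<bar> \<le> \<bar>h c - h ?q\<bar> * \<bar>\<Phi> s\<bar> + \<bar>h ?q\<bar> * \<bar>\<Phi> s - \<phi> v\<bar>"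
      by (metis abs_mult abs_triangle_ineq)
    also have "\<dots> \<le> \<eta> * \<bar>\<Phi> s\<bar> + (\<bar>c\<bar> + 1) * \<eta>"
    proof (rule add_mono)
      show "\<bar>h c - h ?q\<bar> * \<bar>\<Phi> s\<bar> \<le> \<eta> * \<bar>\<Phi> s\<bar>"
        using h(1)[of c ?q] q1 by (intro mult_right_mono) auto
      show "\<bar>h ?q\<bar> * \<bar>\<Phi> s - \<phi> v\<bar> \<le> (\<bar>c\<bar> + 1) * \<eta>"
        using hle[of ?q] q1 \<Phi>[OF s v(1)] v(2) by (intro mult_mono) auto
    qed
    finally have 2: "\<bar>h c * \<Phi> s - h ?q * \<phi> v\<bar> \<le> \<eta> * \<bar>\<Phi> s\<bar> + (\<bar>c\<bar> + 1) * \<eta>" .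
    have "\<bar>\<Phi> (c *\<^sub>R s) - h c * \<Phi> s\<bar> \<le> \<eta> * C" using 1 2 unfolding C_def by (simp add: algebra_simps)
    then show ?thesis using \<eta>(3) by linarith
  qed
  then have "\<bar>\<Phi> (c *\<^sub>R s) - h c * \<Phi> s\<bar> \<le> 0" by (rule field_le_epsilon) simp
  then show ?thesis by simp
qed

text \<open>The domain is dense, so the Lipschitz extension already is the functional, and the bound
  by the norm is its defining estimate at the zero vector.\<close>

lemma functional_extension:
  assumes add: "\<And>v w. v \<in> Vset \<Longrightarrow> w \<in> Vset \<Longrightarrow> f (\<lambda>n. v n + w n) = f v + f w"
    and hom: "\<And>q v. v \<in> Vset \<Longrightarrow> f (\<lambda>n. q * v n) = real_of_rat q * f v"
    and le: "\<And>v. v \<in> Vset \<Longrightarrow> \<bar>f v\<bar> \<le> N (\<iota> v)"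
  obtains F where "F \<in> D\<^sub>X" "\<And>v. v \<in> Vset \<Longrightarrow> F (\<iota> v) = f v"
proof -
  have L: "f v - f w \<le> N (\<iota> v - \<iota> w)" if "v \<in> Vset" "w \<in> Vset" for v w
    using le[of "\<lambda>n. v n - w n"] add[of v "\<lambda>n. -1 * w n"] hom[of w "-1"] Vset_scale[of w "-1"] that
    by (simp add: \<iota>_diff)
  obtain F where F: "\<And>s v. s \<in> S \<Longrightarrow> v \<in> Vset \<Longrightarrow> \<bar>F s - f v\<bar> \<le> N (s - \<iota> v)"
    using lipschitz_extension[of f] L by blast
  have eq: "F (\<iota> v) = f v" if "v \<in> Vset" for v using extension_eq[of F f, OF F that] .
  have a: "F (s + t) = F s + F t" if "s \<in> S" "t \<in> S" for s t
  proof (rule antisym)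
    show "F (s + t) \<le> F s + F t" using that add by (intro extension_subadditive[of F f, OF F]) auto
    \<comment> \<open>Superadditivity is subadditivity of \<open>- F\<close>, which extends
      \<open>- f\<close>.\<close>
    have "- F (s + t) \<le> - F s + - F t"
      using that add F by (intro extension_subadditive[of "\<lambda>s. - F s" "\<lambda>v. - f v"]) (auto simp: abs_minus_commute)
    then show "F s + F t \<le> F (s + t)" by simp
  qed
  have h: "F (c *\<^sub>R s) = c * F s" if "s \<in> S" for c s
    using that hom by (intro extension_homogeneous[of F f "\<lambda>c. c", OF F]) auto
  have b: "\<bar>F s\<bar> \<le> N s" if "s \<in> S" for s
    using F[OF that, of "\<lambda>n. 0"] hom[of "\<lambda>n. 0" 0] by (simp add: \<iota>_zero)
  have "F \<in> dual_space S N"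
    unfolding dual_space_def using a h b by (intro CollectI conjI exI[of _ 1]) auto
  then show ?thesis using that eq b by (auto simp: dual_ball_def)
qed

end

section \<open>Seminorms on \<open>c00\<close> determined by their values at rational
  vectors\<close>

definition ratvec :: "(nat \<Rightarrow> rat) \<Rightarrow> nat \<Rightarrow> real" where
  "ratvec v = (\<lambda>n. real_of_rat (v n))"

text \<open>For nonnegative \<open>c\<close>, the largest seminorm on \<open>c00\<close> with value
  \<open>c n\<close> at the \<open>n\<close>-th basis vector. It measures distances before
  \<open>mubar\<close> is available.\<close>

definition l1_weighted :: "(nat \<Rightarrow> real) \<Rightarrow> (nat \<Rightarrow> real) \<Rightarrow> real" where
  "l1_weighted c x = (\<Sum>n | x n \<noteq> 0. c n * \<bar>x n\<bar>)"

lemma c00_bound: "x \<in> c00 \<longleftrightarrow> (\<exists>K. \<forall>n\<ge>K. x n = 0)"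
proof -
  have "(\<forall>n\<in>{n. x n \<noteq> 0}. n < K) \<longleftrightarrow> (\<forall>n\<ge>K. x n = 0)" for K :: nat
    using not_le by blast
  then show ?thesis by (simp only: c00_def mem_Collect_eq finite_nat_set_iff_bounded)
qed

lemma Vset_bound: "v \<in> Vset \<longleftrightarrow> (\<exists>K. \<forall>n\<ge>K. v n = 0)"
proof -
  have "(\<forall>n\<in>{n. v n \<noteq> 0}. n < K) \<longleftrightarrow> (\<forall>n\<ge>K. v n = 0)" for K :: nat
    using not_le by blast
  then show ?thesis by (simp only: Vset_def mem_Collect_eq finite_nat_set_iff_bounded)
qed

lemma subspace_c00: "subspace c00"
proof (rule subspaceI)
  show "0 \<in> c00" by (simp add: c00_def)
  show "x + y \<in> c00" if xy: "x \<in> c00" "y \<in> c00" for x y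
  proof -
    obtain K L where "\<forall>n\<ge>K. x n = 0" "\<forall>n\<ge>L. y n = 0" using xy by (auto simp: c00_bound)
    then show ?thesis by (auto simp: c00_bound intro!: exI[of _ "max K L"])
  qed
  show "c *\<^sub>R x \<in> c00" if "x \<in> c00" for c x
    using that by (auto simp: c00_bound scaleR_fun_def)
qed

lemma l1_weighted_eq: "\<forall>n\<ge>K. x n = 0 \<Longrightarrow> l1_weighted c x = (\<Sum>n<K. c n * \<bar>x n\<bar>)"
  unfolding l1_weighted_def by (rule sum.mono_neutral_left) (auto, metis not_le)

lemma ratvec_mem [simp]: "v \<in> Vset \<Longrightarrow> ratvec v \<in> c00"
  by (auto simp: c00_bound Vset_bound ratvec_def)

lemma seminormed_l1_weighted:
  assumes "\<And>n. c n \<ge> 0" shows "seminormed_space c00 (l1_weighted c)"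
proof
  show "subspace c00" by (rule subspace_c00)
  show "l1_weighted c (x + y) \<le> l1_weighted c x + l1_weighted c y" if xy: "x \<in> c00" "y \<in> c00" for x y
  proof -
    obtain K L where "\<forall>n\<ge>K. x n = 0" "\<forall>n\<ge>L. y n = 0" using xy by (auto simp: c00_bound)
    then have *: "\<forall>n\<ge>max K L. x n = 0" "\<forall>n\<ge>max K L. y n = 0" "\<forall>n\<ge>max K L. (x + y) n = 0" by auto
    show ?thesis unfolding *[THEN l1_weighted_eq] sum.distrib[symmetric]
      using assms by (intro sum_mono) (auto simp flip: distrib_left intro!: mult_left_mono)
  qed
  show "l1_weighted c (a *\<^sub>R x) = \<bar>a\<bar> * l1_weighted c x" if x: "x \<in> c00" for a x
  proof -
    obtain K where "\<forall>n\<ge>K. x n = 0" using x by (auto simp: c00_bound)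
    then have *: "\<forall>n\<ge>K. x n = 0" "\<forall>n\<ge>K. (a *\<^sub>R x) n = 0" by (auto simp: scaleR_fun_def)
    show ?thesis unfolding *[THEN l1_weighted_eq] sum_distrib_left
      by (intro sum.cong) (auto simp: scaleR_fun_def abs_mult)
  qed
qed

lemma dense_rational_l1_weighted:
  assumes c: "\<And>n. c n \<ge> 0" shows "dense_rational c00 (l1_weighted c) ratvec"
proof -
  interpret seminormed_space c00 "l1_weighted c" by (rule seminormed_l1_weighted[OF c])
  show ?thesis
  proof
    fix x and \<epsilon> :: real assume x: "x \<in> c00" and e: "\<epsilon> > 0"
    obtain K where K: "\<forall>n\<ge>K. x n = 0" using x by (auto simp: c00_bound)
    define C where "C = 1 + (\<Sum>n<K. c n)"
    have C: "C > 0" unfolding C_def using c by (simp add: add_pos_nonneg sum_nonneg)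
    have "\<forall>n. \<exists>q. \<bar>x n - real_of_rat q\<bar> < \<epsilon> / C"
    proof
      fix n
      obtain q where "x n - \<epsilon> / C < real_of_rat q" "real_of_rat q < x n"
        using of_rat_dense[of "x n - \<epsilon> / C" "x n"] e C by auto
      then show "\<exists>q. \<bar>x n - real_of_rat q\<bar> < \<epsilon> / C" by (intro exI[of _ q]) auto
    qed
    then obtain q where q: "\<And>n. \<bar>x n - real_of_rat (q n)\<bar> < \<epsilon> / C" by metis
    define v where "v n = (if n < K then q n else 0)" for n
    have v: "v \<in> Vset" by (auto simp: Vset_bound v_def intro!: exI[of _ K])
    have "\<forall>n\<ge>K. (x - ratvec v) n = 0" using K by (auto simp: ratvec_def v_def)
    then have "l1_weighted c (x - ratvec v) = (\<Sum>n<K. c n * \<bar>(x - ratvec v) n\<bar>)" by (rule l1_weighted_eq)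
    also have "\<dots> \<le> (\<Sum>n<K. c n * (\<epsilon> / C))"
      using c q by (intro sum_mono mult_left_mono) (auto simp: ratvec_def v_def less_imp_le)
    also have "\<dots> = (\<Sum>n<K. c n) * (\<epsilon> / C)" by (rule sum_distrib_right[symmetric])
    also have "\<dots> < C * (\<epsilon> / C)" using e C by (intro mult_strict_right_mono) (auto simp: C_def)
    also have "\<dots> = \<epsilon>" using C by simp
    finally show "\<exists>v\<in>Vset. l1_weighted c (x - ratvec v) < \<epsilon>" using v by blast
  qed (rule ratvec_mem, auto simp: ratvec_def of_rat_add of_rat_mult scaleR_fun_def plus_fun_def)
qed

definition basis_vec :: "nat \<Rightarrow> nat \<Rightarrow> 'a::zero_neq_one" where
  "basis_vec k = (\<lambda>n. if n = k then 1 else 0)"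

lemma basis_vec_Vset [simp]: "basis_vec k \<in> Vset"
  by (auto simp: Vset_bound basis_vec_def intro!: exI[of _ "Suc k"])

lemma basis_vec_c00 [simp]: "basis_vec k \<in> c00"
  by (auto simp: c00_bound basis_vec_def intro!: exI[of _ "Suc k"])

lemma ratvec_basis: "ratvec (basis_vec k) = basis_vec k"
  by (auto simp: ratvec_def basis_vec_def)

lemma c00_expansion:
  assumes "\<forall>n\<ge>K. x n = 0" shows "x = (\<Sum>k<K. x k *\<^sub>R basis_vec k)"
proof
  fix n
  have "(\<Sum>k<K. x k *\<^sub>R basis_vec k) n = (\<Sum>k<K. x k * (if n = k then 1 else 0))"
    by (induction K) (auto simp: scaleR_fun_def basis_vec_def)
  also have "\<dots> = (if n < K then x n else 0)" by (simp add: sum.delta if_distrib cong: if_cong)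
  finally show "x n = (\<Sum>k<K. x k *\<^sub>R basis_vec k) n" using assms by (auto simp: not_less)
qed

lemma seminorm_c00_le_l1:
  assumes "seminormed_space c00 g" "x \<in> c00" shows "g x \<le> l1_weighted (\<lambda>n. g (basis_vec n)) x"
proof -
  interpret seminormed_space c00 g by fact
  obtain K where K: "\<forall>n\<ge>K. x n = 0" using assms(2) by (auto simp: c00_bound)
  have "g x = g (\<Sum>k<K. x k *\<^sub>R basis_vec k)" by (rule arg_cong[OF c00_expansion[OF K]])
  also have "\<dots> \<le> (\<Sum>k<K. g (x k *\<^sub>R basis_vec k))" by (intro N_sum) auto
  also have "\<dots> = (\<Sum>k<K. g (basis_vec k) * \<bar>x k\<bar>)" by (intro sum.cong) (auto simp: N_scale)
  finally show ?thesis using l1_weighted_eq[OF K] by simp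
qed

lemma seminorm_on_c00_iff: "seminorm_on_c00 g \<longleftrightarrow> seminormed_space c00 g"
  using subspace_c00 by (auto simp: seminorm_on_c00_def seminormed_space_def)

lemma seminorm_on_V_add:
  "seminorm_on_V \<mu> \<Longrightarrow> v \<in> Vset \<Longrightarrow> w \<in> Vset \<Longrightarrow> \<mu> (\<lambda>n. v n + w n) \<le> \<mu> v + \<mu> w"
  and seminorm_on_V_scale:
  "seminorm_on_V \<mu> \<Longrightarrow> v \<in> Vset \<Longrightarrow> \<mu> (\<lambda>n. q * v n) = \<bar>real_of_rat q\<bar> * \<mu> v"
  by (auto simp: seminorm_on_V_def)

lemma seminorm_on_V_zero:
  assumes "seminorm_on_V \<mu>" shows "\<mu> (\<lambda>n. 0) = 0"
  using seminorm_on_V_scale[OF assms Vset_zero, of 0] by simp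

lemma seminorm_on_V_nonneg:
  assumes \<mu>: "seminorm_on_V \<mu>" and v: "v \<in> Vset" shows "\<mu> v \<ge> 0"
  using seminorm_on_V_add[OF \<mu> v Vset_scale[OF v, of "-1"]] seminorm_on_V_scale[OF \<mu> v, of "-1"]
    seminorm_on_V_zero[OF \<mu>] by (simp add: of_rat_minus)

lemma seminorm_on_V_le_l1:
  assumes \<mu>: "seminorm_on_V \<mu>" and v: "v \<in> Vset"
  shows "\<mu> v \<le> l1_weighted (\<lambda>n. \<mu> (basis_vec n)) (ratvec v)"
proof -
  obtain K where K: "\<forall>n\<ge>K. v n = 0" using v by (auto simp: Vset_bound)
  have "\<mu> v \<le> (\<Sum>n<K. \<mu> (basis_vec n) * \<bar>ratvec v n\<bar>)" using K
  proof (induction K arbitrary: v)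
    case 0
    then have "v = (\<lambda>n. 0)" by auto
    then show ?case using seminorm_on_V_zero[OF \<mu>] by simp
  next
    case (Suc K)
    let ?w = "v(K := 0)"
    have w: "\<forall>n\<ge>K. ?w n = 0" using Suc.prems by auto
    have wV: "?w \<in> Vset" unfolding Vset_bound using w by blast
    have "v = (\<lambda>n. ?w n + v K * basis_vec K n)" by (auto simp: basis_vec_def)
    moreover have "\<mu> (\<lambda>n. ?w n + v K * basis_vec K n) \<le> \<mu> ?w + \<mu> (\<lambda>n. v K * basis_vec K n)"
      by (rule seminorm_on_V_add[OF \<mu> wV Vset_scale[OF basis_vec_Vset]])
    ultimately have "\<mu> v \<le> \<mu> ?w + \<mu> (\<lambda>n. v K * basis_vec K n)" by metis
    moreover have "\<mu> (\<lambda>n. v K * basis_vec K n) = \<bar>real_of_rat (v K)\<bar> * \<mu> (basis_vec K)"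
      by (rule seminorm_on_V_scale[OF \<mu> basis_vec_Vset])
    moreover have "\<mu> ?w \<le> (\<Sum>n<K. \<mu> (basis_vec n) * \<bar>ratvec ?w n\<bar>)" by (rule Suc.IH[OF w])
    moreover have "(\<Sum>n<K. \<mu> (basis_vec n) * \<bar>ratvec ?w n\<bar>) = (\<Sum>n<K. \<mu> (basis_vec n) * \<bar>ratvec v n\<bar>)"
      by (intro sum.cong) (auto simp: ratvec_def)
    ultimately show ?case by (simp add: ratvec_def mult.commute)
  qed
  moreover have "\<forall>n\<ge>K. ratvec v n = 0" using K by (auto simp: ratvec_def)
  ultimately show ?thesis using l1_weighted_eq by metis
qed

lemma seminorm_on_V_diff_le:
  assumes \<mu>: "seminorm_on_V \<mu>" and vw: "v \<in> Vset" "w \<in> Vset"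
  shows "\<mu> v - \<mu> w \<le> \<mu> (\<lambda>n. v n - w n)"
  using seminorm_on_V_add[OF \<mu> Vset_diff[OF vw] vw(2)] by simp

text \<open>On \<open>Vset\<close>, \<open>\<mu>\<close> is Lipschitz for the \<open>l1\<close> norm
  weighted by its values at the basis vectors, hence it extends. Any seminorm on \<open>c00\<close>
  extending \<open>\<mu>\<close> is Lipschitz for the same norm, hence equal by density; the value 0
  off \<open>c00\<close> fixes the function on the rest of the type.\<close>

lemma ex1_seminorm_extension:
  assumes \<mu>: "seminorm_on_V \<mu>"
  shows "\<exists>!g. seminorm_on_c00 g \<and> (\<forall>v\<in>Vset. g (\<lambda>n. real_of_rat (v n)) = \<mu> v) \<and> (\<forall>x. x \<notin> c00 \<longrightarrow> g x = 0)"
proof -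
  define c where "c = (\<lambda>n. \<mu> (basis_vec n))"
  have c: "c n \<ge> 0" for n unfolding c_def by (rule seminorm_on_V_nonneg[OF \<mu>]) simp
  interpret dense_rational c00 "l1_weighted c" ratvec by (rule dense_rational_l1_weighted[OF c])
  have L: "\<mu> v - \<mu> w \<le> l1_weighted c (ratvec v - ratvec w)" if "v \<in> Vset" "w \<in> Vset" for v w
    using seminorm_on_V_diff_le[OF \<mu> that] seminorm_on_V_le_l1[OF \<mu> Vset_diff[OF that]] \<iota>_diff[OF that]
    by (simp add: c_def)
  have sub: "\<And>v w. v \<in> Vset \<Longrightarrow> w \<in> Vset \<Longrightarrow> \<mu> (\<lambda>n. v n + w n) \<le> \<mu> v + \<mu> w"
    and hom: "\<And>q v. v \<in> Vset \<Longrightarrow> \<mu> (\<lambda>n. q * v n) = \<bar>real_of_rat q\<bar> * \<mu> v"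
    using \<mu> by (auto simp: seminorm_on_V_def)
  obtain \<Phi> where \<Phi>: "\<And>s v. s \<in> c00 \<Longrightarrow> v \<in> Vset \<Longrightarrow> \<bar>\<Phi> s - \<mu> v\<bar> \<le> l1_weighted c (s - ratvec v)"
    using lipschitz_extension[of \<mu>] L by blast
  define g where "g x = (if x \<in> c00 then \<Phi> x else 0)" for x
  show ?thesis
  proof (rule ex1I[of _ g], intro conjI ballI allI impI)
    show "seminorm_on_c00 g"
      unfolding seminorm_on_c00_def
    proof (intro conjI ballI allI)
      show "g (x + y) \<le> g x + g y" if "x \<in> c00" "y \<in> c00" for x y
      proof -
        have "\<Phi> (x + y) \<le> \<Phi> x + \<Phi> y" by (rule extension_subadditive[of \<Phi> \<mu>]) (use \<Phi> sub that in blast)+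
        then show ?thesis using that by (simp add: g_def)
      qed
      show "g (a *\<^sub>R x) = \<bar>a\<bar> * g x" if "x \<in> c00" for a x
      proof -
        have "\<Phi> (a *\<^sub>R x) = \<bar>a\<bar> * \<Phi> x" by (rule extension_homogeneous[of \<Phi> \<mu> abs]) (use \<Phi> hom that in auto)
        then show ?thesis using that by (simp add: g_def)
      qed
    qed
    show "g (\<lambda>n. real_of_rat (v n)) = \<mu> v" if "v \<in> Vset" for v
      using extension_eq[of \<Phi> \<mu>, OF \<Phi> that] ratvec_mem[OF that] by (simp add: g_def ratvec_def)
    show "g x = 0" if "x \<notin> c00" for x using that by (simp add: g_def)
    fix h assume h: "seminorm_on_c00 h \<and> (\<forall>v\<in>Vset. h (\<lambda>n. real_of_rat (v n)) = \<mu> v) \<and> (\<forall>x. x \<notin> c00 \<longrightarrow> h x = 0)"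
    then interpret h: seminormed_space c00 h by (simp add: seminorm_on_c00_iff)
    have hv: "h (ratvec v) = \<mu> v" if "v \<in> Vset" for v using h that by (simp add: ratvec_def)
    have hb: "(\<lambda>n. h (basis_vec n)) = c" using hv[OF basis_vec_Vset] by (simp add: ratvec_basis c_def fun_eq_iff)
    have "\<bar>h s - \<mu> v\<bar> \<le> l1_weighted c (s - ratvec v)" if "s \<in> c00" "v \<in> Vset" for s v
    proof -
      have "\<bar>h s - h (ratvec v)\<bar> \<le> h (s - ratvec v)" using that by (intro h.N_abs_diff) auto
      also have "\<dots> \<le> l1_weighted c (s - ratvec v)"
        using seminorm_c00_le_l1[OF h.seminormed_space_axioms, of "s - ratvec v"] that by (simp add: hb)
      finally show ?thesis using hv that by simp
    qed
    then have "h s = \<Phi> s" if "s \<in> c00" for s using extension_unique[of h \<mu> \<Phi>] \<Phi> that by blast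
    then show "h = g" using h by (auto simp: g_def fun_eq_iff)
  qed
qed

lemma mubar_seminormed:
  assumes "seminorm_on_V \<mu>" shows "seminormed_space c00 (mubar \<mu>)"
    and "v \<in> Vset \<Longrightarrow> mubar \<mu> (ratvec v) = \<mu> v"
  using theI'[OF ex1_seminorm_extension[OF assms]] unfolding mubar_def[symmetric]
  by (auto simp: seminorm_on_c00_iff ratvec_def)

text \<open>Computes \<open>mubar\<close> when \<open>\<mu>\<close> comes from a known seminorm on
  \<open>c00\<close>, as it does for the tree norms.\<close>

lemma mubar_eqI:
  assumes g: "seminormed_space c00 g" and \<mu>: "\<And>v. v \<in> Vset \<Longrightarrow> \<mu> v = g (ratvec v)"
  shows "seminorm_on_V \<mu>" and "x \<in> c00 \<Longrightarrow> mubar \<mu> x = g x"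
proof -
  interpret seminormed_space c00 g by fact
  show V: "seminorm_on_V \<mu>"
    unfolding seminorm_on_V_def
  proof (intro conjI ballI allI)
    show "\<mu> (\<lambda>n. v n + w n) \<le> \<mu> v + \<mu> w" if "v \<in> Vset" "w \<in> Vset" for v w
    proof -
      have "ratvec (\<lambda>n. v n + w n) = ratvec v + ratvec w" by (auto simp: ratvec_def of_rat_add)
      then show ?thesis using \<mu> that N_add[of "ratvec v" "ratvec w"] by simp
    qed
    show "\<mu> (\<lambda>n. q * v n) = \<bar>real_of_rat q\<bar> * \<mu> v" if "v \<in> Vset" for q v
    proof -
      have "ratvec (\<lambda>n. q * v n) = real_of_rat q *\<^sub>R ratvec v" by (auto simp: ratvec_def of_rat_mult scaleR_fun_def)
      then show ?thesis using \<mu> that N_scale[of "ratvec v"] by simp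
    qed
  qed
  define h where "h x = (if x \<in> c00 then g x else 0)" for x
  have "seminorm_on_c00 h"
    using g unfolding seminorm_on_c00_iff[symmetric] by (simp add: seminorm_on_c00_def h_def)
  moreover have "\<forall>v\<in>Vset. h (\<lambda>n. real_of_rat (v n)) = \<mu> v"
    using \<mu> ratvec_mem by (auto simp: h_def ratvec_def)
  ultimately have "mubar \<mu> = h"
    unfolding mubar_def using ex1_seminorm_extension[OF V] by (intro the1_equality) (auto simp: h_def)
  then show "x \<in> c00 \<Longrightarrow> mubar \<mu> x = g x" by (simp add: h_def)
qed

section \<open>The completion as a space of Cauchy sequences\<close>

locale seminorm_V =
  fixes \<mu> :: "(nat \<Rightarrow> rat) \<Rightarrow> real"
  assumes \<mu>: "seminorm_on_V \<mu>"
begin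

sublocale bar: seminormed_space c00 "mubar \<mu>"
  by (rule mubar_seminormed(1)[OF \<mu>])

lemma Xcar_mem: "s \<in> Xcar \<mu> \<Longrightarrow> s k \<in> c00"
  by (simp add: Xcar_def)

lemma Xcar_Cauchy:
  assumes "s \<in> Xcar \<mu>" "\<epsilon> > 0"
  obtains M where "\<And>m k. m \<ge> M \<Longrightarrow> k \<ge> M \<Longrightarrow> mubar \<mu> (s m - s k) < \<epsilon>"
  using assms unfolding Xcar_def by blast

lemma Xnorm_tendsto:
  assumes s: "s \<in> Xcar \<mu>" shows "(\<lambda>k. mubar \<mu> (s k)) \<longlonglongrightarrow> Xnorm \<mu> s"
proof -
  have "Cauchy (\<lambda>k. mubar \<mu> (s k))"
  proof (rule metric_CauchyI)
    fix e :: real assume "e > 0"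
    then obtain M where M: "\<And>m k. m \<ge> M \<Longrightarrow> k \<ge> M \<Longrightarrow> mubar \<mu> (s m - s k) < e"
      using Xcar_Cauchy[OF s] by blast
    have "dist (mubar \<mu> (s m)) (mubar \<mu> (s k)) < e" if "m \<ge> M" "k \<ge> M" for m k
      using bar.N_abs_diff[OF Xcar_mem[OF s] Xcar_mem[OF s], of m k] M[OF that] by (simp add: dist_real_def)
    then show "\<exists>M. \<forall>m\<ge>M. \<forall>n\<ge>M. dist (mubar \<mu> (s m)) (mubar \<mu> (s n)) < e" by blast
  qed
  then show ?thesis unfolding Xnorm_def using Cauchy_convergent convergent_LIMSEQ_iff by blast
qed

lemma Xnorm_eqI: "s \<in> Xcar \<mu> \<Longrightarrow> (\<lambda>k. mubar \<mu> (s k)) \<longlonglongrightarrow> l \<Longrightarrow> Xnorm \<mu> s = l"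
  using Xnorm_tendsto LIMSEQ_unique by blast

lemma subspace_Xcar: "subspace (Xcar \<mu>)"
proof (rule subspaceI)
  show "0 \<in> Xcar \<mu>" by (simp add: Xcar_def)
  show "s + t \<in> Xcar \<mu>" if s: "s \<in> Xcar \<mu>" and t: "t \<in> Xcar \<mu>" for s t
    unfolding Xcar_def
  proof (intro CollectI conjI allI impI)
    show "(s + t) k \<in> c00" for k using s t Xcar_mem by simp
    fix \<epsilon> :: real assume e: "\<epsilon> > 0"
    obtain M where M: "\<And>m k. m \<ge> M \<Longrightarrow> k \<ge> M \<Longrightarrow> mubar \<mu> (s m - s k) < \<epsilon> / 2"
      using Xcar_Cauchy[OF s, of "\<epsilon> / 2"] e by auto
    obtain L where L: "\<And>m k. m \<ge> L \<Longrightarrow> k \<ge> L \<Longrightarrow> mubar \<mu> (t m - t k) < \<epsilon> / 2"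
      using Xcar_Cauchy[OF t, of "\<epsilon> / 2"] e by auto
    have "mubar \<mu> ((s + t) m - (s + t) k) < \<epsilon>" if "m \<ge> max M L" "k \<ge> max M L" for m k
    proof -
      have eq: "(s + t) m - (s + t) k = (s m - s k) + (t m - t k)" by simp
      have "mubar \<mu> ((s m - s k) + (t m - t k)) \<le> mubar \<mu> (s m - s k) + mubar \<mu> (t m - t k)"
        using s t Xcar_mem by (intro bar.N_add) auto
      then show ?thesis unfolding eq using M[of m k] L[of m k] that by linarith
    qed
    then show "\<exists>M. \<forall>m\<ge>M. \<forall>k\<ge>M. mubar \<mu> ((s + t) m - (s + t) k) < \<epsilon>" by blast
  qed
  show "c *\<^sub>R s \<in> Xcar \<mu>" if s: "s \<in> Xcar \<mu>" for c s
    unfolding Xcar_def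
  proof (intro CollectI conjI allI impI)
    show "(c *\<^sub>R s) k \<in> c00" for k using s Xcar_mem by (simp add: scaleR_fun_def[of c s])
    fix \<epsilon> :: real assume e: "\<epsilon> > 0"
    obtain M where M: "\<And>m k. m \<ge> M \<Longrightarrow> k \<ge> M \<Longrightarrow> mubar \<mu> (s m - s k) < \<epsilon> / (\<bar>c\<bar> + 1)"
      using Xcar_Cauchy[OF s, of "\<epsilon> / (\<bar>c\<bar> + 1)"] e by auto
    have "mubar \<mu> ((c *\<^sub>R s) m - (c *\<^sub>R s) k) < \<epsilon>" if "m \<ge> M" "k \<ge> M" for m k
    proof -
      have eq: "(c *\<^sub>R s) m - (c *\<^sub>R s) k = c *\<^sub>R (s m - s k)"
        by (simp add: scaleR_fun_def[of c s] scaleR_diff_right)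
      have n: "0 \<le> mubar \<mu> (s m - s k)" using s Xcar_mem by (intro bar.N_nonneg) auto
      have "mubar \<mu> (c *\<^sub>R (s m - s k)) = \<bar>c\<bar> * mubar \<mu> (s m - s k)"
        using s Xcar_mem by (intro bar.N_scale) auto
      also have "\<dots> \<le> (\<bar>c\<bar> + 1) * mubar \<mu> (s m - s k)" using n by (intro mult_right_mono) auto
      also have "\<dots> < (\<bar>c\<bar> + 1) * (\<epsilon> / (\<bar>c\<bar> + 1))" using M[OF that] by (intro mult_strict_left_mono) auto
      also have "\<dots> = \<epsilon>" by (simp add: add_nonneg_eq_0_iff)
      finally show ?thesis unfolding eq .
    qed
    then show "\<exists>M. \<forall>m\<ge>M. \<forall>k\<ge>M. mubar \<mu> ((c *\<^sub>R s) m - (c *\<^sub>R s) k) < \<epsilon>" by blast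
  qed
qed

sublocale X: seminormed_space "Xcar \<mu>" "Xnorm \<mu>"
proof
  show "subspace (Xcar \<mu>)" by (rule subspace_Xcar)
  show "Xnorm \<mu> (s + t) \<le> Xnorm \<mu> s + Xnorm \<mu> t" if s: "s \<in> Xcar \<mu>" and t: "t \<in> Xcar \<mu>" for s t
  proof (rule LIMSEQ_le)
    show "(\<lambda>k. mubar \<mu> ((s + t) k)) \<longlonglongrightarrow> Xnorm \<mu> (s + t)"
      using subspace_add[OF subspace_Xcar s t] by (rule Xnorm_tendsto)
    show "(\<lambda>k. mubar \<mu> (s k) + mubar \<mu> (t k)) \<longlonglongrightarrow> Xnorm \<mu> s + Xnorm \<mu> t"
      by (intro tendsto_add Xnorm_tendsto s t)
    show "\<exists>N. \<forall>n\<ge>N. mubar \<mu> ((s + t) n) \<le> mubar \<mu> (s n) + mubar \<mu> (t n)"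
      using bar.N_add Xcar_mem s t by simp
  qed
  show "Xnorm \<mu> (c *\<^sub>R s) = \<bar>c\<bar> * Xnorm \<mu> s" if s: "s \<in> Xcar \<mu>" for c s
  proof (rule Xnorm_eqI)
    show "c *\<^sub>R s \<in> Xcar \<mu>" using subspace_Xcar s by (simp add: subspace_mul)
    have "(\<lambda>k. \<bar>c\<bar> * mubar \<mu> (s k)) \<longlonglongrightarrow> \<bar>c\<bar> * Xnorm \<mu> s" by (intro tendsto_mult_left Xnorm_tendsto s)
    moreover have "mubar \<mu> ((c *\<^sub>R s) k) = \<bar>c\<bar> * mubar \<mu> (s k)" for k
      using bar.N_scale[OF Xcar_mem[OF s]] by (simp add: scaleR_fun_def[of c s])
    ultimately show "(\<lambda>k. mubar \<mu> ((c *\<^sub>R s) k)) \<longlonglongrightarrow> \<bar>c\<bar> * Xnorm \<mu> s" by simp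
  qed
qed

lemma const_Xcar [simp]: "x \<in> c00 \<Longrightarrow> (\<lambda>_. x) \<in> Xcar \<mu>"
  by (simp add: Xcar_def)

lemma Xnorm_const: "x \<in> c00 \<Longrightarrow> Xnorm \<mu> (\<lambda>_. x) = mubar \<mu> x"
  by (rule Xnorm_eqI) auto

lemma const_dense:
  assumes s: "s \<in> Xcar \<mu>" and e: "\<epsilon> > 0"
  obtains x where "x \<in> c00" "Xnorm \<mu> (s - (\<lambda>_. x)) < \<epsilon>"
proof -
  obtain M where M: "\<And>m k. m \<ge> M \<Longrightarrow> k \<ge> M \<Longrightarrow> mubar \<mu> (s m - s k) < \<epsilon> / 2"
    using Xcar_Cauchy[OF s, of "\<epsilon> / 2"] e by auto
  have "s - (\<lambda>_. s M) \<in> Xcar \<mu>" using s Xcar_mem by (intro X.diff_mem) auto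
  then have "(\<lambda>k. mubar \<mu> ((s - (\<lambda>_. s M)) k)) \<longlonglongrightarrow> Xnorm \<mu> (s - (\<lambda>_. s M))" by (rule Xnorm_tendsto)
  moreover have "mubar \<mu> ((s - (\<lambda>_. s M)) k) \<le> \<epsilon> / 2" if "k \<ge> M" for k
    using M[OF that order_refl] by simp
  ultimately have "Xnorm \<mu> (s - (\<lambda>_. s M)) \<le> \<epsilon> / 2" by (intro LIMSEQ_le_const2) blast+
  then show ?thesis using that[of "s M"] Xcar_mem[OF s] e by simp
qed

definition emb :: "(nat \<Rightarrow> rat) \<Rightarrow> nat \<Rightarrow> nat \<Rightarrow> real" where
  "emb v = (\<lambda>_. ratvec v)"

lemma Xnorm_emb: "v \<in> Vset \<Longrightarrow> Xnorm \<mu> (emb v) = \<mu> v"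
  by (simp add: emb_def Xnorm_const mubar_seminormed(2)[OF \<mu>])

sublocale X: dense_rational "Xcar \<mu>" "Xnorm \<mu>" emb
proof
  show "emb v \<in> Xcar \<mu>" if "v \<in> Vset" for v using that by (simp add: emb_def)
  show "emb (\<lambda>n. v n + w n) = emb v + emb w" if "v \<in> Vset" "w \<in> Vset" for v w
    by (auto simp: emb_def ratvec_def of_rat_add fun_eq_iff)
  show "emb (\<lambda>n. q * v n) = real_of_rat q *\<^sub>R emb v" if "v \<in> Vset" for q v
    by (auto simp: emb_def ratvec_def of_rat_mult fun_eq_iff scaleR_fun_def)
  fix s and \<epsilon> :: real assume s: "s \<in> Xcar \<mu>" and e: "\<epsilon> > 0"
  obtain x where x: "x \<in> c00" "Xnorm \<mu> (s - (\<lambda>_. x)) < \<epsilon> / 2" using const_dense[OF s, of "\<epsilon> / 2"] e by auto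
  let ?c = "\<lambda>n. mubar \<mu> (basis_vec n)"
  have c: "?c n \<ge> 0" for n by (intro bar.N_nonneg) simp
  obtain v where v: "v \<in> Vset" "l1_weighted ?c (x - ratvec v) < \<epsilon> / 2"
    using dense_rational.dense[OF dense_rational_l1_weighted[of ?c, OF c] x(1), of "\<epsilon> / 2"] e by auto
  have "mubar \<mu> (x - ratvec v) < \<epsilon> / 2"
    using seminorm_c00_le_l1[OF bar.seminormed_space_axioms, of "x - ratvec v"] v x(1) by simp
  moreover have "(\<lambda>_. x) - emb v = (\<lambda>_. x - ratvec v)" by (auto simp: emb_def fun_eq_iff)
  ultimately have "Xnorm \<mu> ((\<lambda>_. x) - emb v) < \<epsilon> / 2" using Xnorm_const[of "x - ratvec v"] x(1) v(1) by simp
  moreover have "Xnorm \<mu> (s - emb v) \<le> Xnorm \<mu> (s - (\<lambda>_. x)) + Xnorm \<mu> ((\<lambda>_. x) - emb v)"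
    using s x(1) v(1) by (intro X.N_diff_trans) (auto simp: emb_def)
  ultimately show "\<exists>v\<in>Vset. Xnorm \<mu> (s - emb v) < \<epsilon>" using x(2) v(1) by force
qed

text \<open>Otherwise each basis vector agrees, up to a null vector, with some \<open>y k\<close> in
  the span of a finite set. A linear relation among the \<open>y k\<close> yields a combination of
  basis vectors of seminorm zero, which definiteness excludes; so infinitely many independent
  vectors would lie in that span.\<close>

lemma infinite_dim_Xcar:
  assumes inj: "\<And>x. x \<in> c00 \<Longrightarrow> mubar \<mu> x = 0 \<Longrightarrow> x = 0"
  shows "infinite_dim (Xcar \<mu>) (Xnorm \<mu>)"
  unfolding infinite_dim_def
proof
  assume "\<exists>F. finite F \<and> F \<subseteq> Xcar \<mu> \<and> (\<forall>x\<in>Xcar \<mu>. \<exists>y\<in>span F. Xnorm \<mu> (x - y) = 0)"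
  then obtain F where F: "finite F" "F \<subseteq> Xcar \<mu>" "\<forall>x\<in>Xcar \<mu>. \<exists>y\<in>span F. Xnorm \<mu> (x - y) = 0" by blast
  have sp: "span F \<subseteq> Xcar \<mu>" using F(2) subspace_Xcar by (rule span_minimal)
  have "\<forall>k. \<exists>y\<in>span F. Xnorm \<mu> ((\<lambda>_. basis_vec k) - y) = 0" using F(3) by simp
  then obtain y where y: "\<And>k. y k \<in> span F" "\<And>k. Xnorm \<mu> ((\<lambda>_. basis_vec k) - y k) = 0" by metis
  have yX: "y k \<in> Xcar \<mu>" for k using y sp by blast
  have comb: "a = 0" if K: "finite K" and z: "(\<Sum>k\<in>K. c k *\<^sub>R y k) = 0" and a: "a = (\<Sum>k\<in>K. c k *\<^sub>R basis_vec k)" for K c and a :: "nat \<Rightarrow> real"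
  proof -
    have aC: "a \<in> c00" unfolding a by (intro bar.sum_mem) auto
    have "(\<lambda>_::nat. \<Sum>k\<in>K. c k *\<^sub>R (basis_vec k :: nat \<Rightarrow> real)) = (\<Sum>k\<in>K. c k *\<^sub>R (\<lambda>_. basis_vec k))"
      using K by (induction K rule: finite_induct) (auto simp: fun_eq_iff scaleR_fun_def)
    then have "(\<lambda>_. a) = (\<Sum>k\<in>K. c k *\<^sub>R ((\<lambda>_. basis_vec k) - y k))"
      using z by (simp add: a scaleR_diff_right sum_subtractf)
    then have "Xnorm \<mu> (\<lambda>_. a) \<le> (\<Sum>k\<in>K. Xnorm \<mu> (c k *\<^sub>R ((\<lambda>_. basis_vec k) - y k)))"
      using X.N_sum[of K "\<lambda>k. c k *\<^sub>R ((\<lambda>_. basis_vec k) - y k)"] yX by simp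
    also have "\<dots> = 0" using y(2) yX by (intro sum.neutral) (simp add: X.N_scale)
    finally have "mubar \<mu> a = 0" using Xnorm_const[OF aC] bar.N_nonneg[OF aC] by simp
    then show ?thesis using inj aC by blast
  qed
  have "inj y"
  proof
    fix j k assume jk: "y j = y k"
    show "j = k"
    proof (rule ccontr)
      assume ne: "j \<noteq> k"
      have "basis_vec j - basis_vec k = (0 :: nat \<Rightarrow> real)"
        by (rule comb[of "{j, k}" "\<lambda>i. if i = j then 1 else -1"]) (use jk ne in auto)
      then have "(basis_vec j - basis_vec k) j = (0::real)" by simp
      then show False using ne by (simp add: basis_vec_def)
    qed
  qed
  have "independent (range y)"
    unfolding independent_explicit_finite_subsets
  proof (intro allI impI ballI)
    fix A u v assume A: "A \<subseteq> range y" "finite A" "(\<Sum>v\<in>A. u v *\<^sub>R v) = 0" and v: "v \<in> A"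
    define K where "K = y -` A"
    have K: "finite K" "A = y ` K" unfolding K_def using A \<open>inj y\<close> by (auto intro: finite_vimageI)
    obtain k where k: "k \<in> K" "v = y k" using v K by auto
    have "(\<Sum>k\<in>K. u (y k) *\<^sub>R y k) = 0"
      using A(3) unfolding K(2) using \<open>inj y\<close> by (subst (asm) sum.reindex) (auto intro: inj_on_subset)
    then have z: "(\<Sum>k\<in>K. u (y k) *\<^sub>R basis_vec k) = (0 :: nat \<Rightarrow> real)" by (rule comb[OF K(1) _ refl])
    have "(\<Sum>k\<in>L. u (y k) *\<^sub>R basis_vec k) n = (\<Sum>k\<in>L. if k = n then u (y k) else 0)" if "finite L" for L n
      using that by (induction L rule: finite_induct) (auto simp: scaleR_fun_def basis_vec_def)
    from this[OF K(1), of k] z show "u v = 0" using k K(1) by (simp add: sum.delta)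
  qed
  then have "finite (range y)" using independent_span_bound[OF F(1), of "range y"] y(1) by blast
  then show False using \<open>inj y\<close> finite_imageD[of y UNIV] by simp
qed

end

lemma Bset_I:
  assumes g: "seminormed_space c00 g" and inj: "\<And>x. x \<in> c00 \<Longrightarrow> g x = 0 \<Longrightarrow> x = 0"
  shows "restrict (\<lambda>v. g (ratvec v)) Vset \<in> Bset"
proof -
  let ?m = "restrict (\<lambda>v. g (ratvec v)) Vset"
  have m: "seminorm_on_V ?m" "\<And>x. x \<in> c00 \<Longrightarrow> mubar ?m x = g x" by (rule mubar_eqI[OF g]; simp)+
  interpret seminorm_V ?m by unfold_locales (rule m(1))
  have "infinite_dim (Xcar ?m) (Xnorm ?m)" by (rule infinite_dim_Xcar) (simp add: m inj)
  then show ?thesis using m inj by (simp add: Bset_def Pset_def RV_def)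
qed

section \<open>Failure of the properties in terms of rational vectors\<close>

abbreviation V\<^sub>1 :: "(nat \<Rightarrow> rat) set" where "V\<^sub>1 \<equiv> Vset - {\<lambda>n. 0}"

definition V_dual :: "((nat \<Rightarrow> rat) \<Rightarrow> real) \<Rightarrow> nat \<Rightarrow> (nat \<Rightarrow> (nat \<Rightarrow> rat) \<Rightarrow> real) \<Rightarrow> bool" where
  "V_dual \<mu> n f \<longleftrightarrow> (\<forall>i<n.
     (\<forall>v\<in>Vset. \<forall>w\<in>Vset. f i (\<lambda>n. v n + w n) = f i v + f i w) \<and>
     (\<forall>q. \<forall>v\<in>Vset. f i (\<lambda>n. q * v n) = real_of_rat q * f i v) \<and>
     (\<forall>v\<in>Vset. \<bar>f i v\<bar> \<le> \<mu> v))"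

text \<open>This is \<open>point_gap\<close> at the normalised vectors of \<open>v\<close> and
  \<open>u\<close>, multiplied through by \<open>\<mu> v\<close>, because dividing by
  \<open>\<mu> v\<close> generally leaves the rational vectors. The ball condition
  \<open>\<mu> w < \<mu> v\<close> is strict, which makes every premise open; density of the open
  ball in the closed one ensures that nothing is lost.\<close>

definition V_point_gap ::
  "((nat \<Rightarrow> rat) \<Rightarrow> real) \<Rightarrow> (nat \<Rightarrow> rat) \<Rightarrow> (nat \<Rightarrow> rat) \<Rightarrow> nat \<Rightarrow> real \<Rightarrow> bool" where
  "V_point_gap \<mu> v u n \<delta> \<longleftrightarrow> (\<exists>f. V_dual \<mu> n f \<and>
     (\<forall>w\<in>Vset. \<mu> w < \<mu> v \<and> (\<forall>i<n. (f i u / \<mu> u - \<delta>) * \<mu> v < f i w) \<longrightarrow>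
        \<mu> (\<lambda>m. v m - w m) \<le> (2 - \<delta>) * \<mu> v))"

text \<open>Only the centres \<open>u i\<close> need normalising; \<open>x i\<close> and
  \<open>y i\<close> range over the rational vectors of the open unit ball.\<close>

definition V_slices_gap ::
  "((nat \<Rightarrow> rat) \<Rightarrow> real) \<Rightarrow> (nat \<Rightarrow> nat \<Rightarrow> rat) \<Rightarrow> nat \<Rightarrow> (nat \<Rightarrow> nat) \<Rightarrow> real \<Rightarrow> bool" where
  "V_slices_gap \<mu> u n l \<delta> \<longleftrightarrow> (\<exists>f. V_dual \<mu> n f \<and> (\<forall>i<n. \<delta> \<le> f i (u i) / \<mu> (u i)) \<and>
     (\<forall>x y. (\<forall>i<n. x i \<in> Vset \<and> y i \<in> Vset) \<longrightarrow>
        (\<forall>i<n. \<mu> (x i) < 1 \<and> \<mu> (y i) < 1 \<and>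
               f i (u i) / \<mu> (u i) - \<delta> < f i (x i) \<and> f i (u i) / \<mu> (u i) - \<delta> < f i (y i)) \<longrightarrow>
        \<mu> (\<lambda>m. \<Sum>i<n. of_nat (l i) * (x i m - y i m)) \<le> (2 - \<delta>) * (\<Sum>i<n. real (l i))))"

lemma finite_gap:
  fixes a b :: "nat \<Rightarrow> real"
  assumes "\<And>i. i < n \<Longrightarrow> a i < b i"
  obtains r where "r > 0" "\<And>i. i < n \<Longrightarrow> a i + r \<le> b i"
proof
  let ?r = "Min (insert 1 ((\<lambda>i. b i - a i) ` {..<n}))"
  show "?r > 0" using assms by auto
  show "a i + ?r \<le> b i" if "i < n" for i
  proof -
    have "?r \<le> b i - a i" using that by (intro Min_le) auto
    then show ?thesis by simp
  qed
qed

lemma inverse_Suc_below: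
  assumes "(\<delta>::real) > 0" obtains k :: nat where "1 / real (Suc k) \<le> \<delta>"
  using reals_Archimedean[OF assms] that by (auto simp: inverse_eq_divide intro: less_imp_le)

lemma V_slices_gap_cong:
  assumes "\<And>i. i < n \<Longrightarrow> u i = u' i \<and> l i = l' i"
  shows "V_slices_gap \<mu> u n l \<delta> \<longleftrightarrow> V_slices_gap \<mu> u' n l' \<delta>"
  unfolding V_slices_gap_def using assms by simp

text \<open>Positivity on nonzero rational vectors makes division by \<open>\<mu> v\<close>
  legitimate, both in the normalised centres and in the continuity arguments.\<close>

locale norm_V = seminorm_V +
  assumes \<mu>_pos: "v \<in> Vset \<Longrightarrow> v \<noteq> (\<lambda>n. 0) \<Longrightarrow> \<mu> v > 0"
begin

definition nrm :: "(nat \<Rightarrow> rat) \<Rightarrow> nat \<Rightarrow> nat \<Rightarrow> real" where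
  "nrm v = (1 / \<mu> v) *\<^sub>R emb v"

lemma nrm_sphere: "v \<in> Vset \<Longrightarrow> v \<noteq> (\<lambda>n. 0) \<Longrightarrow> nrm v \<in> X.S\<^sub>X"
  using \<mu>_pos[of v] X.normalize_in_sphere[of "emb v"] by (simp add: nrm_def Xnorm_emb)

lemma nrm_mem [simp]: "v \<in> Vset \<Longrightarrow> nrm v \<in> Xcar \<mu>"
  by (simp add: nrm_def)

lemma sphere_approx:
  assumes x: "x \<in> X.S\<^sub>X" and e: "\<eta> > 0"
  obtains v where "v \<in> Vset" "v \<noteq> (\<lambda>n. 0)" "Xnorm \<mu> (x - nrm v) \<le> \<eta>"
proof -
  define \<eta>' where "\<eta>' = min (1/2) (\<eta> / 2)"
  have e': "\<eta>' > 0" "\<eta>' \<le> 1/2" "\<eta>' \<le> \<eta> / 2" using e by (auto simp: \<eta>'_def)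
  have xX: "x \<in> Xcar \<mu>" "Xnorm \<mu> x = 1" using x by (auto simp: unit_sphere_def)
  obtain v where v: "v \<in> Vset" "Xnorm \<mu> (x - emb v) < \<eta>'" using X.dense[OF xX(1) e'(1)] by auto
  have d: "\<bar>1 - \<mu> v\<bar> < \<eta>'" using X.N_abs_diff[of x "emb v"] v xX by (simp add: Xnorm_emb)
  then have p: "\<mu> v > 0" using e' by linarith
  have v0: "v \<noteq> (\<lambda>n. 0)" using p seminorm_on_V_zero[OF \<mu>] by auto
  have eq: "emb v - nrm v = (1 - 1 / \<mu> v) *\<^sub>R emb v" by (simp add: nrm_def scaleR_diff_left)
  have "Xnorm \<mu> (emb v - nrm v) = \<bar>1 - 1 / \<mu> v\<bar> * \<mu> v" unfolding eq using v(1) by (simp add: X.N_scale Xnorm_emb)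
  also have "\<dots> = \<bar>(1 - 1 / \<mu> v) * \<mu> v\<bar>" using p by (simp add: abs_mult)
  also have "(1 - 1 / \<mu> v) * \<mu> v = \<mu> v - 1" using p by (simp add: left_diff_distrib)
  finally have "Xnorm \<mu> (emb v - nrm v) < \<eta>'" using d by linarith
  then have "Xnorm \<mu> (x - nrm v) \<le> \<eta>" using X.N_diff_trans[of x "emb v" "nrm v"] xX v e' by simp
  then show ?thesis using that v v0 by blast
qed

text \<open>Shrinking \<open>y\<close> by the factor \<open>1 - \<eta>'\<close> before approximating
  leaves room for the error, so the rational vector lands strictly inside the ball of radius
  \<open>c\<close>.\<close>

lemma ball_approx:
  assumes y: "y \<in> X.B\<^sub>X" and e: "\<eta> > 0" and c: "c > 0"
  obtains w where "w \<in> Vset" "\<mu> w < c" "Xnorm \<mu> (y - (1 / c) *\<^sub>R emb w) < \<eta>"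
proof -
  define \<eta>' where "\<eta>' = min 1 (\<eta> / 2)"
  have e': "\<eta>' > 0" "\<eta>' \<le> 1" "\<eta>' \<le> \<eta> / 2" using e by (auto simp: \<eta>'_def)
  have yX: "y \<in> Xcar \<mu>" "Xnorm \<mu> y \<le> 1" using y by (auto simp: unit_ball_def)
  let ?z = "(c * (1 - \<eta>')) *\<^sub>R y"
  have z: "?z \<in> Xcar \<mu>" using yX by simp
  obtain w where w: "w \<in> Vset" "Xnorm \<mu> (?z - emb w) < c * \<eta>' / 2"
    using X.dense[OF z, of "c * \<eta>' / 2"] c e' by auto
  have "Xnorm \<mu> ?z = c * (1 - \<eta>') * Xnorm \<mu> y" using yX c e' by (simp add: X.N_scale)
  also have "\<dots> \<le> c * (1 - \<eta>')" using yX c e' by (intro mult_left_le) auto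
  finally have zn: "Xnorm \<mu> ?z \<le> c - c * \<eta>'" by (simp add: right_diff_distrib)
  have "\<mu> w < c"
  proof -
    have "\<bar>Xnorm \<mu> ?z - Xnorm \<mu> (emb w)\<bar> < c * \<eta>' / 2"
      using X.N_abs_diff[of ?z "emb w"] w z by (meson X.\<iota>_mem le_less_trans)
    moreover have "Xnorm \<mu> (emb w) = \<mu> w" using w(1) by (rule Xnorm_emb)
    moreover have "c * \<eta>' > 0" using c e' by simp
    ultimately show ?thesis using zn by linarith
  qed
  moreover have "Xnorm \<mu> (y - (1 / c) *\<^sub>R emb w) < \<eta>"
  proof -
    have eq: "y - (1 / c) *\<^sub>R emb w = \<eta>' *\<^sub>R y + (1 / c) *\<^sub>R (?z - emb w)"
      using c by (simp add: scaleR_diff_right scaleR_diff_left right_diff_distrib)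
    have "Xnorm \<mu> (\<eta>' *\<^sub>R y + (1 / c) *\<^sub>R (?z - emb w)) \<le> Xnorm \<mu> (\<eta>' *\<^sub>R y) + Xnorm \<mu> ((1 / c) *\<^sub>R (?z - emb w))"
      using yX w by (intro X.N_add) auto
    also have "\<dots> = \<eta>' * Xnorm \<mu> y + Xnorm \<mu> (?z - emb w) / c"
      using yX w c e' z by (simp add: X.N_scale)
    also have "\<dots> < \<eta>' * 1 + (c * \<eta>' / 2) / c"
      using yX w c e' by (intro add_le_less_mono mult_left_mono divide_strict_right_mono) auto
    also have "\<dots> = \<eta>' + \<eta>' / 2" using c by simp
    also have "\<dots> \<le> \<eta>" using e' by simp
    finally show ?thesis unfolding eq .
  qed
  ultimately show ?thesis using that w by blast
qed

lemma V_dual_restrict: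
  assumes "\<And>i. i < n \<Longrightarrow> F i \<in> X.D\<^sub>X"
  shows "V_dual \<mu> n (\<lambda>i v. F i (emb v))"
  unfolding V_dual_def
proof (intro allI impI conjI ballI)
  fix i assume i: "i < n"
  have fd: "F i \<in> dual_space (Xcar \<mu>) (Xnorm \<mu>)" using assms[OF i] by (rule X.dual_ball_space)
  show "F i (emb (\<lambda>n. v n + w n)) = F i (emb v) + F i (emb w)" if "v \<in> Vset" "w \<in> Vset" for v w
    using that X.dual_add[OF fd, of "emb v" "emb w"] by (simp add: X.\<iota>_add)
  show "F i (emb (\<lambda>n. q * v n)) = real_of_rat q * F i (emb v)" if "v \<in> Vset" for q v
    using that X.dual_scale[OF fd, of "emb v"] by (simp add: X.\<iota>_scale)
  show "\<bar>F i (emb v)\<bar> \<le> \<mu> v" if "v \<in> Vset" for v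
    using X.dual_ball_le[OF assms[OF i], of "emb v"] that by (simp add: Xnorm_emb)
qed

lemma V_dual_extend:
  assumes "V_dual \<mu> n f"
  obtains F where "\<And>i. i < n \<Longrightarrow> F i \<in> X.D\<^sub>X"
    "\<And>i v. i < n \<Longrightarrow> v \<in> Vset \<Longrightarrow> F i (emb v) = f i v"
proof -
  have "\<forall>i. \<exists>F. i < n \<longrightarrow> F \<in> X.D\<^sub>X \<and> (\<forall>v\<in>Vset. F (emb v) = f i v)"
  proof
    fix i
    have "\<exists>F. F \<in> X.D\<^sub>X \<and> (\<forall>v\<in>Vset. F (emb v) = f i v)" if i: "i < n"
      by (rule X.functional_extension[of "f i"]) (use assms i in \<open>auto simp: V_dual_def Xnorm_emb\<close>)
    then show "\<exists>F. i < n \<longrightarrow> F \<in> X.D\<^sub>X \<and> (\<forall>v\<in>Vset. F (emb v) = f i v)" by blast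
  qed
  then show ?thesis using that by metis
qed

lemma dual_ball_nrm:
  assumes "F \<in> X.D\<^sub>X" "v \<in> Vset" shows "F (nrm v) = F (emb v) / \<mu> v"
  using X.dual_scale[OF X.dual_ball_space[OF assms(1)], of "emb v" "1 / \<mu> v"] assms(2) by (simp add: nrm_def)

text \<open>Functionals restrict to \<open>Vset\<close> and extend back by density. A vector
  \<open>y\<close> of the ball is approximated by rational \<open>w\<close>: the finitely many
  strict premises survive because they hold with some slack \<open>r\<close>, and the weak
  conclusion passes to the limit.\<close>

lemma point_gap_iff:
  assumes v: "v \<in> Vset" "v \<noteq> (\<lambda>n. 0)" and u: "u \<in> Vset"
  shows "X.point_gap (nrm v) (nrm u) n \<delta> \<longleftrightarrow> V_point_gap \<mu> v u n \<delta>"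
proof
  have vp: "\<mu> v > 0" by (rule \<mu>_pos[OF v])
  have diff: "Xnorm \<mu> (nrm v - (1 / \<mu> v) *\<^sub>R emb w) = \<mu> (\<lambda>m. v m - w m) / \<mu> v" if w: "w \<in> Vset" for w
  proof -
    have eq: "nrm v - (1 / \<mu> v) *\<^sub>R emb w = (1 / \<mu> v) *\<^sub>R emb (\<lambda>m. v m - w m)"
      using v w by (simp add: nrm_def X.\<iota>_diff scaleR_diff_right)
    show ?thesis unfolding eq using v w vp by (simp add: X.N_scale Xnorm_emb)
  qed
  {
    assume "X.point_gap (nrm v) (nrm u) n \<delta>"
    then obtain F where F: "\<And>i. i < n \<Longrightarrow> F i \<in> X.D\<^sub>X"
      "\<And>y. y \<in> X.B\<^sub>X \<Longrightarrow> (\<forall>i<n. F i (nrm u) - \<delta> < F i y) \<Longrightarrow> Xnorm \<mu> (nrm v - y) \<le> 2 - \<delta>"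
      unfolding X.point_gap_def by blast
    have "\<mu> (\<lambda>m. v m - w m) \<le> (2 - \<delta>) * \<mu> v"
      if w: "w \<in> Vset" "\<mu> w < \<mu> v" "\<forall>i<n. (F i (emb u) / \<mu> u - \<delta>) * \<mu> v < F i (emb w)" for w
    proof -
      let ?y = "(1 / \<mu> v) *\<^sub>R emb w"
      have "?y \<in> X.B\<^sub>X" using w vp by (simp add: unit_ball_def X.N_scale Xnorm_emb)
      moreover have "F i (nrm u) - \<delta> < F i ?y" if i: "i < n" for i
      proof -
        have "F i ?y = F i (emb w) / \<mu> v"
          using X.dual_scale[OF X.dual_ball_space[OF F(1)[OF i]], of "emb w" "1 / \<mu> v"] w by simp
        moreover have "(F i (emb u) / \<mu> u - \<delta>) * \<mu> v < F i (emb w)" using w(3) i by blast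
        ultimately show ?thesis using dual_ball_nrm[OF F(1)[OF i] u] vp by (simp add: pos_less_divide_eq)
      qed
      ultimately have "Xnorm \<mu> (nrm v - ?y) \<le> 2 - \<delta>" by (intro F(2)) auto
      then show ?thesis using diff[OF w(1)] vp by (simp add: pos_divide_le_eq)
    qed
    then show "V_point_gap \<mu> v u n \<delta>"
      unfolding V_point_gap_def using V_dual_restrict[of n F, OF F(1)]
      by (intro exI[of _ "\<lambda>i v. F i (emb v)"]) blast
  }
  assume "V_point_gap \<mu> v u n \<delta>"
  then obtain f where f: "V_dual \<mu> n f"
    "\<And>w. w \<in> Vset \<Longrightarrow> \<mu> w < \<mu> v \<Longrightarrow> (\<forall>i<n. (f i u / \<mu> u - \<delta>) * \<mu> v < f i w) \<Longrightarrow>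
        \<mu> (\<lambda>m. v m - w m) \<le> (2 - \<delta>) * \<mu> v"
    unfolding V_point_gap_def by blast
  obtain F where F: "\<And>i. i < n \<Longrightarrow> F i \<in> X.D\<^sub>X"
    "\<And>i v. i < n \<Longrightarrow> v \<in> Vset \<Longrightarrow> F i (emb v) = f i v" using V_dual_extend[OF f(1)] by blast
  have "Xnorm \<mu> (nrm v - y) \<le> 2 - \<delta>"
    if y: "y \<in> X.B\<^sub>X" "\<forall>i<n. F i (nrm u) - \<delta> < F i y" for y
  proof (rule field_le_epsilon)
    fix \<epsilon> :: real assume e: "\<epsilon> > 0"
    obtain r where r: "r > 0" "\<And>i. i < n \<Longrightarrow> F i (nrm u) - \<delta> + r \<le> F i y"
      using finite_gap[of n "\<lambda>i. F i (nrm u) - \<delta>" "\<lambda>i. F i y"] y(2) by blast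
    have yX: "y \<in> Xcar \<mu>" using y by (simp add: unit_ball_def)
    obtain w where w: "w \<in> Vset" "\<mu> w < \<mu> v" "Xnorm \<mu> (y - (1 / \<mu> v) *\<^sub>R emb w) < min r \<epsilon>"
      using ball_approx[OF y(1), of "min r \<epsilon>" "\<mu> v"] r(1) e vp by auto
    let ?w = "(1 / \<mu> v) *\<^sub>R emb w"
    have wX: "?w \<in> Xcar \<mu>" using w by simp
    have "(f i u / \<mu> u - \<delta>) * \<mu> v < f i w" if i: "i < n" for i
    proof -
      have "F i ?w = f i w / \<mu> v"
        using X.dual_scale[OF X.dual_ball_space[OF F(1)[OF i]], of "emb w" "1 / \<mu> v"] w F(2)[OF i] by simp
      moreover have "\<bar>F i y - F i ?w\<bar> < r" using X.dual_ball_diff_le[OF F(1)[OF i] yX wX] w(3) by simp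
      moreover have "F i (nrm u) = f i u / \<mu> u" using dual_ball_nrm[OF F(1)[OF i] u] F(2)[OF i u] by simp
      ultimately have "f i u / \<mu> u - \<delta> < f i w / \<mu> v" using r(2)[OF i] by linarith
      then show ?thesis using vp by (simp add: pos_less_divide_eq)
    qed
    then have "\<mu> (\<lambda>m. v m - w m) \<le> (2 - \<delta>) * \<mu> v" using f(2) w by blast
    then have "Xnorm \<mu> (nrm v - ?w) \<le> 2 - \<delta>" using diff[OF w(1)] vp by (simp add: pos_divide_le_eq)
    moreover have "Xnorm \<mu> (nrm v - y) \<le> Xnorm \<mu> (nrm v - ?w) + Xnorm \<mu> (?w - y)"
      using v yX wX by (intro X.N_diff_trans) auto
    moreover have "Xnorm \<mu> (?w - y) < \<epsilon>" using w(3) X.N_minus_commute[OF wX yX] by simp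
    ultimately show "Xnorm \<mu> (nrm v - y) \<le> 2 - \<delta> + \<epsilon>" by linarith
  qed
  then show "X.point_gap (nrm v) (nrm u) n \<delta>" unfolding X.point_gap_def using F(1) by blast
qed

lemma emb_comb:
  assumes "\<And>i. i < n \<Longrightarrow> x i \<in> Vset \<and> y i \<in> Vset"
  shows "emb (\<lambda>m. \<Sum>i<n. of_nat (l i) * (x i m - y i m)) = (\<Sum>i<n. real (l i) *\<^sub>R (emb (x i) - emb (y i)))"
proof -
  have "emb (\<lambda>m. \<Sum>i<n. of_nat (l i) * (x i m - y i m)) = (\<Sum>i<n. emb (\<lambda>m. of_nat (l i) * (x i m - y i m)))"
    using assms Vset_diff by (intro X.\<iota>_sum) auto
  also have "\<dots> = (\<Sum>i<n. real (l i) *\<^sub>R (emb (x i) - emb (y i)))"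
    using assms by (intro sum.cong) (simp_all add: X.\<iota>_scale[OF Vset_diff] X.\<iota>_diff)
  finally show ?thesis .
qed

lemma slices_gap_iff:
  assumes u: "\<And>i. i < n \<Longrightarrow> u i \<in> Vset \<and> u i \<noteq> (\<lambda>n. 0)"
  shows "X.slices_gap (\<lambda>i. nrm (u i)) n l \<delta> \<longleftrightarrow> V_slices_gap \<mu> u n l \<delta>"
proof
  assume "X.slices_gap (\<lambda>i. nrm (u i)) n l \<delta>"
  then obtain F where F: "\<And>i. i < n \<Longrightarrow> F i \<in> X.D\<^sub>X"
    "\<And>i. i < n \<Longrightarrow> \<delta> \<le> F i (nrm (u i))"
    "\<And>x y. \<forall>i<n. x i \<in> X.B\<^sub>X \<and> F i (nrm (u i)) - \<delta> < F i (x i) \<and>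
                  y i \<in> X.B\<^sub>X \<and> F i (nrm (u i)) - \<delta> < F i (y i) \<Longrightarrow>
        Xnorm \<mu> (\<Sum>i<n. real (l i) *\<^sub>R (x i - y i)) \<le> (2 - \<delta>) * (\<Sum>i<n. real (l i))"
    unfolding X.slices_gap_def by blast
  have Fu: "F i (nrm (u i)) = F i (emb (u i)) / \<mu> (u i)" if "i < n" for i
    using dual_ball_nrm[OF F(1)[OF that]] u[OF that] by blast
  have "\<mu> (\<lambda>m. \<Sum>i<n. of_nat (l i) * (x i m - y i m)) \<le> (2 - \<delta>) * (\<Sum>i<n. real (l i))"
    if xy: "\<forall>i<n. x i \<in> Vset \<and> y i \<in> Vset"
      and h: "\<forall>i<n. \<mu> (x i) < 1 \<and> \<mu> (y i) < 1 \<and>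
               F i (emb (u i)) / \<mu> (u i) - \<delta> < F i (emb (x i)) \<and> F i (emb (u i)) / \<mu> (u i) - \<delta> < F i (emb (y i))" for x y
  proof -
    have "Xnorm \<mu> (\<Sum>i<n. real (l i) *\<^sub>R (emb (x i) - emb (y i))) \<le> (2 - \<delta>) * (\<Sum>i<n. real (l i))"
      using xy h by (intro F(3)) (auto simp: unit_ball_def Xnorm_emb Fu less_imp_le)
    then have "Xnorm \<mu> (emb (\<lambda>m. \<Sum>i<n. of_nat (l i) * (x i m - y i m))) \<le> (2 - \<delta>) * (\<Sum>i<n. real (l i))"
      using emb_comb[of n x y l] xy by simp
    moreover have "(\<lambda>m. \<Sum>i<n. of_nat (l i) * (x i m - y i m)) \<in> Vset"
      using xy by (intro Vset_sum Vset_scale Vset_diff) auto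
    ultimately show ?thesis by (simp add: Xnorm_emb)
  qed
  then show "V_slices_gap \<mu> u n l \<delta>"
    unfolding V_slices_gap_def using V_dual_restrict[of n F, OF F(1)] F(2) Fu
    by (intro exI[of _ "\<lambda>i v. F i (emb v)"]) auto
next
  assume "V_slices_gap \<mu> u n l \<delta>"
  then obtain f where f: "V_dual \<mu> n f" "\<And>i. i < n \<Longrightarrow> \<delta> \<le> f i (u i) / \<mu> (u i)"
    "\<And>x y. \<forall>i<n. x i \<in> Vset \<and> y i \<in> Vset \<Longrightarrow>
        \<forall>i<n. \<mu> (x i) < 1 \<and> \<mu> (y i) < 1 \<and>
               f i (u i) / \<mu> (u i) - \<delta> < f i (x i) \<and> f i (u i) / \<mu> (u i) - \<delta> < f i (y i) \<Longrightarrow>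
        \<mu> (\<lambda>m. \<Sum>i<n. of_nat (l i) * (x i m - y i m)) \<le> (2 - \<delta>) * (\<Sum>i<n. real (l i))"
    unfolding V_slices_gap_def by blast
  obtain F where F: "\<And>i. i < n \<Longrightarrow> F i \<in> X.D\<^sub>X"
    "\<And>i v. i < n \<Longrightarrow> v \<in> Vset \<Longrightarrow> F i (emb v) = f i v" using V_dual_extend[OF f(1)] by blast
  have Fu: "F i (nrm (u i)) = f i (u i) / \<mu> (u i)" if "i < n" for i
    using dual_ball_nrm[OF F(1)[OF that]] u[OF that] F(2)[OF that] by simp
  have "Xnorm \<mu> (\<Sum>i<n. real (l i) *\<^sub>R (x i - y i)) \<le> (2 - \<delta>) * (\<Sum>i<n. real (l i))"
    if xy: "\<forall>i<n. x i \<in> X.B\<^sub>X \<and> F i (nrm (u i)) - \<delta> < F i (x i) \<and>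
                  y i \<in> X.B\<^sub>X \<and> F i (nrm (u i)) - \<delta> < F i (y i)" for x y
  proof (rule field_le_epsilon)
    fix \<epsilon> :: real assume e: "\<epsilon> > 0"
    \<comment> \<open>The added 1 allows division by \<open>L\<close> even if all weights vanish;
      replacing all \<open>x i\<close> and \<open>y i\<close> by rational vectors then costs at most
      \<open>2 * \<eta> * L = \<epsilon>\<close>.\<close>
    define L where "L = (\<Sum>i<n. real (l i)) + 1"
    have L: "L > 0" unfolding L_def by (intro add_nonneg_pos sum_nonneg) auto
    define \<eta> where "\<eta> = \<epsilon> / (2 * L)"
    have \<eta>: "\<eta> > 0" using e L by (simp add: \<eta>_def)
    have ap: "\<exists>w. w \<in> Vset \<and> \<mu> w < 1 \<and> f i (u i) / \<mu> (u i) - \<delta> < f i w \<and> Xnorm \<mu> (z - emb w) < \<eta>"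
      if i: "i < n" and z: "z \<in> X.B\<^sub>X" "F i (nrm (u i)) - \<delta> < F i z" for i z
    proof -
      obtain w where w: "w \<in> Vset" "\<mu> w < 1" "Xnorm \<mu> (z - (1 / 1) *\<^sub>R emb w) < min \<eta> (F i z - (F i (nrm (u i)) - \<delta>))"
        using ball_approx[OF z(1), of "min \<eta> (F i z - (F i (nrm (u i)) - \<delta>))" 1] \<eta> z(2) by auto
      have "\<bar>F i z - F i (emb w)\<bar> \<le> Xnorm \<mu> (z - emb w)"
        using z w by (intro X.dual_ball_diff_le[OF F(1)[OF i]]) (auto simp: unit_ball_def)
      moreover have "Xnorm \<mu> (z - emb w) < F i z - (F i (nrm (u i)) - \<delta>)" using w(3) by simp
      ultimately have "F i (nrm (u i)) - \<delta> < F i (emb w)" by linarith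
      then show ?thesis using w F(2)[OF i w(1)] Fu[OF i] by (intro exI[of _ w]) auto
    qed
    have "\<forall>i. \<exists>w. i < n \<longrightarrow> w \<in> Vset \<and> \<mu> w < 1 \<and> f i (u i) / \<mu> (u i) - \<delta> < f i w \<and> Xnorm \<mu> (x i - emb w) < \<eta>"
      using ap xy by blast
    then obtain a where a: "\<And>i. i < n \<Longrightarrow> a i \<in> Vset \<and> \<mu> (a i) < 1 \<and> f i (u i) / \<mu> (u i) - \<delta> < f i (a i) \<and> Xnorm \<mu> (x i - emb (a i)) < \<eta>"
      by metis
    have "\<forall>i. \<exists>w. i < n \<longrightarrow> w \<in> Vset \<and> \<mu> w < 1 \<and> f i (u i) / \<mu> (u i) - \<delta> < f i w \<and> Xnorm \<mu> (y i - emb w) < \<eta>"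
      using ap xy by blast
    then obtain b where b: "\<And>i. i < n \<Longrightarrow> b i \<in> Vset \<and> \<mu> (b i) < 1 \<and> f i (u i) / \<mu> (u i) - \<delta> < f i (b i) \<and> Xnorm \<mu> (y i - emb (b i)) < \<eta>"
      by metis
    have "\<mu> (\<lambda>m. \<Sum>i<n. of_nat (l i) * (a i m - b i m)) \<le> (2 - \<delta>) * (\<Sum>i<n. real (l i))"
      using a b by (intro f(3)) auto
    moreover have "(\<lambda>m. \<Sum>i<n. of_nat (l i) * (a i m - b i m)) \<in> Vset"
      using a b by (intro Vset_sum Vset_scale Vset_diff) auto
    ultimately have 1: "Xnorm \<mu> (\<Sum>i<n. real (l i) *\<^sub>R (emb (a i) - emb (b i))) \<le> (2 - \<delta>) * (\<Sum>i<n. real (l i))"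
      using emb_comb[of n a b l] a b by (simp add: Xnorm_emb[symmetric])
    have xyX: "x i \<in> Xcar \<mu>" "y i \<in> Xcar \<mu>" if "i < n" for i using xy that by (auto simp: unit_ball_def)
    let ?d = "\<lambda>i. real (l i) *\<^sub>R ((x i - emb (a i)) - (y i - emb (b i)))"
    have eq: "(\<Sum>i<n. real (l i) *\<^sub>R (x i - y i)) = (\<Sum>i<n. real (l i) *\<^sub>R (emb (a i) - emb (b i))) + (\<Sum>i<n. ?d i)"
      unfolding sum.distrib[symmetric] by (intro sum.cong) (auto simp: scaleR_diff_right)
    have "Xnorm \<mu> (\<Sum>i<n. ?d i) \<le> (\<Sum>i<n. Xnorm \<mu> (?d i))" using xyX a b by (intro X.N_sum) auto
    also have "\<dots> \<le> (\<Sum>i<n. real (l i) * (2 * \<eta>))"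
    proof (intro sum_mono)
      fix i assume "i \<in> {..<n}"
      then have i: "i < n" by simp
      have "Xnorm \<mu> ((x i - emb (a i)) - (y i - emb (b i))) \<le> Xnorm \<mu> (x i - emb (a i)) + Xnorm \<mu> (y i - emb (b i))"
        using xyX[OF i] a[OF i] b[OF i] by (intro X.N_diff) auto
      also have "\<dots> \<le> 2 * \<eta>" using a[OF i] b[OF i] by simp
      finally show "Xnorm \<mu> (?d i) \<le> real (l i) * (2 * \<eta>)"
        using xyX[OF i] a[OF i] b[OF i] X.N_scale[of "(x i - emb (a i)) - (y i - emb (b i))" "real (l i)"]
        by (simp add: mult_left_mono)
    qed
    also have "\<dots> = (L - 1) * (2 * \<eta>)" by (simp add: L_def sum_distrib_right)
    also have "\<dots> \<le> L * (2 * \<eta>)" using \<eta> by (intro mult_right_mono) auto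
    also have "\<dots> = \<epsilon>" using L by (simp add: \<eta>_def)
    finally have 2: "Xnorm \<mu> (\<Sum>i<n. ?d i) \<le> \<epsilon>" .
    have "Xnorm \<mu> (\<Sum>i<n. real (l i) *\<^sub>R (x i - y i)) \<le> Xnorm \<mu> (\<Sum>i<n. real (l i) *\<^sub>R (emb (a i) - emb (b i))) + Xnorm \<mu> (\<Sum>i<n. ?d i)"
      unfolding eq using xyX a b by (intro X.N_add X.sum_mem) auto
    then show "Xnorm \<mu> (\<Sum>i<n. real (l i) *\<^sub>R (x i - y i)) \<le> (2 - \<delta>) * (\<Sum>i<n. real (l i)) + \<epsilon>"
      using 1 2 by linarith
  qed
  then show "X.slices_gap (\<lambda>i. nrm (u i)) n l \<delta>"
    unfolding X.slices_gap_def using F(1) Fu f(2) by (intro exI[of _ F]) auto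
qed

lemma point_gap_V1:
  assumes g: "X.point_gap x z n \<delta>" and d: "\<delta> > 0"
    and x: "x \<in> X.S\<^sub>X" and z: "z \<in> X.S\<^sub>X"
  shows "\<exists>v\<in>V\<^sub>1. \<exists>u\<in>V\<^sub>1. (x = z \<longrightarrow> v = u) \<and> (\<exists>k. V_point_gap \<mu> v u n (1 / real (Suc k)))"
proof -
  obtain v where v: "v \<in> V\<^sub>1" "Xnorm \<mu> (x - nrm v) \<le> \<delta> / 2" using sphere_approx[OF x, of "\<delta> / 2"] d by auto
  obtain u' where u': "u' \<in> V\<^sub>1" "Xnorm \<mu> (z - nrm u') \<le> \<delta> / 2" using sphere_approx[OF z, of "\<delta> / 2"] d by auto
  \<comment> \<open>Equal centres receive the same rational approximation, so the lemma also covers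
    the diagonal gaps of DLD2P and DD2P.\<close>
  define u where "u = (if x = z then v else u')"
  have u: "u \<in> V\<^sub>1" "Xnorm \<mu> (z - nrm u) \<le> \<delta> / 2" "x = z \<longrightarrow> v = u" using v u' by (auto simp: u_def)
  have "X.point_gap (nrm v) (nrm u) n (\<delta> / 2)"
    using x z u v by (intro X.point_gap_perturb[OF g]) (auto simp: unit_sphere_def)
  moreover obtain k where k: "1 / real (Suc k) \<le> \<delta> / 2" using inverse_Suc_below[OF half_gt_zero[OF d]] by auto
  ultimately have "X.point_gap (nrm v) (nrm u) n (1 / real (Suc k))" by (rule X.point_gap_mono)
  then have "V_point_gap \<mu> v u n (1 / real (Suc k))" using point_gap_iff[of v u n] v u by blast
  then show ?thesis using u v by blast
qed

lemma V1_point_gap: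
  assumes "v \<in> V\<^sub>1" "u \<in> V\<^sub>1" "V_point_gap \<mu> v u n \<delta>"
  shows "X.point_gap (nrm v) (nrm u) n \<delta>" "nrm v \<in> X.S\<^sub>X"
    "nrm u \<in> X.S\<^sub>X"
  using assms point_gap_iff[of v u n] nrm_sphere by auto

lemma not_Daugavet_V:
  "\<not> Daugavet (Xcar \<mu>) (Xnorm \<mu>) \<longleftrightarrow> (\<exists>v\<in>V\<^sub>1. \<exists>u\<in>V\<^sub>1. \<exists>k. V_point_gap \<mu> v u 1 (1 / real (Suc k)))"
  unfolding X.not_Daugavet_iff
proof (intro iffI; elim bexE exE conjE)
  fix x z \<delta> assume "x \<in> X.S\<^sub>X" "z \<in> X.S\<^sub>X" "0 < \<delta>" "X.point_gap x z 1 \<delta>"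
  then show "\<exists>v\<in>V\<^sub>1. \<exists>u\<in>V\<^sub>1. \<exists>k. V_point_gap \<mu> v u 1 (1 / real (Suc k))" using point_gap_V1 by blast
next
  fix v u k assume "v \<in> V\<^sub>1" "u \<in> V\<^sub>1" "V_point_gap \<mu> v u 1 (1 / real (Suc k))"
  from V1_point_gap[OF this] show "\<exists>x\<in>X.S\<^sub>X. \<exists>z\<in>X.S\<^sub>X. \<exists>\<delta>>0. X.point_gap x z 1 \<delta>"
    by (metis of_nat_0_less_iff zero_less_Suc zero_less_divide_1_iff)
qed

lemma not_DLD2P_V:
  "\<not> DLD2P (Xcar \<mu>) (Xnorm \<mu>) \<longleftrightarrow> (\<exists>v\<in>V\<^sub>1. \<exists>k. V_point_gap \<mu> v v 1 (1 / real (Suc k)))"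
  unfolding X.not_DLD2P_iff
proof (intro iffI; elim bexE exE conjE)
  fix x \<delta> assume "x \<in> X.S\<^sub>X" "0 < \<delta>" "X.point_gap x x 1 \<delta>"
  then show "\<exists>v\<in>V\<^sub>1. \<exists>k. V_point_gap \<mu> v v 1 (1 / real (Suc k))" using point_gap_V1[of x x] by blast
next
  fix v k assume "v \<in> V\<^sub>1" "V_point_gap \<mu> v v 1 (1 / real (Suc k))"
  from V1_point_gap[OF this(1) this(1) this(2)] show "\<exists>x\<in>X.S\<^sub>X. \<exists>\<delta>>0. X.point_gap x x 1 \<delta>"
    by (metis of_nat_0_less_iff zero_less_Suc zero_less_divide_1_iff)
qed

lemma not_DD2P_V:
  "\<not> DD2P (Xcar \<mu>) (Xnorm \<mu>) \<longleftrightarrow> (\<exists>v\<in>V\<^sub>1. \<exists>n k. V_point_gap \<mu> v v n (1 / real (Suc k)))"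
  unfolding X.not_DD2P_iff
proof (intro iffI; elim bexE exE conjE)
  fix x n \<delta> assume "x \<in> X.S\<^sub>X" "0 < \<delta>" "X.point_gap x x n \<delta>"
  then show "\<exists>v\<in>V\<^sub>1. \<exists>n k. V_point_gap \<mu> v v n (1 / real (Suc k))" using point_gap_V1[of x x] by blast
next
  fix v n k assume "v \<in> V\<^sub>1" "V_point_gap \<mu> v v n (1 / real (Suc k))"
  from V1_point_gap[OF this(1) this(1) this(2)] show "\<exists>x\<in>X.S\<^sub>X. \<exists>n. \<exists>\<delta>>0. X.point_gap x x n \<delta>"
    by (metis of_nat_0_less_iff zero_less_Suc zero_less_divide_1_iff)
qed

lemma slices_gap_V1:
  assumes g: "X.slices_gap z n l \<delta>" and d: "\<delta> > 0"
    and z: "\<And>i. i < n \<Longrightarrow> z i \<in> X.S\<^sub>X"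
  shows "\<exists>u k. (\<forall>i<n. u i \<in> V\<^sub>1) \<and> V_slices_gap \<mu> u n l (1 / real (Suc k))"
proof -
  have "\<forall>i. \<exists>v. i < n \<longrightarrow> v \<in> V\<^sub>1 \<and> Xnorm \<mu> (z i - nrm v) \<le> \<delta> / 2"
  proof
    fix i
    have "\<exists>v. v \<in> V\<^sub>1 \<and> Xnorm \<mu> (z i - nrm v) \<le> \<delta> / 2" if i: "i < n"
      using sphere_approx[OF z[OF i], of "\<delta> / 2"] d by auto
    then show "\<exists>v. i < n \<longrightarrow> v \<in> V\<^sub>1 \<and> Xnorm \<mu> (z i - nrm v) \<le> \<delta> / 2" by blast
  qed
  then obtain u where u: "\<And>i. i < n \<Longrightarrow> u i \<in> V\<^sub>1 \<and> Xnorm \<mu> (z i - nrm (u i)) \<le> \<delta> / 2" by metis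
  have "X.slices_gap (\<lambda>i. nrm (u i)) n l (\<delta> / 2)"
    using z u by (intro X.slices_gap_perturb[OF g]) (auto simp: unit_sphere_def)
  moreover obtain k where k: "1 / real (Suc k) \<le> \<delta> / 2" using inverse_Suc_below[OF half_gt_zero[OF d]] by auto
  ultimately have "X.slices_gap (\<lambda>i. nrm (u i)) n l (1 / real (Suc k))" by (rule X.slices_gap_mono)
  then have "V_slices_gap \<mu> u n l (1 / real (Suc k))" using slices_gap_iff[of n u] u by blast
  then show ?thesis using u by blast
qed

lemma V1_slices_gap:
  assumes "\<And>i. i < n \<Longrightarrow> u i \<in> V\<^sub>1" "V_slices_gap \<mu> u n l \<delta>"
  shows "X.slices_gap (\<lambda>i. nrm (u i)) n l \<delta>" "\<forall>i<n. nrm (u i) \<in> X.S\<^sub>X"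
  using assms slices_gap_iff[of n u] nrm_sphere by auto

lemma not_LD2P_V:
  "\<not> LD2P (Xcar \<mu>) (Xnorm \<mu>) \<longleftrightarrow> (\<exists>v\<in>V\<^sub>1. \<exists>k. V_slices_gap \<mu> (\<lambda>_. v) 1 (\<lambda>_. 1) (1 / real (Suc k)))"
  unfolding X.not_LD2P_iff
proof (intro iffI; elim bexE exE conjE)
  fix z \<delta> assume "z \<in> X.S\<^sub>X" "0 < \<delta>" "X.slices_gap (\<lambda>_. z) 1 (\<lambda>_. 1) \<delta>"
  then obtain u k where u: "\<forall>i<1. u i \<in> V\<^sub>1" "V_slices_gap \<mu> u 1 (\<lambda>_. 1) (1 / real (Suc k))"
    using slices_gap_V1[of "\<lambda>_. z" 1] by blast
  moreover have "V_slices_gap \<mu> u 1 (\<lambda>_. 1) (1 / real (Suc k)) \<longleftrightarrow> V_slices_gap \<mu> (\<lambda>_. u 0) 1 (\<lambda>_. 1) (1 / real (Suc k))"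
    by (rule V_slices_gap_cong) simp
  ultimately show "\<exists>v\<in>V\<^sub>1. \<exists>k. V_slices_gap \<mu> (\<lambda>_. v) 1 (\<lambda>_. 1) (1 / real (Suc k))" by auto
next
  fix v k assume v: "v \<in> V\<^sub>1" "V_slices_gap \<mu> (\<lambda>_. v) 1 (\<lambda>_. 1) (1 / real (Suc k))"
  have "X.slices_gap (\<lambda>_. nrm v) 1 (\<lambda>_. 1) (1 / real (Suc k))" by (rule V1_slices_gap(1)) (use v in auto)
  moreover have "nrm v \<in> X.S\<^sub>X" using v(1) nrm_sphere by auto
  ultimately show "\<exists>z\<in>X.S\<^sub>X. \<exists>\<delta>>0. X.slices_gap (\<lambda>_. z) 1 (\<lambda>_. 1) \<delta>"
    by (metis of_nat_0_less_iff zero_less_Suc zero_less_divide_1_iff)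
qed

text \<open>A list of pairs packs the number of slices, their centres and their weights into one
  element of a countable set.\<close>

lemma not_SD2P_V:
  "\<not> SD2P (Xcar \<mu>) (Xnorm \<mu>) \<longleftrightarrow> (\<exists>ps\<in>lists (V\<^sub>1 \<times> UNIV). \<exists>k. (\<Sum>i<length ps. snd (ps ! i)) > 0 \<and>
     V_slices_gap \<mu> (\<lambda>i. fst (ps ! i)) (length ps) (\<lambda>i. snd (ps ! i)) (1 / real (Suc k)))"
  unfolding X.not_SD2P_iff
proof (intro iffI; elim bexE exE conjE)
  fix n l z \<delta> assume h: "\<forall>i<n. z i \<in> X.S\<^sub>X" "0 < (\<Sum>i<n. l i)" "0 < \<delta>" "X.slices_gap z n l \<delta>"
  then obtain u k where u: "\<forall>i<n. u i \<in> V\<^sub>1" "V_slices_gap \<mu> u n l (1 / real (Suc k))"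
    using slices_gap_V1[of z n] by blast
  define ps where "ps = map (\<lambda>i. (u i, l i)) [0..<n]"
  have "ps \<in> lists (V\<^sub>1 \<times> UNIV)" using u(1) unfolding ps_def in_lists_conv_set by fastforce
  moreover have "(\<Sum>i<length ps. snd (ps ! i)) = (\<Sum>i<n. l i)" by (rule sum.cong) (auto simp: ps_def)
  moreover have "V_slices_gap \<mu> u n l (1 / real (Suc k)) \<longleftrightarrow>
      V_slices_gap \<mu> (\<lambda>i. fst (ps ! i)) n (\<lambda>i. snd (ps ! i)) (1 / real (Suc k))"
    by (rule V_slices_gap_cong) (simp add: ps_def)
  moreover have "length ps = n" by (simp add: ps_def)
  ultimately show "\<exists>ps\<in>lists (V\<^sub>1 \<times> UNIV). \<exists>k. (\<Sum>i<length ps. snd (ps ! i)) > 0 \<and>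
     V_slices_gap \<mu> (\<lambda>i. fst (ps ! i)) (length ps) (\<lambda>i. snd (ps ! i)) (1 / real (Suc k))"
    using h(2) u(2) by (intro bexI[of _ ps] exI[of _ k]) auto
next
  fix ps k assume ps: "ps \<in> lists (V\<^sub>1 \<times> UNIV)" and pos: "(\<Sum>i<length ps. snd (ps ! i)) > 0"
    and g: "V_slices_gap \<mu> (\<lambda>i. fst (ps ! i)) (length ps) (\<lambda>i. snd (ps ! i)) (1 / real (Suc k))"
  have "fst (ps ! i) \<in> V\<^sub>1" if "i < length ps" for i
    using ps nth_mem[OF that] by (auto simp: in_lists_conv_set)
  note V1_slices_gap[of "length ps" "\<lambda>i. fst (ps ! i)", OF this g]
  then show "\<exists>n l z. \<exists>\<delta>>0. (\<forall>i<n. z i \<in> X.S\<^sub>X) \<and> (\<Sum>i<n. l i) > 0 \<and> X.slices_gap z n l \<delta>"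
    using pos by (metis of_nat_0_less_iff zero_less_Suc zero_less_divide_1_iff)
qed

end

section \<open>The classes are \<open>G\<^sub>\<delta>\<close>\<close>

text \<open>Predicates instead of sets let the topological rules follow the logical shape of the gap
  conditions.\<close>

definition closed_cond :: "'a topology \<Rightarrow> ('a \<Rightarrow> bool) \<Rightarrow> bool" where
  "closed_cond Z P \<longleftrightarrow> closedin Z {z \<in> topspace Z. P z}"

definition open_cond :: "'a topology \<Rightarrow> ('a \<Rightarrow> bool) \<Rightarrow> bool" where
  "open_cond Z P \<longleftrightarrow> openin Z {z \<in> topspace Z. P z}"

lemma closed_cond_const: "closed_cond Z (\<lambda>z. Q)"
  by (cases Q) (auto simp: closed_cond_def)

lemma closed_cond_all:
  assumes "\<And>j. closed_cond Z (P j)" shows "closed_cond Z (\<lambda>z. \<forall>j. P j z)"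
proof -
  have "{z \<in> topspace Z. \<forall>j. P j z} = \<Inter> (range (\<lambda>j. {z \<in> topspace Z. P j z}))" by auto
  then show ?thesis using assms unfolding closed_cond_def by (auto intro!: closedin_Inter)
qed

lemma closed_cond_if:
  assumes "Q \<Longrightarrow> closed_cond Z P" shows "closed_cond Z (\<lambda>z. Q \<longrightarrow> P z)"
  using assms closed_cond_const[of Z True] by (cases Q) auto

lemma closed_cond_Ball:
  assumes "\<And>v. v \<in> A \<Longrightarrow> closed_cond Z (P v)" shows "closed_cond Z (\<lambda>z. \<forall>v\<in>A. P v z)"
  unfolding Ball_def using assms by (intro closed_cond_all closed_cond_if)

lemma closed_cond_conj:
  assumes "closed_cond Z P" "closed_cond Z Q" shows "closed_cond Z (\<lambda>z. P z \<and> Q z)"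
proof -
  have "{z \<in> topspace Z. P z \<and> Q z} = {z \<in> topspace Z. P z} \<inter> {z \<in> topspace Z. Q z}" by auto
  then show ?thesis using assms by (simp add: closed_cond_def closedin_Int)
qed

text \<open>This rule dictates the strict premises and weak conclusions in the gap
  conditions.\<close>

lemma closed_cond_imp:
  assumes "open_cond Z P" "closed_cond Z Q" shows "closed_cond Z (\<lambda>z. P z \<longrightarrow> Q z)"
proof -
  have "{z \<in> topspace Z. P z \<longrightarrow> Q z} = (topspace Z - {z \<in> topspace Z. P z}) \<union> {z \<in> topspace Z. Q z}" by auto
  then show ?thesis using assms by (simp add: closed_cond_def open_cond_def closedin_Un closedin_diff)
qed

lemma open_cond_conj:
  assumes "open_cond Z P" "open_cond Z Q" shows "open_cond Z (\<lambda>z. P z \<and> Q z)"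
proof -
  have "{z \<in> topspace Z. P z \<and> Q z} = {z \<in> topspace Z. P z} \<inter> {z \<in> topspace Z. Q z}" by auto
  then show ?thesis using assms by (simp add: open_cond_def openin_Int)
qed

lemma open_cond_all_less:
  assumes "\<And>i. i < n \<Longrightarrow> open_cond Z (P i)" shows "open_cond Z (\<lambda>z. \<forall>i<(n::nat). P i z)"
  using assms
proof (induction n)
  case 0
  then show ?case by (simp add: open_cond_def)
next
  case (Suc n)
  have "(\<lambda>z. \<forall>i<Suc n. P i z) = (\<lambda>z. (\<forall>i<n. P i z) \<and> P n z)" by (auto simp: less_Suc_eq)
  then show ?case using Suc open_cond_conj[of Z "\<lambda>z. \<forall>i<n. P i z" "P n"] by simp
qed

lemma closed_cond_le:
  assumes "continuous_map Z euclideanreal a" "continuous_map Z euclideanreal b"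
  shows "closed_cond Z (\<lambda>z. a z \<le> b z)"
proof -
  have "closedin Z {z \<in> topspace Z. b z - a z \<in> {0..}}"
    by (rule closedin_continuous_map_preimage[of _ euclideanreal]) (use assms in \<open>auto intro!: continuous_intros\<close>)
  then show ?thesis by (simp add: closed_cond_def)
qed

lemma closed_cond_eq:
  assumes "continuous_map Z euclideanreal a" "continuous_map Z euclideanreal b"
  shows "closed_cond Z (\<lambda>z. a z = b z)"
  unfolding order_eq_iff using assms by (intro closed_cond_conj closed_cond_le)

lemma open_cond_less:
  assumes "continuous_map Z euclideanreal a" "continuous_map Z euclideanreal b"
  shows "open_cond Z (\<lambda>z. a z < b z)"
proof -
  have "openin Z {z \<in> topspace Z. b z - a z \<in> {0<..}}"
    by (rule openin_continuous_map_preimage[of _ euclideanreal]) (use assms in \<open>auto intro!: continuous_intros\<close>)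
  then show ?thesis by (simp add: open_cond_def)
qed

text \<open>A functional \<open>f\<close> bounded by \<open>\<mu>\<close> is encoded as \<open>f v = \<mu> v * g (i, v)\<close> with a point \<open>g\<close> of
  this compact cube, so that quantifying over functionals is a projection along a compact factor.\<close>

definition cube :: "(nat \<times> (nat \<Rightarrow> rat) \<Rightarrow> real) topology" where
  "cube = product_topology (\<lambda>_. subtopology euclideanreal {-1..1}) (UNIV \<times> Vset)"

lemma compact_cube: "compact_space cube"
  unfolding cube_def by (simp add: compact_space_product_topology compact_space_subtopology)

lemma topspace_Btop: "topspace Btop = Bset"
  by (auto simp: Btop_def Bset_def Pset_def)

abbreviation "BC \<equiv> prod_topology Btop cube"

lemma continuous_map_eval: "v \<in> Vset \<Longrightarrow> continuous_map Btop euclideanreal (\<lambda>\<mu>. \<mu> v)"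
  unfolding Btop_def RV_def
  by (intro continuous_map_from_subtopology continuous_map_product_projection)

lemma continuous_BC_fst: "v \<in> Vset \<Longrightarrow> continuous_map BC euclideanreal (\<lambda>z. fst z v)"
  using continuous_map_compose[OF continuous_map_fst continuous_map_eval] by (simp add: o_def)

lemma continuous_BC_snd:
  assumes "v \<in> Vset" shows "continuous_map BC euclideanreal (\<lambda>z. snd z (i, v))"
proof -
  have "continuous_map cube (subtopology euclideanreal {-1..1}) (\<lambda>g. g (i, v))"
    unfolding cube_def using assms by (intro continuous_map_product_projection) auto
  then have "continuous_map cube euclideanreal (\<lambda>g. g (i, v))" by (rule continuous_map_into_fulltopology)
  then show ?thesis using continuous_map_compose[OF continuous_map_snd] by (fastforce simp: o_def)
qed

definition functional_of :: "((nat \<Rightarrow> rat) \<Rightarrow> real) \<times> (nat \<times> (nat \<Rightarrow> rat) \<Rightarrow> real) \<Rightarrow> nat \<Rightarrow> (nat \<Rightarrow> rat) \<Rightarrow> real" where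
  "functional_of z i v = fst z v * snd z (i, v)"

lemma continuous_functional_of: "v \<in> Vset \<Longrightarrow> continuous_map BC euclideanreal (\<lambda>z. functional_of z i v)"
  unfolding functional_of_def by (intro continuous_intros continuous_BC_fst continuous_BC_snd)

lemma Bset_norm_V: "\<mu> \<in> Bset \<Longrightarrow> norm_V \<mu>"
proof -
  assume B: "\<mu> \<in> Bset"
  then interpret seminorm_V \<mu> by unfold_locales (simp add: Bset_def Pset_def)
  show ?thesis
  proof
    fix v assume v: "v \<in> Vset" "v \<noteq> (\<lambda>n. 0)"
    have "ratvec v \<noteq> 0" using v by (auto simp: ratvec_def fun_eq_iff)
    then have "mubar \<mu> (ratvec v) \<noteq> 0" using B v by (auto simp: Bset_def)
    then show "0 < \<mu> v" using bar.N_nonneg[of "ratvec v"] v mubar_seminormed(2)[OF \<mu> v(1)] by simp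
  qed
qed

lemma Bset_nonzero: "\<mu> \<in> Bset \<Longrightarrow> v \<in> Vset \<Longrightarrow> v \<noteq> (\<lambda>n. 0) \<Longrightarrow> \<mu> v \<noteq> 0"
  using norm_V.\<mu>_pos[OF Bset_norm_V] by fastforce

lemma closed_V_dual: "closed_cond BC (\<lambda>z. V_dual (fst z) n (functional_of z))"
  unfolding V_dual_def
  by (intro closed_cond_all closed_cond_if closed_cond_conj closed_cond_Ball closed_cond_eq closed_cond_le
      continuous_functional_of continuous_intros continuous_BC_fst) auto

lemma functional_of_surj:
  assumes B: "\<mu> \<in> Bset" and f: "V_dual \<mu> n f"
  obtains g where "g \<in> topspace cube" "\<And>i v. i < n \<Longrightarrow> v \<in> Vset \<Longrightarrow> functional_of (\<mu>, g) i v = f i v"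
proof
  define g where "g = restrict (\<lambda>(i, v). if i < n then f i v / \<mu> v else 0) (UNIV \<times> Vset)"
  interpret norm_V \<mu> by (rule Bset_norm_V[OF B])
  have b: "\<bar>f i v\<bar> \<le> \<mu> v" if "i < n" "v \<in> Vset" for i v using f that by (auto simp: V_dual_def)
  have n: "\<mu> v \<ge> 0" if "v \<in> Vset" for v using seminorm_on_V_nonneg[OF \<mu> that] .
  have "\<bar>f i v / \<mu> v\<bar> \<le> 1" if "i < n" "v \<in> Vset" for i v
    using b[OF that] n[OF that(2)] by (cases "\<mu> v = 0") (auto simp: abs_divide divide_le_eq_1)
  then have "-1 \<le> f i v / \<mu> v \<and> f i v / \<mu> v \<le> 1" if "i < n" "v \<in> Vset" for i v
    using that by (metis abs_le_D1 abs_le_D2 minus_le_iff)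
  then have "g (i, v) \<in> {-1..1}" if "v \<in> Vset" for i v
    using that by (auto simp: g_def)
  then show "g \<in> topspace cube" by (auto simp: cube_def g_def intro!: restrict_PiE)
  \<comment> \<open>Where \<open>\<mu> v = 0\<close>, the bound forces \<open>f i v = 0\<close>, so
    the product recovers \<open>f i v\<close> there too.\<close>
  show "functional_of (\<mu>, g) i v = f i v" if "i < n" "v \<in> Vset" for i v
    using b[OF that] that by (cases "\<mu> v = 0") (auto simp: functional_of_def g_def)
qed

lemma V_dual_cong:
  assumes "\<And>i v. i < n \<Longrightarrow> v \<in> Vset \<Longrightarrow> f i v = f' i v"
  shows "V_dual \<mu> n f \<longleftrightarrow> V_dual \<mu> n f'"
  unfolding V_dual_def using assms by (intro all_cong conj_cong ball_cong refl) simp_all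

text \<open>Projection along a compact factor is a closed map. This is how the existential
  quantifier over functionals is eliminated.\<close>

lemma closedin_projection:
  assumes R: "closed_cond BC R"
  shows "closedin Btop {\<mu> \<in> Bset. \<exists>g\<in>topspace cube. R (\<mu>, g)}"
proof -
  have "closedin Btop (fst ` {z \<in> topspace BC. R z})"
    using closed_map_fst[OF compact_cube, of Btop] R unfolding closed_map_def closed_cond_def by blast
  moreover have "fst ` {z \<in> topspace BC. R z} = {\<mu> \<in> Bset. \<exists>g\<in>topspace cube. R (\<mu>, g)}"
    by (force simp: topspace_Btop)
  ultimately show ?thesis by simp
qed

lemma closedin_V_point_gap:
  assumes v: "v \<in> Vset" "v \<noteq> (\<lambda>n. 0)" and u: "u \<in> Vset" "u \<noteq> (\<lambda>n. 0)"
  shows "closedin Btop {\<mu> \<in> Bset. V_point_gap \<mu> v u n \<delta>}"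
proof -
  define R where "R = (\<lambda>z. V_dual (fst z) n (functional_of z) \<and>
     (\<forall>w\<in>Vset. fst z w < fst z v \<and> (\<forall>i<n. (functional_of z i u / fst z u - \<delta>) * fst z v < functional_of z i w) \<longrightarrow>
        fst z (\<lambda>m. v m - w m) \<le> (2 - \<delta>) * fst z v))"
  \<comment> \<open>Definiteness on \<open>Bset\<close> keeps the denominator away from zero
    pointwise, so the quotient by \<open>fst z u\<close> is continuous.\<close>
  have nz: "z \<in> topspace BC \<Longrightarrow> fst z u \<noteq> 0" for z using Bset_nonzero u by (auto simp: topspace_Btop)
  have "closed_cond BC R"
    unfolding R_def
    by (intro closed_V_dual closed_cond_conj closed_cond_Ball closed_cond_imp open_cond_conj open_cond_all_less
       open_cond_less closed_cond_le continuous_intros continuous_functional_of continuous_BC_fst)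
      (use u v nz in auto)
  moreover have "V_point_gap \<mu> v u n \<delta> \<longleftrightarrow> (\<exists>g\<in>topspace cube. R (\<mu>, g))" if B: "\<mu> \<in> Bset" for \<mu>
  proof
    assume "V_point_gap \<mu> v u n \<delta>"
    then obtain f where f: "V_dual \<mu> n f"
     "\<forall>w\<in>Vset. \<mu> w < \<mu> v \<and> (\<forall>i<n. (f i u / \<mu> u - \<delta>) * \<mu> v < f i w) \<longrightarrow>
        \<mu> (\<lambda>m. v m - w m) \<le> (2 - \<delta>) * \<mu> v" unfolding V_point_gap_def by blast
    obtain g where g: "g \<in> topspace cube" "\<And>i v. i < n \<Longrightarrow> v \<in> Vset \<Longrightarrow> functional_of (\<mu>, g) i v = f i v"
      using functional_of_surj[OF B f(1)] by blast
    have "V_dual \<mu> n (functional_of (\<mu>, g))" using f(1) V_dual_cong[of n "functional_of (\<mu>, g)" f] g(2) by blast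
    then have "R (\<mu>, g)" unfolding R_def using f(2) g(2) u by simp
    then show "\<exists>g\<in>topspace cube. R (\<mu>, g)" using g by blast
  next
    assume "\<exists>g\<in>topspace cube. R (\<mu>, g)"
    then show "V_point_gap \<mu> v u n \<delta>" unfolding V_point_gap_def R_def by auto
  qed
  ultimately show ?thesis using closedin_projection[of R] by (simp cong: conj_cong)
qed

lemma closedin_V_slices_gap:
  assumes u: "\<And>i. i < n \<Longrightarrow> u i \<in> Vset \<and> u i \<noteq> (\<lambda>n. 0)"
  shows "closedin Btop {\<mu> \<in> Bset. V_slices_gap \<mu> u n l \<delta>}"
proof -
  define R where "R = (\<lambda>z. V_dual (fst z) n (functional_of z) \<and> (\<forall>i<n. \<delta> \<le> functional_of z i (u i) / fst z (u i)) \<and>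
     (\<forall>x y. (\<forall>i<n. x i \<in> Vset \<and> y i \<in> Vset) \<longrightarrow>
        (\<forall>i<n. fst z (x i) < 1 \<and> fst z (y i) < 1 \<and>
               functional_of z i (u i) / fst z (u i) - \<delta> < functional_of z i (x i) \<and>
               functional_of z i (u i) / fst z (u i) - \<delta> < functional_of z i (y i)) \<longrightarrow>
        fst z (\<lambda>m. \<Sum>i<n. of_nat (l i) * (x i m - y i m)) \<le> (2 - \<delta>) * (\<Sum>i<n. real (l i))))"
  have nz: "z \<in> topspace BC \<Longrightarrow> i < n \<Longrightarrow> fst z (u i) \<noteq> 0" for z i using Bset_nonzero u by (auto simp: topspace_Btop)
  have quot: "continuous_map BC euclideanreal (\<lambda>z. functional_of z i (u i) / fst z (u i))" if "i < n" for i
    using u nz that by (intro continuous_map_real_divide continuous_functional_of continuous_BC_fst) auto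
  \<comment> \<open>The quantifier over all families \<open>x\<close> and \<open>y\<close> is
    harmless, as closed sets are stable under arbitrary intersections.\<close>
  have "closed_cond BC R"
    unfolding R_def
    by (intro closed_V_dual closed_cond_conj closed_cond_all closed_cond_if closed_cond_imp open_cond_conj open_cond_all_less
       open_cond_less closed_cond_le continuous_map_diff quot continuous_functional_of continuous_BC_fst)
      (use u in \<open>auto intro!: Vset_sum Vset_scale Vset_diff\<close>)
  moreover have "V_slices_gap \<mu> u n l \<delta> \<longleftrightarrow> (\<exists>g\<in>topspace cube. R (\<mu>, g))" if B: "\<mu> \<in> Bset" for \<mu>
  proof
    assume "V_slices_gap \<mu> u n l \<delta>"
    then obtain f where f: "V_dual \<mu> n f" "\<forall>i<n. \<delta> \<le> f i (u i) / \<mu> (u i)"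
     "\<And>x y. (\<forall>i<n. x i \<in> Vset \<and> y i \<in> Vset) \<Longrightarrow>
        (\<forall>i<n. \<mu> (x i) < 1 \<and> \<mu> (y i) < 1 \<and>
               f i (u i) / \<mu> (u i) - \<delta> < f i (x i) \<and> f i (u i) / \<mu> (u i) - \<delta> < f i (y i)) \<Longrightarrow>
        \<mu> (\<lambda>m. \<Sum>i<n. of_nat (l i) * (x i m - y i m)) \<le> (2 - \<delta>) * (\<Sum>i<n. real (l i))"
      unfolding V_slices_gap_def by blast
    obtain g where g: "g \<in> topspace cube" "\<And>i v. i < n \<Longrightarrow> v \<in> Vset \<Longrightarrow> functional_of (\<mu>, g) i v = f i v"
      using functional_of_surj[OF B f(1)] by blast
    have "V_dual \<mu> n (functional_of (\<mu>, g))" using f(1) V_dual_cong[of n "functional_of (\<mu>, g)" f] g(2) by blast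
    moreover have "\<delta> \<le> functional_of (\<mu>, g) i (u i) / \<mu> (u i)" if "i < n" for i
      using f(2) g(2)[OF that] u[OF that] that by simp
    moreover have "\<mu> (\<lambda>m. \<Sum>i<n. of_nat (l i) * (x i m - y i m)) \<le> (2 - \<delta>) * (\<Sum>i<n. real (l i))"
      if "\<forall>i<n. x i \<in> Vset \<and> y i \<in> Vset"
        "\<forall>i<n. \<mu> (x i) < 1 \<and> \<mu> (y i) < 1 \<and>
               functional_of (\<mu>, g) i (u i) / \<mu> (u i) - \<delta> < functional_of (\<mu>, g) i (x i) \<and>
               functional_of (\<mu>, g) i (u i) / \<mu> (u i) - \<delta> < functional_of (\<mu>, g) i (y i)" for x y
      using that g(2) u by (intro f(3)) auto
    ultimately have "R (\<mu>, g)" unfolding R_def fst_conv by blast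
    then show "\<exists>g\<in>topspace cube. R (\<mu>, g)" using g by blast
  next
    assume "\<exists>g\<in>topspace cube. R (\<mu>, g)"
    then obtain g where "R (\<mu>, g)" by blast
    then show "V_slices_gap \<mu> u n l \<delta>" unfolding V_slices_gap_def R_def fst_conv
      by (intro exI[of _ "functional_of (\<mu>, g)"])
  qed
  ultimately show ?thesis using closedin_projection[of R] by (simp cong: conj_cong)
qed

section \<open>Countable unions over rational parameters\<close>

lemma countable_Vset: "countable Vset"
proof (rule countable_subset)
  show "Vset \<subseteq> range (\<lambda>xs n. if n < length xs then xs ! n else 0)"
  proof
    fix v assume "v \<in> Vset"
    then obtain K where K: "\<forall>n\<ge>K. v n = 0" by (auto simp: Vset_bound)
    have "v = (\<lambda>n. if n < length (map v [0..<K]) then map v [0..<K] ! n else 0)" using K by (auto simp: not_less)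
    then show "v \<in> range (\<lambda>xs n. if n < length xs then xs ! n else 0)" by blast
  qed
qed auto

lemma gdelta_in_Btop_I:
  assumes I: "countable I" and cl: "\<And>i. i \<in> I \<Longrightarrow> closedin Btop {\<mu> \<in> Bset. Q i \<mu>}"
    and P: "\<And>\<mu>. \<mu> \<in> Bset \<Longrightarrow> \<not> P \<mu> \<longleftrightarrow> (\<exists>i\<in>I. Q i \<mu>)"
  shows "gdelta_in Btop {\<mu> \<in> Bset. P \<mu>}"
proof -
  have "fsigma_in Btop (\<Union>i\<in>I. {\<mu> \<in> Bset. Q i \<mu>})"
    using I cl by (intro fsigma_in_Union) (auto intro: closed_imp_fsigma_in)
  moreover have "(\<Union>i\<in>I. {\<mu> \<in> Bset. Q i \<mu>}) = topspace Btop - {\<mu> \<in> Bset. P \<mu>}"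
    using P by (auto simp: topspace_Btop)
  ultimately show ?thesis by (auto simp: gdelta_in_fsigma_in topspace_Btop)
qed

lemma gdelta_Daugavet: "gdelta_in Btop {\<mu> \<in> Bset. Daugavet (Xcar \<mu>) (Xnorm \<mu>)}"
proof (rule gdelta_in_Btop_I[where I = "V\<^sub>1 \<times> V\<^sub>1 \<times> (UNIV :: nat set)"
    and Q = "\<lambda>(v, u, k) \<mu>. V_point_gap \<mu> v u 1 (1 / real (Suc k))"])
  show "countable (V\<^sub>1 \<times> V\<^sub>1 \<times> (UNIV :: nat set))"
    by (intro countable_SIGMA countable_Diff countable_Vset countableI_type)
next
  fix \<mu> assume "\<mu> \<in> Bset"
  then interpret norm_V \<mu> by (rule Bset_norm_V)
  show "\<not> Daugavet (Xcar \<mu>) (Xnorm \<mu>) \<longleftrightarrow> (\<exists>i\<in>V\<^sub>1 \<times> V\<^sub>1 \<times> (UNIV :: nat set).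
      (\<lambda>(v, u, k) \<mu>. V_point_gap \<mu> v u 1 (1 / real (Suc k))) i \<mu>)"
    unfolding not_Daugavet_V by (auto simp: Bex_def)
qed (auto intro!: closedin_V_point_gap)

lemma gdelta_DLD2P: "gdelta_in Btop {\<mu> \<in> Bset. DLD2P (Xcar \<mu>) (Xnorm \<mu>)}"
proof (rule gdelta_in_Btop_I[where I = "V\<^sub>1 \<times> (UNIV :: nat set)"
    and Q = "\<lambda>(v, k) \<mu>. V_point_gap \<mu> v v 1 (1 / real (Suc k))"])
  show "countable (V\<^sub>1 \<times> (UNIV :: nat set))"
    by (intro countable_SIGMA countable_Diff countable_Vset countableI_type)
next
  fix \<mu> assume "\<mu> \<in> Bset"
  then interpret norm_V \<mu> by (rule Bset_norm_V)
  show "\<not> DLD2P (Xcar \<mu>) (Xnorm \<mu>) \<longleftrightarrow> (\<exists>i\<in>V\<^sub>1 \<times> (UNIV :: nat set).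
      (\<lambda>(v, k) \<mu>. V_point_gap \<mu> v v 1 (1 / real (Suc k))) i \<mu>)"
    unfolding not_DLD2P_V by (auto simp: Bex_def)
qed (auto intro!: closedin_V_point_gap)

lemma gdelta_DD2P: "gdelta_in Btop {\<mu> \<in> Bset. DD2P (Xcar \<mu>) (Xnorm \<mu>)}"
proof (rule gdelta_in_Btop_I[where I = "V\<^sub>1 \<times> (UNIV :: nat set) \<times> (UNIV :: nat set)"
    and Q = "\<lambda>(v, n, k) \<mu>. V_point_gap \<mu> v v n (1 / real (Suc k))"])
  show "countable (V\<^sub>1 \<times> (UNIV :: nat set) \<times> (UNIV :: nat set))"
    by (intro countable_SIGMA countable_Diff countable_Vset countableI_type)
next
  fix \<mu> assume "\<mu> \<in> Bset"
  then interpret norm_V \<mu> by (rule Bset_norm_V)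
  show "\<not> DD2P (Xcar \<mu>) (Xnorm \<mu>) \<longleftrightarrow> (\<exists>i\<in>V\<^sub>1 \<times> (UNIV :: nat set) \<times> (UNIV :: nat set).
      (\<lambda>(v, n, k) \<mu>. V_point_gap \<mu> v v n (1 / real (Suc k))) i \<mu>)"
    unfolding not_DD2P_V by (auto simp: Bex_def)
qed (auto intro!: closedin_V_point_gap)

lemma gdelta_LD2P: "gdelta_in Btop {\<mu> \<in> Bset. LD2P (Xcar \<mu>) (Xnorm \<mu>)}"
proof (rule gdelta_in_Btop_I[where I = "V\<^sub>1 \<times> (UNIV :: nat set)"
    and Q = "\<lambda>(v, k) \<mu>. V_slices_gap \<mu> (\<lambda>_. v) 1 (\<lambda>_. 1) (1 / real (Suc k))"])
  show "countable (V\<^sub>1 \<times> (UNIV :: nat set))"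
    by (intro countable_SIGMA countable_Diff countable_Vset countableI_type)
next
  fix \<mu> assume "\<mu> \<in> Bset"
  then interpret norm_V \<mu> by (rule Bset_norm_V)
  show "\<not> LD2P (Xcar \<mu>) (Xnorm \<mu>) \<longleftrightarrow> (\<exists>i\<in>V\<^sub>1 \<times> (UNIV :: nat set).
      (\<lambda>(v, k) \<mu>. V_slices_gap \<mu> (\<lambda>_. v) 1 (\<lambda>_. 1) (1 / real (Suc k))) i \<mu>)"
    unfolding not_LD2P_V by (auto simp: Bex_def)
qed (auto intro!: closedin_V_slices_gap)

lemma gdelta_SD2P: "gdelta_in Btop {\<mu> \<in> Bset. SD2P (Xcar \<mu>) (Xnorm \<mu>)}"
proof (rule gdelta_in_Btop_I[where
    I = "{ps \<in> lists (V\<^sub>1 \<times> (UNIV :: nat set)). (\<Sum>i<length ps. snd (ps ! i)) > 0} \<times> (UNIV :: nat set)"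
    and Q = "\<lambda>(ps, k) \<mu>. V_slices_gap \<mu> (\<lambda>i. fst (ps ! i)) (length ps) (\<lambda>i. snd (ps ! i)) (1 / real (Suc k))"])
  show "countable ({ps \<in> lists (V\<^sub>1 \<times> (UNIV :: nat set)). (\<Sum>i<length ps. snd (ps ! i)) > 0} \<times> (UNIV :: nat set))"
    by (intro countable_SIGMA countable_Collect countable_lists countable_Diff countable_Vset countableI_type)
next
  fix i assume "i \<in> {ps \<in> lists (V\<^sub>1 \<times> (UNIV :: nat set)). (\<Sum>i<length ps. snd (ps ! i)) > 0} \<times> (UNIV :: nat set)"
  then obtain ps k where i: "i = (ps, k)" "ps \<in> lists (V\<^sub>1 \<times> (UNIV :: nat set))" by auto
  have "fst (ps ! j) \<in> Vset \<and> fst (ps ! j) \<noteq> (\<lambda>n. 0)" if "j < length ps" for j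
  proof -
    have "ps ! j \<in> V\<^sub>1 \<times> UNIV" using i(2) nth_mem[OF that] by blast
    then show ?thesis by auto
  qed
  then show "closedin Btop {\<mu> \<in> Bset. (\<lambda>(ps, k) \<mu>. V_slices_gap \<mu> (\<lambda>i. fst (ps ! i)) (length ps) (\<lambda>i. snd (ps ! i)) (1 / real (Suc k))) i \<mu>}"
    unfolding i(1) prod.case by (rule closedin_V_slices_gap)
next
  fix \<mu> assume "\<mu> \<in> Bset"
  then interpret norm_V \<mu> by (rule Bset_norm_V)
  show "\<not> SD2P (Xcar \<mu>) (Xnorm \<mu>) \<longleftrightarrow> (\<exists>i\<in>{ps \<in> lists (V\<^sub>1 \<times> (UNIV :: nat set)). (\<Sum>i<length ps. snd (ps ! i)) > 0} \<times> (UNIV :: nat set).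
      (\<lambda>(ps, k) \<mu>. V_slices_gap \<mu> (\<lambda>i. fst (ps ! i)) (length ps) (\<lambda>i. snd (ps ! i)) (1 / real (Suc k))) i \<mu>)"
    unfolding not_SD2P_V by (auto simp: Bex_def)
qed

section \<open>Norms on a dyadic tree\<close>

text \<open>Level \<open>k\<close> of a dyadic tree has the atoms \<open>j < 2^k\<close>; passing to level \<open>k + 1\<close> the atom \<open>j\<close>
  is split into \<open>j\<close> and \<open>j + 2^k\<close>. The coordinate \<open>x (j + 2^k)\<close> is the jump between the two halves,
  so vectors supported in \<open>{..<2^k}\<close> are exactly the step functions of level \<open>k\<close>.\<close>

primrec val :: "(nat \<Rightarrow> real) \<Rightarrow> nat \<Rightarrow> nat \<Rightarrow> real" where
  "val x 0 j = x 0"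
| "val x (Suc k) j = (if j < 2 ^ k then val x k j else x j + val x k (j - 2 ^ k))"

text \<open>The mass of the atom \<open>0\<close> at level \<open>k\<close> is prescribed to be \<open>m k\<close>; all other atoms are halved.\<close>

primrec weight :: "(nat \<Rightarrow> real) \<Rightarrow> nat \<Rightarrow> nat \<Rightarrow> real" where
  "weight m 0 j = m 0"
| "weight m (Suc k) j = (if j = 0 then m (Suc k) else if j = 2 ^ k then m k - m (Suc k)
     else if j < 2 ^ k then weight m k j / 2 else weight m k (j - 2 ^ k) / 2)"

definition level_norm :: "(nat \<Rightarrow> real) \<Rightarrow> nat \<Rightarrow> (nat \<Rightarrow> real) \<Rightarrow> real" where
  "level_norm m k x = (\<Sum>j<2 ^ k. weight m k j * \<bar>val x k j\<bar>)"

definition level_of :: "(nat \<Rightarrow> real) \<Rightarrow> nat" where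
  "level_of x = (LEAST k. \<forall>n\<ge>2 ^ k. x n = 0)"

text \<open>The least level is only a choice of representative: every level at which
  \<open>x\<close> is a step function gives the same value.\<close>

definition tree_norm :: "(nat \<Rightarrow> real) \<Rightarrow> (nat \<Rightarrow> real) \<Rightarrow> real" where
  "tree_norm m x = level_norm m (level_of x) x"

lemma weight_0 [simp]: "weight m k 0 = m k"
  by (cases k) auto

lemma sum_lessThan_double:
  fixes h :: "nat \<Rightarrow> 'a::comm_monoid_add"
  shows "(\<Sum>j<2 ^ Suc k. h j) = (\<Sum>j<2 ^ k. h j + h (j + 2 ^ k))"
proof -
  have "(\<Sum>j<2 ^ Suc k. h j) = (\<Sum>j<2 ^ k. h j) + (\<Sum>j=2 ^ k..<2 ^ k + 2 ^ k. h j)"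
    using sum.atLeastLessThan_concat[of 0 "2 ^ k" "2 ^ k + 2 ^ k" h]
    by (simp add: lessThan_atLeast0 mult_2)
  also have "(\<Sum>j=2 ^ k..<2 ^ k + 2 ^ k. h j) = (\<Sum>j<2 ^ k. h (j + 2 ^ k))"
    using sum.shift_bounds_nat_ivl[of h 0 "2 ^ k" "2 ^ k"] by (simp add: lessThan_atLeast0)
  finally show ?thesis by (simp add: sum.distrib)
qed

lemma weight_split: "j < 2 ^ k \<Longrightarrow> weight m (Suc k) j + weight m (Suc k) (j + 2 ^ k) = weight m k j"
  by auto

text \<open>Both halves of a split atom keep the old value, since the jumps at level
  \<open>k\<close> vanish, and their weights add up to the old weight.\<close>

lemma level_norm_Suc:
  assumes "\<forall>n\<ge>2 ^ k. x n = 0" shows "level_norm m (Suc k) x = level_norm m k x"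
proof -
  have "weight m (Suc k) j * \<bar>val x (Suc k) j\<bar> + weight m (Suc k) (j + 2 ^ k) * \<bar>val x (Suc k) (j + 2 ^ k)\<bar>
      = weight m k j * \<bar>val x k j\<bar>" if "j < 2 ^ k" for j
  proof -
    have "val x (Suc k) j = val x k j" "val x (Suc k) (j + 2 ^ k) = val x k j" using assms that by auto
    then show ?thesis using weight_split[OF that, of m] by (simp only: distrib_right[symmetric])
  qed
  then show ?thesis unfolding level_norm_def sum_lessThan_double by (intro sum.cong) auto
qed

lemma level_mono:
  fixes x :: "nat \<Rightarrow> real"
  assumes "\<forall>n\<ge>2 ^ k. x n = 0" "k \<le> l" shows "\<forall>n\<ge>2 ^ l. x n = 0"
proof (intro allI impI)
  fix n :: nat assume "2 ^ l \<le> n"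
  moreover have "(2::nat) ^ k \<le> 2 ^ l" using assms(2) by (rule power_increasing) simp
  ultimately show "x n = 0" using assms(1) by (meson le_trans)
qed

lemma level_norm_mono:
  assumes "\<forall>n\<ge>2 ^ k. x n = 0" "k \<le> l" shows "level_norm m l x = level_norm m k x"
  using assms(2)
proof (induction l rule: dec_induct)
  case (step l)
  have "\<forall>n\<ge>2 ^ l. x n = 0" using assms(1) step.hyps(1) by (rule level_mono)
  then show ?case using level_norm_Suc step by simp
qed simp

lemma tree_norm_eq:
  assumes "\<forall>n\<ge>2 ^ k. x n = 0" shows "tree_norm m x = level_norm m k x"
proof -
  have "\<forall>n\<ge>2 ^ level_of x. x n = 0" unfolding level_of_def by (rule LeastI[of _ k]) (rule assms)
  moreover have "level_of x \<le> k" unfolding level_of_def by (rule Least_le) (rule assms)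
  ultimately show ?thesis unfolding tree_norm_def using level_norm_mono[of "level_of x" x k m] by simp
qed

lemma c00_level:
  assumes "x \<in> c00" obtains k where "\<forall>n\<ge>2 ^ k. x n = 0"
proof -
  obtain K where K: "\<forall>n\<ge>K. x n = 0" using assms by (auto simp: c00_bound)
  have "\<forall>n\<ge>2 ^ K. x n = 0" using K less_exp[of K] le_trans[of K "2 ^ K"] less_imp_le by blast
  then show ?thesis by (rule that)
qed

lemma c00_common_level:
  assumes "x \<in> c00" "y \<in> c00"
  obtains k where "\<forall>n\<ge>2 ^ k. x n = 0" "\<forall>n\<ge>2 ^ k. y n = 0"
proof -
  obtain k1 where k1: "\<forall>n\<ge>2 ^ k1. x n = 0" by (rule c00_level[OF assms(1)])
  obtain k2 where k2: "\<forall>n\<ge>2 ^ k2. y n = 0" by (rule c00_level[OF assms(2)])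
  show ?thesis using that[of "max k1 k2"] level_mono[OF k1, of "max k1 k2"] level_mono[OF k2, of "max k1 k2"] by simp
qed

lemma c00_levelI: "\<forall>n\<ge>2 ^ k. x n = 0 \<Longrightarrow> x \<in> c00"
  unfolding c00_bound by blast

section \<open>Coordinates and values of step functions\<close>

lemma val_add: "val (x + y) k j = val x k j + val y k j"
  by (induction k arbitrary: j) auto

lemma val_scale: "val (c *\<^sub>R x) k j = c * val x k j"
  by (induction k arbitrary: j) (auto simp: scaleR_fun_def distrib_left)

lemma val_diff: "val (x - y) k j = val x k j - val y k j"
  by (induction k arbitrary: j) auto

lemma val_0 [simp]: "val x k 0 = x 0"
  by (induction k) auto

lemma val_cong: "(\<And>n. n < 2 ^ k \<Longrightarrow> x n = y n) \<Longrightarrow> j < 2 ^ k \<Longrightarrow> val x k j = val y k j"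
proof (induction k arbitrary: j)
  case (Suc k)
  have "val x k i = val y k i" if "i < 2 ^ k" for i using Suc.IH[OF _ that] Suc.prems(1) by auto
  then show ?case using Suc.prems by auto
qed auto

lemma val_injective:
  assumes "\<And>j. j < 2 ^ k \<Longrightarrow> val x k j = val y k j" "n < 2 ^ k" shows "x n = y n"
  using assms
proof (induction k arbitrary: n)
  case 0
  then show ?case by simp
next
  case (Suc k)
  have v: "val x k j = val y k j" if "j < 2 ^ k" for j
  proof -
    have "j < 2 ^ Suc k" using that by simp
    from Suc.prems(1)[OF this] show ?thesis using that by simp
  qed
  show ?case
  proof (cases "n < 2 ^ k")
    case True
    then show ?thesis using Suc.IH v by blast
  next
    case False
    then have "val x k (n - 2 ^ k) = val y k (n - 2 ^ k)" using Suc.prems(2) by (intro v) auto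
    then show ?thesis using Suc.prems(1)[OF Suc.prems(2)] False by simp
  qed
qed

lemma val_surjective: "\<exists>x. (\<forall>n\<ge>2 ^ k. x n = 0) \<and> (\<forall>j<2 ^ k. val x k j = a j)"
proof (induction k)
  case 0
  show ?case by (rule exI[of _ "\<lambda>n. if n = 0 then a 0 else 0"]) auto
next
  case (Suc k)
  then obtain x where x: "\<forall>n\<ge>2 ^ k. x n = 0" "\<forall>j<2 ^ k. val x k j = a j" by blast
  \<comment> \<open>A new coordinate \<open>n\<close> must be the jump from the left half
    \<open>n - 2 ^ k\<close> to the right half \<open>n\<close>.\<close>
  let ?y = "\<lambda>n. if n < 2 ^ k then x n else if n < 2 ^ Suc k then a n - a (n - 2 ^ k) else 0"
  have v: "val ?y k j = a j" if "j < 2 ^ k" for j using val_cong[of k ?y x j] x(2) that by simp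
  show ?case
  proof (intro exI[of _ ?y] conjI allI impI)
    fix j :: nat assume j: "j < 2 ^ Suc k"
    show "val ?y (Suc k) j = a j"
    proof (cases "j < 2 ^ k")
      case False
      then have "val ?y k (j - 2 ^ k) = a (j - 2 ^ k)" using j by (intro v) auto
      then show ?thesis using False j by simp
    qed (use v in simp)
  qed auto
qed

text \<open>The value on an atom is a sum of distinct coordinates, the jumps met along its
  branch.\<close>

lemma val_bound: "j < 2 ^ k \<Longrightarrow> \<bar>val x k j\<bar> \<le> (\<Sum>n<2 ^ k. \<bar>x n\<bar>)"
proof (induction k arbitrary: j)
  case (Suc k)
  have s: "(\<Sum>n<2 ^ Suc k. \<bar>x n\<bar>) = (\<Sum>n<2 ^ k. \<bar>x n\<bar>) + (\<Sum>n<2 ^ k. \<bar>x (n + 2 ^ k)\<bar>)"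
    by (simp only: sum_lessThan_double sum.distrib)
  show ?case
  proof (cases "j < 2 ^ k")
    case True
    have "0 \<le> (\<Sum>n<2 ^ k. \<bar>x (n + 2 ^ k)\<bar>)" by (simp add: sum_nonneg)
    then have "\<bar>val x k j\<bar> \<le> (\<Sum>n<2 ^ k. \<bar>x n\<bar>) + (\<Sum>n<2 ^ k. \<bar>x (n + 2 ^ k)\<bar>)"
      using Suc.IH[OF True] by linarith
    then show ?thesis unfolding s using True by simp
  next
    case False
    define i where "i = j - 2 ^ k"
    have i: "i < 2 ^ k" "j = i + 2 ^ k" using False Suc.prems by (auto simp: i_def)
    have "\<bar>x (i + 2 ^ k)\<bar> \<le> (\<Sum>n<2 ^ k. \<bar>x (n + 2 ^ k)\<bar>)" using i by (intro member_le_sum) auto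
    then have "\<bar>x (i + 2 ^ k) + val x k i\<bar> \<le> (\<Sum>n<2 ^ k. \<bar>x n\<bar>) + (\<Sum>n<2 ^ k. \<bar>x (n + 2 ^ k)\<bar>)"
      using Suc.IH[OF i(1)] by linarith
    then show ?thesis unfolding s using i by simp
  qed
qed auto

text \<open>Strict decrease gives the positive mass \<open>m k - m (Suc k)\<close> to the atom split
  off from the branch; with it all atoms have positive mass and the tree norm is definite.\<close>

locale weights =
  fixes m :: "nat \<Rightarrow> real"
  assumes m_pos: "m k > 0" and m_decr: "m (Suc k) < m k"
begin

lemma weight_pos: "j < 2 ^ k \<Longrightarrow> weight m k j > 0"
proof (induction k arbitrary: j)
  case (Suc k)
  show ?case
  proof (cases "j < 2 ^ k")
    case False
    then have "weight m k (j - 2 ^ k) > 0" using Suc.prems by (intro Suc.IH) auto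
    then show ?thesis using False m_decr m_pos by auto
  qed (use Suc.IH m_pos in auto)
qed (auto simp: m_pos)

lemma seminormed_tree_norm: "seminormed_space c00 (tree_norm m)"
proof
  show "subspace c00" by (rule subspace_c00)
  show "tree_norm m (x + y) \<le> tree_norm m x + tree_norm m y" if xy: "x \<in> c00" "y \<in> c00" for x y
  proof -
    obtain k where k: "\<forall>n\<ge>2 ^ k. x n = 0" "\<forall>n\<ge>2 ^ k. y n = 0" by (rule c00_common_level[OF xy])
    then have "\<forall>n\<ge>2 ^ k. (x + y) n = 0" by simp
    note eqs = this[THEN tree_norm_eq] k[THEN tree_norm_eq]
    show ?thesis unfolding eqs unfolding level_norm_def sum.distrib[symmetric] distrib_left[symmetric]
      using weight_pos by (intro sum_mono mult_left_mono) (auto simp: val_add less_imp_le)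
  qed
  show "tree_norm m (c *\<^sub>R x) = \<bar>c\<bar> * tree_norm m x" if x: "x \<in> c00" for c x
  proof -
    obtain k where k: "\<forall>n\<ge>2 ^ k. x n = 0" by (rule c00_level[OF x])
    then have "\<forall>n\<ge>2 ^ k. (c *\<^sub>R x) n = 0" by (simp add: scaleR_fun_def)
    note eqs = this[THEN tree_norm_eq] k[THEN tree_norm_eq]
    show ?thesis unfolding eqs level_norm_def sum_distrib_left
      by (intro sum.cong) (auto simp: val_scale abs_mult)
  qed
qed

sublocale T: seminormed_space c00 "tree_norm m"
  by (rule seminormed_tree_norm)

lemma tree_norm_definite:
  assumes x: "x \<in> c00" and 0: "tree_norm m x = 0" shows "x = 0"
proof
  fix n
  obtain k where k: "\<forall>n\<ge>2 ^ k. x n = 0" by (rule c00_level[OF x])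
  have "(\<Sum>j<2 ^ k. weight m k j * \<bar>val x k j\<bar>) = 0" using 0 tree_norm_eq[OF k] by (simp add: level_norm_def)
  then have z: "weight m k j * \<bar>val x k j\<bar> = 0" if "j < 2 ^ k" for j
    using that weight_pos by (subst (asm) sum_nonneg_eq_0_iff) (auto simp: less_imp_le)
  have "val x k j = val 0 k j" if "j < 2 ^ k" for j
    using z[OF that] weight_pos[OF that] val_scale[of 0 0 k j] by simp
  then have "n < 2 ^ k \<Longrightarrow> x n = 0 n" by (rule val_injective)
  then show "x n = 0 n" using k by (cases "n < 2 ^ k") auto
qed

definition tree_seminorm :: "(nat \<Rightarrow> rat) \<Rightarrow> real" where
  "tree_seminorm = restrict (\<lambda>v. tree_norm m (ratvec v)) Vset"

lemma tree_seminorm_Bset: "tree_seminorm \<in> Bset"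
  unfolding tree_seminorm_def by (rule Bset_I[OF seminormed_tree_norm tree_norm_definite])

lemma mubar_tree: "x \<in> c00 \<Longrightarrow> mubar tree_seminorm x = tree_norm m x"
  by (rule mubar_eqI(2)[OF seminormed_tree_norm]) (simp add: tree_seminorm_def)

sublocale N: norm_V tree_seminorm
  by (rule Bset_norm_V[OF tree_seminorm_Bset])

text \<open>Separates the branch from the rest: the value on atom 0 is \<open>x 0\<close> at every
  level.\<close>

lemma m_le_tree_norm:
  assumes x: "x \<in> c00" and k: "\<forall>n\<ge>2 ^ k. x n = 0"
  shows "m k * \<bar>x 0\<bar> + (\<Sum>j\<in>{..<2 ^ k} - {0}. weight m k j * \<bar>val x k j\<bar>) = tree_norm m x"
  unfolding tree_norm_eq[OF k] level_norm_def by (subst (2) sum.remove[of _ 0]) auto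

text \<open>The branch value \<open>x 0\<close> times \<open>c\<close> is a functional dominated by
  the norm. If it exceeds 3/4 on a vector of norm below 1, then the branch part of the norm lies
  between 3/4 and 1 and less than 1/4 is left elsewhere. Two such vectors differ by at most three
  quarters, well below 2.\<close>

lemma not_LD2P_tree:
  assumes c: "c > 0" "m \<longlonglongrightarrow> c"
  shows "\<not> LD2P (Xcar tree_seminorm) (Xnorm tree_seminorm)"
proof -
  have mc: "c < m k" for k
  proof -
    have "decseq m" using m_decr by (intro decseq_SucI) (simp add: less_imp_le)
    then have "c \<le> m (Suc k)" using c(2) by (rule decseq_ge)
    then show ?thesis using m_decr[of k] by simp
  qed
  \<comment> \<open>Chosen to give \<open>c / m K > 7 / 8\<close>; subtracting the depth 1/8 leaves
    the level 3/4 of \<open>small\<close>.\<close>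
  obtain K where K: "m K < 8 / 7 * c"
    using order_tendstoD(2)[OF c(2), of "8 / 7 * c"] c(1) by (auto simp: eventually_sequentially)
  \<comment> \<open>The indicator of the leftmost atom of level \<open>K\<close>: value 1 at the
    root and a jump of -1 to each right sibling \<open>2 ^ i\<close> of the branch.\<close>
  define v :: "nat \<Rightarrow> rat" where "v n = (if n = 0 then 1 else if \<exists>i<K. n = 2 ^ i then -1 else 0)" for n
  have v0: "v n = 0" if "n \<ge> 2 ^ K" for n
  proof -
    have "n \<noteq> 2 ^ i" if "i < K" for i
      using \<open>n \<ge> 2 ^ K\<close> power_strict_increasing[OF that, of "2::nat"] by auto
    moreover have "n \<noteq> 0" using that by (metis le_zero_eq power_eq_0_iff zero_neq_numeral)
    ultimately show ?thesis by (auto simp: v_def)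
  qed
  have vV: "v \<in> Vset" unfolding Vset_bound using v0 by blast
  have valv: "val (ratvec v) k j = (if j = 0 then 1 else 0)" if "k \<le> K" "j < 2 ^ k" for k j
    using that
  proof (induction k arbitrary: j)
    case 0
    then show ?case by (simp add: ratvec_def v_def)
  next
    case (Suc k)
    show ?case
    proof (cases "j < 2 ^ k")
      case True
      then show ?thesis using Suc by simp
    next
      case False
      then have IH: "val (ratvec v) k (j - 2 ^ k) = (if j - 2 ^ k = 0 then 1 else 0)"
        using Suc.prems by (intro Suc.IH) auto
      have j0: "j \<noteq> 0" using False by (metis gr0I zero_less_numeral zero_less_power)
      show ?thesis
      proof (cases "j = 2 ^ k")
        case True
        then have "v j = -1" using Suc.prems(1) j0 by (auto simp: v_def)
        then show ?thesis using True IH by (simp add: ratvec_def)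
      next
        case ne: False
        have "j \<noteq> 2 ^ i" for i
        proof
          assume j: "j = 2 ^ i"
          have "k < i" using j False ne by (metis linorder_neqE_nat not_less_iff_gr_or_eq one_less_numeral_iff power_strict_increasing_iff semiring_norm(76))
          moreover have "i < Suc k" using j Suc.prems(2) by (metis one_less_numeral_iff power_strict_increasing_iff semiring_norm(76))
          ultimately show False by simp
        qed
        then have "v j = 0" using j0 by (simp add: v_def)
        then show ?thesis using ne False IH by (simp add: ratvec_def)
      qed
    qed
  qed
  have vn: "tree_seminorm v = m K"
  proof -
    have z: "\<forall>n\<ge>2 ^ K. ratvec v n = 0" using v0 by (simp add: ratvec_def)
    have "tree_norm m (ratvec v) = m K * \<bar>ratvec v 0\<bar> + (\<Sum>j\<in>{..<2 ^ K} - {0}. weight m K j * \<bar>val (ratvec v) K j\<bar>)"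
      using m_le_tree_norm[OF ratvec_mem[OF vV] z] by simp
    also have "(\<Sum>j\<in>{..<2 ^ K} - {0}. weight m K j * \<bar>val (ratvec v) K j\<bar>) = 0"
      using valv[of K] by (intro sum.neutral) auto
    finally show ?thesis using vV by (simp add: tree_seminorm_def ratvec_def v_def)
  qed
  have bnd: "c * \<bar>x 0\<bar> \<le> tree_norm m x" if x: "x \<in> c00" for x
  proof -
    obtain k where k: "\<forall>n\<ge>2 ^ k. x n = 0" by (rule c00_level[OF x])
    have "0 \<le> (\<Sum>j\<in>{..<2 ^ k} - {0}. weight m k j * \<bar>val x k j\<bar>)"
      using weight_pos by (intro sum_nonneg) (simp add: less_imp_le)
    moreover have "c * \<bar>x 0\<bar> \<le> m k * \<bar>x 0\<bar>" using mc[of k] by (intro mult_right_mono) auto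
    ultimately show ?thesis using m_le_tree_norm[OF x k] by linarith
  qed
  have small: "tree_norm m (x - y) \<le> 1"
    if xy: "x \<in> c00" "y \<in> c00" and n: "tree_norm m x < 1" "tree_norm m y < 1" and g: "3 / 4 < c * x 0" "3 / 4 < c * y 0" for x y
  proof -
    obtain k where k: "\<forall>n\<ge>2 ^ k. x n = 0" "\<forall>n\<ge>2 ^ k. y n = 0" by (rule c00_common_level[OF xy])
    then have kd: "\<forall>n\<ge>2 ^ k. (x - y) n = 0" by simp
    let ?R = "\<lambda>x. \<Sum>j\<in>{..<2 ^ k} - {0}. weight m k j * \<bar>val x k j\<bar>"
    have R0: "?R x \<ge> 0" for x using weight_pos by (intro sum_nonneg) (simp add: less_imp_le)
    have pos: "x 0 > 0" "y 0 > 0" 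
    proof -
      have "0 < c * x 0" "0 < c * y 0" using g by linarith+
      then show "x 0 > 0" "y 0 > 0" using c(1) by (auto simp: zero_less_mult_iff)
    qed
    have "?R (x - y) \<le> ?R x + ?R y"
      unfolding sum.distrib[symmetric] distrib_left[symmetric]
      using weight_pos by (intro sum_mono mult_left_mono) (auto simp: val_diff less_imp_le)
    moreover have "m k * x 0 + ?R x < 1" "m k * y 0 + ?R y < 1"
      using m_le_tree_norm[OF xy(1) k(1)] m_le_tree_norm[OF xy(2) k(2)] n pos by auto
    moreover have "c * x 0 \<le> m k * x 0" "c * y 0 \<le> m k * y 0"
      using pos mc[of k] by (auto intro!: mult_right_mono)
    moreover have "\<bar>m k * x 0 - m k * y 0\<bar> = m k * \<bar>(x - y) 0\<bar>"
      using m_pos[of k] by (simp add: abs_mult flip: right_diff_distrib)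
    moreover have "m k * \<bar>(x - y) 0\<bar> + ?R (x - y) = tree_norm m (x - y)"
      using xy by (intro m_le_tree_norm kd T.diff_mem)
    ultimately show ?thesis using R0[of x] R0[of y] g by argo
  qed
  define f where "f = (\<lambda>(i::nat) w. c * real_of_rat (w (0::nat)))"
  have "V_slices_gap tree_seminorm (\<lambda>_. v) 1 (\<lambda>_. 1) (1 / real (Suc 7))"
    unfolding V_slices_gap_def
  proof (intro exI[of _ f] conjI allI impI)
    have "\<bar>c * real_of_rat (w 0)\<bar> \<le> tree_seminorm w" if "w \<in> Vset" for w
      using bnd[OF ratvec_mem[OF that]] c(1) that by (simp add: tree_seminorm_def ratvec_def abs_mult)
    then show "V_dual tree_seminorm 1 f"
      unfolding V_dual_def f_def by (auto simp: of_rat_add of_rat_mult distrib_left)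
    have fv: "f i v / tree_seminorm v = c / m K" for i unfolding vn by (simp add: f_def v_def)
    have cK: "c / m K > 7 / 8" using K m_pos[of K] by (simp add: pos_less_divide_eq)
    show "1 / real (Suc 7) \<le> f i v / tree_seminorm v" for i unfolding fv using cK by simp
    fix x y :: "nat \<Rightarrow> nat \<Rightarrow> rat"
    assume V: "\<forall>i<1. x i \<in> Vset \<and> y i \<in> Vset"
      and h: "\<forall>i<1. tree_seminorm (x i) < 1 \<and> tree_seminorm (y i) < 1 \<and>
        f i v / tree_seminorm v - 1 / real (Suc 7) < f i (x i) \<and> f i v / tree_seminorm v - 1 / real (Suc 7) < f i (y i)"
    have V0: "x 0 \<in> Vset" "y 0 \<in> Vset" using V by auto
    have "tree_norm m (ratvec (x 0) - ratvec (y 0)) \<le> 1"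
    proof (rule small)
      show "tree_norm m (ratvec (x 0)) < 1" "tree_norm m (ratvec (y 0)) < 1"
        using h V0 by (auto simp: tree_seminorm_def)
      have "c / m K - 1 / 8 < c * ratvec (x 0) 0" "c / m K - 1 / 8 < c * ratvec (y 0) 0"
        using h[unfolded fv] by (auto simp: f_def ratvec_def)
      then show "3 / 4 < c * ratvec (x 0) 0" "3 / 4 < c * ratvec (y 0) 0" using cK by linarith+
    qed (use V0 in auto)
    moreover have "ratvec (\<lambda>n. x 0 n - y 0 n) = ratvec (x 0) - ratvec (y 0)" by (auto simp: ratvec_def of_rat_diff)
    ultimately have "tree_seminorm (\<lambda>n. x 0 n - y 0 n) \<le> 1" using V0 by (simp add: tree_seminorm_def)
    then show "tree_seminorm (\<lambda>n. \<Sum>i<1. of_nat 1 * (x i n - y i n)) \<le> (2 - 1 / real (Suc 7)) * (\<Sum>i<(1::nat). real 1)"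
      by simp
  qed
  moreover have "v \<noteq> (\<lambda>n. 0)" by (auto simp: v_def fun_eq_iff)
  ultimately show ?thesis unfolding N.not_LD2P_V using vV by blast
qed

end

text \<open>One representative is kept for each cell of size \<open>\<delta>\<close> of the cube \<open>[-C, C]^\<Phi>\<close>.\<close>

lemma grouping:
  fixes C \<delta> :: real and \<Phi> :: "'f set"
  assumes \<Phi>: "finite \<Phi>" and d: "\<delta> > 0"
  obtains M :: nat where "\<And>(J :: nat set) \<phi>. finite J \<Longrightarrow> (\<forall>f\<in>\<Phi>. \<forall>t\<in>J. \<bar>\<phi> f t\<bar> \<le> C) \<Longrightarrow>
    \<exists>r. r ` J \<subseteq> J \<and> card (r ` J) \<le> M \<and> (\<forall>t\<in>J. \<forall>f\<in>\<Phi>. \<bar>\<phi> f (r t) - \<phi> f t\<bar> \<le> \<delta>)"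
proof
  define B where "B = \<lceil>C / \<delta>\<rceil>"
  define cells where "cells = PiE \<Phi> (\<lambda>_. {- B..B})"
  have fin: "finite cells" unfolding cells_def using \<Phi> by (intro finite_PiE) auto
  fix J :: "nat set" and \<phi>
  assume J: "finite J" and b: "\<forall>f\<in>\<Phi>. \<forall>t\<in>J. \<bar>\<phi> f t\<bar> \<le> C"
  define key where "key t = restrict (\<lambda>f. \<lfloor>\<phi> f t / \<delta>\<rfloor>) \<Phi>" for t
  define rep where "rep \<kappa> = (SOME t. t \<in> J \<and> key t = \<kappa>)" for \<kappa>
  have rep: "rep (key t) \<in> J \<and> key (rep (key t)) = key t" if "t \<in> J" for t
    unfolding rep_def by (rule someI[of _ t]) (use that in simp)
  have kc: "key ` J \<subseteq> cells"
  proof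
    fix \<kappa> assume "\<kappa> \<in> key ` J"
    then obtain t where t: "t \<in> J" "\<kappa> = key t" by blast
    have "\<lfloor>\<phi> f t / \<delta>\<rfloor> \<in> {- B..B}" if "f \<in> \<Phi>" for f
    proof -
      have "\<bar>\<phi> f t\<bar> \<le> C" using b t that by blast
      then have "\<phi> f t / \<delta> \<le> C / \<delta>" "(- C) / \<delta> \<le> \<phi> f t / \<delta>"
        using d by (intro divide_right_mono; linarith)+
      then have "\<phi> f t / \<delta> \<le> C / \<delta>" "- (C / \<delta>) \<le> \<phi> f t / \<delta>" by simp_all
      then have "\<lfloor>\<phi> f t / \<delta>\<rfloor> \<le> B" "- B \<le> \<lfloor>\<phi> f t / \<delta>\<rfloor>" unfolding B_def by linarith+
      then show ?thesis by simp
    qed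
    then show "\<kappa> \<in> cells" unfolding cells_def t(2) key_def by (intro restrict_PiE_iff[THEN iffD2]) auto
  qed
  let ?r = "\<lambda>t. rep (key t)"
  have "card (?r ` J) = card (rep ` key ` J)" by (simp add: image_image)
  also have "\<dots> \<le> card (key ` J)" using J by (intro card_image_le) auto
  also have "\<dots> \<le> card cells" using fin kc by (rule card_mono)
  finally have "card (?r ` J) \<le> card cells" .
  moreover have "\<bar>\<phi> f (?r t) - \<phi> f t\<bar> \<le> \<delta>" if "t \<in> J" "f \<in> \<Phi>" for t f
  proof -
    have "key (?r t) f = key t f" using rep[OF that(1)] by simp
    then have "\<lfloor>\<phi> f (?r t) / \<delta>\<rfloor> = \<lfloor>\<phi> f t / \<delta>\<rfloor>" using that(2) by (simp add: key_def)
    then have "\<bar>\<phi> f (?r t) / \<delta> - \<phi> f t / \<delta>\<bar> \<le> 1" by linarith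
    then have "\<bar>(\<phi> f (?r t) - \<phi> f t) / \<delta>\<bar> \<le> 1" by (simp add: diff_divide_distrib)
    then show ?thesis using d by (simp add: abs_divide)
  qed
  ultimately show "\<exists>r. r ` J \<subseteq> J \<and> card (r ` J) \<le> card cells \<and> (\<forall>t\<in>J. \<forall>f\<in>\<Phi>. \<bar>\<phi> f (r t) - \<phi> f t\<bar> \<le> \<delta>)"
    using rep by (intro exI[of _ ?r]) blast
qed

section \<open>Diffuseness when the masses tend to zero\<close>

context weights
begin

text \<open>\<open>b k\<close> dominates every atom of level \<open>k\<close> other than 0: such an
  atom is either half of an older one or has just been split off from the branch with mass
  \<open>m (k - 1) - m k\<close>. The atom 0 itself has mass \<open>m k\<close>.\<close>

lemma weight_vanishes:
  assumes m0: "m \<longlonglongrightarrow> 0" and e: "\<eta> > 0"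
  obtains K where "\<And>k j. k \<ge> K \<Longrightarrow> j < 2 ^ k \<Longrightarrow> weight m k j < \<eta>"
proof -
  define b where "b = rec_nat 0 (\<lambda>k b. b / 2 + (m k - m (Suc k)))"
  have b0: "b 0 = 0" and bS: "b (Suc k) = b k / 2 + (m k - m (Suc k))" for k by (simp_all add: b_def)
  have bn: "b k \<ge> 0" for k
  proof (induction k)
    case (Suc k)
    then show ?case using m_decr[of k] by (simp add: bS)
  qed (simp add: b0)
  have wb: "weight m k j \<le> b k" if "j < 2 ^ k" "j \<noteq> 0" for k j
    using that
  proof (induction k arbitrary: j)
    case (Suc k)
    have *: "weight m k i / 2 \<le> b (Suc k)" if "i < 2 ^ k" "i \<noteq> 0" for i
      using Suc.IH[OF that] m_decr[of k] by (simp add: bS)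
    consider "j = 2 ^ k" | "j < 2 ^ k" | "j > 2 ^ k" by linarith
    then show ?case
    proof cases
      case 1
      then show ?thesis using bn[of k] by (simp add: bS)
    next
      case 2
      then show ?thesis using * Suc.prems by simp
    next
      case 3
      then show ?thesis using *[of "j - 2 ^ k"] Suc.prems by simp
    qed
  qed simp
  have blim: "b \<longlonglongrightarrow> 0"
  proof -
    \<comment> \<open>Adding \<open>2 * m k\<close> makes the sequence monotone, so \<open>b\<close>
      converges; passing to the limit in its recursion gives \<open>L = L / 2\<close>.\<close>
    have "decseq (\<lambda>k. b k + 2 * m k)"
    proof (rule decseq_SucI)
      fix k show "b (Suc k) + 2 * m (Suc k) \<le> b k + 2 * m k" using bn[of k] m_decr[of k] by (simp add: bS)
    qed
    then obtain L where "(\<lambda>k. b k + 2 * m k) \<longlonglongrightarrow> L"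
      using decseq_convergent[of "\<lambda>k. b k + 2 * m k" 0] bn m_pos by (metis add_nonneg_nonneg less_imp_le mult_nonneg_nonneg zero_le_numeral)
    then have "(\<lambda>k. b k + 2 * m k - 2 * m k) \<longlonglongrightarrow> L - 2 * 0" by (intro tendsto_diff tendsto_mult_left m0)
    then have bL: "b \<longlonglongrightarrow> L" by simp
    have "(\<lambda>k. b k / 2 + (m k - m (Suc k))) \<longlonglongrightarrow> L / 2 + (0 - 0)"
      by (intro tendsto_add tendsto_diff tendsto_divide tendsto_const bL m0 LIMSEQ_Suc[OF m0]) simp
    then have "(\<lambda>k. b (Suc k)) \<longlonglongrightarrow> L / 2" by (simp add: bS)
    moreover have "(\<lambda>k. b (Suc k)) \<longlonglongrightarrow> L" using bL by (rule LIMSEQ_Suc)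
    ultimately have "L / 2 = L" by (rule LIMSEQ_unique)
    then show ?thesis using bL by simp
  qed
  have "eventually (\<lambda>k. b k < \<eta> \<and> m k < \<eta>) sequentially"
    using order_tendstoD(2)[OF blim e] order_tendstoD(2)[OF m0 e] by (rule eventually_conj)
  then obtain K where K: "\<And>k. k \<ge> K \<Longrightarrow> b k < \<eta> \<and> m k < \<eta>" by (auto simp: eventually_sequentially)
  have "weight m k j < \<eta>" if "k \<ge> K" "j < 2 ^ k" for k j
    using K[OF that(1)] wb[OF that(2)] by (cases "j = 0") auto
  then show ?thesis using that by blast
qed

text \<open>The order of the choices is the point. The number \<open>M\<close> of representatives
  depends on the functionals and on \<open>\<delta>\<close> but not on the level, so the level can
  be taken afterwards, so fine that any \<open>M\<close> atoms carry a negligible part of the norm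
  of \<open>x\<close>.\<close>

lemma diffuse_c00:
  assumes m0: "m \<longlonglongrightarrow> 0" and x: "x \<in> c00" and z: "z \<in> c00"
    and \<Phi>: "finite \<Phi>" "\<And>f. f \<in> \<Phi> \<Longrightarrow> f \<in> dual_space c00 (tree_norm m)" and d: "\<delta> > 0" and e: "\<epsilon> > 0"
  obtains y where "y \<in> c00" "tree_norm m y = tree_norm m z" "\<And>f. f \<in> \<Phi> \<Longrightarrow> \<bar>f y - f z\<bar> \<le> \<delta> * tree_norm m z"
    "tree_norm m x + tree_norm m z - \<epsilon> < tree_norm m (x + y)"
proof -
  define C where "C = (\<Sum>f\<in>\<Phi>. \<bar>dual_norm c00 (tree_norm m) f\<bar>)"
  have Cf: "\<bar>f y\<bar> \<le> C * tree_norm m y" if f: "f \<in> \<Phi>" and y: "y \<in> c00" for f y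
  proof -
    have "\<bar>f y\<bar> \<le> dual_norm c00 (tree_norm m) f * tree_norm m y" by (rule T.dual_le_norm[OF \<Phi>(2)[OF f] y])
    also have "\<dots> \<le> C * tree_norm m y"
    proof (rule mult_right_mono)
      show "dual_norm c00 (tree_norm m) f \<le> C"
        using member_le_sum[OF f, of "\<lambda>f. \<bar>dual_norm c00 (tree_norm m) f\<bar>"] \<Phi>(1) unfolding C_def by force
    qed (rule T.N_nonneg[OF y])
    finally show ?thesis .
  qed
  obtain M :: nat where M: "\<And>(J :: nat set) \<phi>. finite J \<Longrightarrow> (\<forall>f\<in>\<Phi>. \<forall>t\<in>J. \<bar>\<phi> f t\<bar> \<le> C) \<Longrightarrow>
    \<exists>r. r ` J \<subseteq> J \<and> card (r ` J) \<le> M \<and> (\<forall>t\<in>J. \<forall>f\<in>\<Phi>. \<bar>\<phi> f (r t) - \<phi> f t\<bar> \<le> \<delta>)"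
    using grouping[OF \<Phi>(1) d, of C] by blast
  obtain k0 where k0: "\<forall>n\<ge>2 ^ k0. x n = 0" "\<forall>n\<ge>2 ^ k0. z n = 0" by (rule c00_common_level[OF x z])
  define B where "B = (\<Sum>n<2 ^ k0. \<bar>x n\<bar>)"
  have B0: "B \<ge> 0" unfolding B_def by (simp add: sum_nonneg)
  \<comment> \<open>The loss is at most \<open>2 * M * \<eta> * B\<close>: there are
    \<open>M\<close> atoms of weight below \<open>\<eta>\<close>, and \<open>x\<close> is bounded by
    \<open>B\<close>. The added ones avoid zero factors and make the estimate strict.\<close>
  define \<eta> where "\<eta> = \<epsilon> / (2 * (real M + 1) * (B + 1))"
  have \<eta>: "\<eta> > 0" using e B0 by (simp add: \<eta>_def)
  obtain K where K: "\<And>k j. k \<ge> K \<Longrightarrow> j < 2 ^ k \<Longrightarrow> weight m k j < \<eta>" using weight_vanishes[OF m0 \<eta>] by blast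
  define k where "k = max k0 K"
  have kx: "\<forall>n\<ge>2 ^ k. x n = 0" and kz: "\<forall>n\<ge>2 ^ k. z n = 0"
    using level_mono[OF k0(1), of k] level_mono[OF k0(2), of k] by (auto simp: k_def)
  let ?J = "{..<2 ^ k :: nat}"
  define W where "W = weight m k"
  have W: "W j > 0" "W j < \<eta>" if "j \<in> ?J" for j using that weight_pos K[of k j] by (auto simp: W_def k_def)
  have xB: "\<bar>val x k j\<bar> \<le> B" if "j \<in> ?J" for j
  proof -
    have "\<bar>val x k j\<bar> \<le> (\<Sum>n<2 ^ k. \<bar>x n\<bar>)" using val_bound that by simp
    also have "\<dots> = B" unfolding B_def
    proof (rule sum.mono_neutral_right)
      show "{..<2 ^ k0} \<subseteq> {..<2 ^ k :: nat}" by (auto simp: k_def intro: order.strict_trans2 power_increasing)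
      show "\<forall>i\<in>{..<2 ^ k} - {..<2 ^ k0}. \<bar>x i\<bar> = 0" using k0(1) by auto
    qed simp
    finally show ?thesis .
  qed
  have "\<forall>t. \<exists>u. (\<forall>n\<ge>2 ^ k. u n = 0) \<and> (\<forall>j<2 ^ k. val u k j = (if j = t then 1 else 0))"
    by (intro allI val_surjective)
  then obtain ind where ind: "\<And>t. \<forall>n\<ge>2 ^ k. ind t n = 0" "\<And>t j. j < 2 ^ k \<Longrightarrow> val (ind t) k j = (if j = t then 1 else 0)"
    by metis
  have indC: "ind t \<in> c00" for t using ind(1) by (rule c00_levelI)
  have norm_ind: "tree_norm m (ind t) = W t" if "t \<in> ?J" for t
  proof -
    have "tree_norm m (ind t) = (\<Sum>j<2 ^ k. if j = t then W j else 0)"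
      unfolding tree_norm_eq[OF ind(1)] level_norm_def W_def by (intro sum.cong) (auto simp: ind(2))
    then show ?thesis using that by (simp add: sum.delta)
  qed
  have expand: "f y = (\<Sum>t<2 ^ k. val y k t * f (ind t))"
    if f: "f \<in> dual_space c00 (tree_norm m)" and ky: "\<forall>n\<ge>2 ^ k. y n = 0" for f y
  proof -
    have val_sum: "val (\<Sum>t\<in>A. val y k t *\<^sub>R ind t) k j = (\<Sum>t\<in>A. val y k t * val (ind t) k j)" if "finite A" for A j
      using that
    proof (induction A rule: finite_induct)
      case empty
      then show ?case using val_scale[of 0 0 k j] by (simp add: zero_fun_def)
    next
      case (insert t A)
      then show ?case by (simp only: sum.insert val_add val_scale not_False_eq_True)
    qed
    have app: "(\<Sum>t\<in>A. val y k t *\<^sub>R ind t) n = 0" if "finite A" "n \<ge> 2 ^ k" for A n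
      using that ind(1) by (induction A rule: finite_induct) (auto simp: scaleR_fun_def)
    have "y = (\<Sum>t<2 ^ k. val y k t *\<^sub>R ind t)"
    proof
      fix n
      show "y n = (\<Sum>t<2 ^ k. val y k t *\<^sub>R ind t) n"
      proof (cases "n < 2 ^ k")
        case True
        have "val y k j = val (\<Sum>t<2 ^ k. val y k t *\<^sub>R ind t) k j" if "j < 2 ^ k" for j
        proof -
          have "(\<Sum>t<2 ^ k. val y k t * val (ind t) k j) = (\<Sum>t<2 ^ k. if t = j then val y k t else 0)"
            using that by (intro sum.cong) (auto simp: ind(2))
          then show ?thesis using that by (simp add: val_sum sum.delta)
        qed
        then show ?thesis using True by (rule val_injective)
      next
        case False
        then show ?thesis using app[of "{..<2 ^ k}" n] ky by simp
      qed
    qed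
    moreover have "f (\<Sum>t\<in>A. val y k t *\<^sub>R ind t) = (\<Sum>t\<in>A. val y k t * f (ind t))" if "finite A" for A
      using that
    proof (induction A rule: finite_induct)
      case empty
      have "f 0 = 0" using T.dual_scale[OF f T.zero_mem, of 0] by simp
      then show ?case by (simp only: sum.empty)
    next
      case (insert t A)
      have "(\<Sum>t\<in>A. val y k t *\<^sub>R ind t) \<in> c00" using indC by (intro T.sum_mem T.scale_mem)
      then show ?case using insert T.dual_add[OF f T.scale_mem[OF indC]] T.dual_scale[OF f indC]
        by (simp only: sum.insert not_False_eq_True)
    qed
    ultimately show ?thesis by (metis finite_lessThan)
  qed
  define s where "s t = (if val z k t \<ge> 0 then 1 else -1 :: real)" for t
  have s2: "s t * s t = 1" "\<bar>s t\<bar> = 1" "s t * val z k t = \<bar>val z k t\<bar>" for t by (auto simp: s_def)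
  \<comment> \<open>\<open>\<phi> f t\<close> is the value of \<open>f\<close> at the atom
    \<open>t\<close>, normalised and with the sign of \<open>z\<close>; \<open>c t\<close> is the
    share of the norm of \<open>z\<close> on that atom. Thus \<open>f z\<close> is the sum of the
    products \<open>c t * \<phi> f t\<close>.\<close>
  define \<phi> where "\<phi> f t = s t * f (ind t) / W t" for f :: "(nat \<Rightarrow> real) \<Rightarrow> real" and t
  define c where "c t = W t * \<bar>val z k t\<bar>" for t
  have c0: "c t \<ge> 0" if "t \<in> ?J" for t using W[OF that] by (simp add: c_def)
  have zn: "tree_norm m z = (\<Sum>t\<in>?J. c t)" unfolding tree_norm_eq[OF kz] level_norm_def c_def W_def ..
  have "\<forall>f\<in>\<Phi>. \<forall>t\<in>?J. \<bar>\<phi> f t\<bar> \<le> C"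
  proof (intro ballI)
    fix f t assume "f \<in> \<Phi>" and t: "t \<in> ?J"
    then have "\<bar>f (ind t)\<bar> \<le> C * W t" using Cf[of f "ind t"] indC norm_ind by simp
    then show "\<bar>\<phi> f t\<bar> \<le> C" using W(1)[OF t] by (simp add: \<phi>_def abs_mult abs_divide s2 pos_divide_le_eq)
  qed
  then obtain r where r: "r ` ?J \<subseteq> ?J" "card (r ` ?J) \<le> M" "\<And>t f. t \<in> ?J \<Longrightarrow> f \<in> \<Phi> \<Longrightarrow> \<bar>\<phi> f (r t) - \<phi> f t\<bar> \<le> \<delta>"
    using M[of ?J \<phi>] by auto
  \<comment> \<open>The mass \<open>c\<close> transported along \<open>r\<close>. The total, hence
    the norm, is preserved, and in the sum for \<open>f\<close> each \<open>\<phi> f t\<close> is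
    replaced by \<open>\<phi> f (r t)\<close>, which differs by at most
    \<open>\<delta>\<close>.\<close>
  define b where "b t = (\<Sum>i\<in>{i \<in> ?J. r i = t}. c i)" for t
  have b0: "b t \<ge> 0" for t unfolding b_def by (intro sum_nonneg c0) auto
  have bz: "b t = 0" if "t \<notin> r ` ?J" for t
  proof -
    have "{i \<in> ?J. r i = t} = {}" using that by auto
    then show ?thesis by (simp only: b_def sum.empty)
  qed
  have regroup: "(\<Sum>t\<in>?J. b t * h t) = (\<Sum>i\<in>?J. c i * h (r i))" for h :: "nat \<Rightarrow> real"
  proof -
    have "(\<Sum>t\<in>?J. b t * h t) = (\<Sum>t\<in>?J. \<Sum>i\<in>{i \<in> ?J. r i = t}. c i * h (r i))"
      unfolding b_def sum_distrib_right by (intro sum.cong) auto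
    also have "\<dots> = (\<Sum>i\<in>?J. c i * h (r i))" using r(1) by (intro sum.group) auto
    finally show ?thesis .
  qed
  obtain y where y: "\<forall>n\<ge>2 ^ k. y n = 0" "\<And>t. t < 2 ^ k \<Longrightarrow> val y k t = b t * s t / W t"
    using val_surjective[of k "\<lambda>t. b t * s t / W t"] by blast
  show ?thesis
  proof
    show "y \<in> c00" using y(1) by (rule c00_levelI)
    have "tree_norm m y = (\<Sum>t\<in>?J. b t * 1)"
      unfolding tree_norm_eq[OF y(1)] level_norm_def W_def[symmetric]
    proof (intro sum.cong refl)
      fix t assume t: "t \<in> ?J"
      show "W t * \<bar>val y k t\<bar> = b t * 1" using t W(1)[OF t] b0[of t] y(2)[of t] by (simp add: abs_mult abs_divide s2)
    qed
    then show "tree_norm m y = tree_norm m z" unfolding regroup zn by simp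
    show "\<bar>f y - f z\<bar> \<le> \<delta> * tree_norm m z" if f: "f \<in> \<Phi>" for f
    proof -
      have "f y = (\<Sum>t\<in>?J. b t * \<phi> f t)"
        unfolding expand[OF \<Phi>(2)[OF f] y(1)] by (intro sum.cong) (auto simp: y(2) \<phi>_def)
      also have "\<dots> = (\<Sum>t\<in>?J. c t * \<phi> f (r t))" by (rule regroup)
      finally have fy: "f y = (\<Sum>t\<in>?J. c t * \<phi> f (r t))" .
      have fz: "f z = (\<Sum>t\<in>?J. c t * \<phi> f t)"
        unfolding expand[OF \<Phi>(2)[OF f] kz]
      proof (intro sum.cong refl)
        fix t assume t: "t \<in> ?J"
        have "c t * \<phi> f t = s t * \<bar>val z k t\<bar> * f (ind t)" using W(1)[OF t] by (simp add: c_def \<phi>_def)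
        also have "s t * \<bar>val z k t\<bar> = val z k t" by (auto simp: s_def)
        finally show "val z k t * f (ind t) = c t * \<phi> f t" by simp
      qed
      have "\<bar>f y - f z\<bar> = \<bar>\<Sum>t\<in>?J. c t * (\<phi> f (r t) - \<phi> f t)\<bar>"
        unfolding fy fz by (simp add: sum_subtractf right_diff_distrib)
      also have "\<dots> \<le> (\<Sum>t\<in>?J. \<bar>c t * (\<phi> f (r t) - \<phi> f t)\<bar>)" by (rule sum_abs)
      also have "\<dots> \<le> (\<Sum>t\<in>?J. c t * \<delta>)"
      proof (intro sum_mono)
        fix t assume t: "t \<in> ?J"
        show "\<bar>c t * (\<phi> f (r t) - \<phi> f t)\<bar> \<le> c t * \<delta>"
          using r(3)[OF t f] c0[OF t] by (simp add: abs_mult mult_left_mono)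
      qed
      also have "\<dots> = \<delta> * tree_norm m z" unfolding zn by (simp add: sum_distrib_left mult.commute)
      finally show ?thesis .
    qed
    have kxy: "\<forall>n\<ge>2 ^ k. (x + y) n = 0" using kx y(1) by simp
    have xn: "tree_norm m x = (\<Sum>t\<in>?J. W t * \<bar>val x k t\<bar>)" unfolding tree_norm_eq[OF kx] level_norm_def W_def ..
    \<comment> \<open>Off the representatives \<open>y\<close> vanishes; on them the triangle
      inequality loses at most \<open>2 * (W t * \<bar>val x k t\<bar>)\<close>.\<close>
    have "tree_norm m x + tree_norm m z - (\<Sum>t\<in>r ` ?J. 2 * (W t * \<bar>val x k t\<bar>))
        = (\<Sum>t\<in>?J. W t * \<bar>val x k t\<bar> + b t - (if t \<in> r ` ?J then 2 * (W t * \<bar>val x k t\<bar>) else 0))"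
    proof -
      have "tree_norm m z = (\<Sum>t\<in>?J. b t)" using regroup[of "\<lambda>_. 1"] zn by simp
      moreover have "(\<Sum>t\<in>r ` ?J. 2 * (W t * \<bar>val x k t\<bar>)) = (\<Sum>t\<in>?J. if t \<in> r ` ?J then 2 * (W t * \<bar>val x k t\<bar>) else 0)"
        using r(1) by (simp add: sum.inter_restrict[symmetric] Int_absorb1)
      ultimately show ?thesis unfolding xn by (simp add: sum.distrib sum_subtractf)
    qed
    also have "\<dots> \<le> (\<Sum>t\<in>?J. W t * \<bar>val (x + y) k t\<bar>)"
    proof (intro sum_mono)
      fix t assume t: "t \<in> ?J"
      have "W t * val (x + y) k t = W t * val x k t + s t * b t"
        using t W(1)[OF t] by (simp add: val_add y(2) distrib_left)
      then have eq: "W t * \<bar>val (x + y) k t\<bar> = \<bar>W t * val x k t + s t * b t\<bar>"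
        using W(1)[OF t] by (metis abs_mult abs_of_pos)
      have 1: "\<bar>s t * b t\<bar> = b t" using b0[of t] by (simp add: abs_mult s2)
      have 2: "\<bar>W t * val x k t\<bar> = W t * \<bar>val x k t\<bar>" using W(1)[OF t] by (simp add: abs_mult)
      show "W t * \<bar>val x k t\<bar> + b t - (if t \<in> r ` ?J then 2 * (W t * \<bar>val x k t\<bar>) else 0) \<le> W t * \<bar>val (x + y) k t\<bar>"
      proof (cases "t \<in> r ` ?J")
        case True
        then show ?thesis unfolding eq using 1 2 by auto
      next
        case False
        then show ?thesis unfolding eq using bz[OF False] 2 by auto
      qed
    qed
    also have "\<dots> = tree_norm m (x + y)" unfolding tree_norm_eq[OF kxy] level_norm_def W_def ..
    finally have main: "tree_norm m x + tree_norm m z - (\<Sum>t\<in>r ` ?J. 2 * (W t * \<bar>val x k t\<bar>)) \<le> tree_norm m (x + y)" .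
    have "(\<Sum>t\<in>r ` ?J. 2 * (W t * \<bar>val x k t\<bar>)) \<le> (\<Sum>t\<in>r ` ?J. 2 * (\<eta> * B))"
    proof (intro sum_mono mult_left_mono)
      fix t assume "t \<in> r ` ?J"
      then have t: "t \<in> ?J" using r(1) by blast
      show "W t * \<bar>val x k t\<bar> \<le> \<eta> * B" using W[OF t] xB[OF t] \<eta> by (intro mult_mono) auto
    qed simp
    also have "\<dots> = real (card (r ` ?J)) * (2 * (\<eta> * B))" by simp
    also have "\<dots> \<le> real M * (2 * (\<eta> * B))" using r(2) \<eta> B0 by (intro mult_right_mono) auto
    also have "\<dots> < (real M + 1) * (2 * (\<eta> * (B + 1)))"
      by (rule mult_strict_mono') (use \<eta> B0 in auto)
    also have "\<dots> = \<eta> * (2 * (real M + 1) * (B + 1))" by (simp only: mult_ac)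
    also have "\<dots> = \<epsilon>"
    proof -
      have "2 * (real M + 1) * (B + 1) > 0" using B0 by simp
      then show ?thesis unfolding \<eta>_def by (metis less_irrefl nonzero_eq_divide_eq)
    qed
    finally show "tree_norm m x + tree_norm m z - \<epsilon> < tree_norm m (x + y)" using main by linarith
  qed
qed

text \<open>Both vectors are approximated by constant sequences from \<open>c00\<close>, where
  \<open>diffuse_c00\<close> applies. The approximation of \<open>z\<close> has norm below 1 and
  \<open>y\<close> has the same norm, so \<open>y\<close> stays in the ball.\<close>

lemma diffuse_tree:
  assumes m0: "m \<longlonglongrightarrow> 0" shows "N.X.diffuse"
  unfolding N.X.diffuse_def
proof (intro ballI allI impI, elim conjE)
  let ?\<mu> = tree_seminorm
  fix x z G and \<delta> \<epsilon> :: real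
  assume x: "x \<in> Xcar ?\<mu>" and z: "z \<in> N.X.B\<^sub>X"
    and G: "finite G" "G \<subseteq> dual_space (Xcar ?\<mu>) (Xnorm ?\<mu>)" and d: "\<delta> > 0" and e: "\<epsilon> > 0"
  define C where "C = 1 + (\<Sum>f\<in>G. \<bar>dual_norm (Xcar ?\<mu>) (Xnorm ?\<mu>) f\<bar>)"
  have C1: "C \<ge> 1" unfolding C_def by (simp add: sum_nonneg)
  have Cf: "\<bar>f y\<bar> \<le> C * Xnorm ?\<mu> y" if f: "f \<in> G" and y: "y \<in> Xcar ?\<mu>" for f y
  proof -
    have fd: "f \<in> dual_space (Xcar ?\<mu>) (Xnorm ?\<mu>)" using f G(2) by blast
    have "\<bar>f y\<bar> \<le> dual_norm (Xcar ?\<mu>) (Xnorm ?\<mu>) f * Xnorm ?\<mu> y" by (rule N.X.dual_le_norm[OF fd y])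
    also have "\<dots> \<le> C * Xnorm ?\<mu> y"
    proof (rule mult_right_mono)
      show "dual_norm (Xcar ?\<mu>) (Xnorm ?\<mu>) f \<le> C"
        using member_le_sum[OF f, of "\<lambda>f. \<bar>dual_norm (Xcar ?\<mu>) (Xnorm ?\<mu>) f\<bar>"] G(1) unfolding C_def by force
    qed (rule N.X.N_nonneg[OF y])
    finally show ?thesis .
  qed
  \<comment> \<open>The norm estimate collects three errors \<open>\<eta>\<close> and one
    \<open>\<epsilon> / 4\<close>; for the functionals, whose norms \<open>C\<close> bounds,
    \<open>C * \<eta>\<close> is added to \<open>\<delta> / 2\<close>.\<close>
  define \<eta> where "\<eta> = min (\<epsilon> / 4) (\<delta> / (4 * C))"
  have \<eta>: "\<eta> > 0" "\<eta> \<le> \<epsilon> / 4" "C * \<eta> \<le> \<delta> / 4"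
  proof -
    show "\<eta> > 0" "\<eta> \<le> \<epsilon> / 4" using e d C1 by (auto simp: \<eta>_def)
    have "C * \<eta> \<le> C * (\<delta> / (4 * C))" using C1 by (intro mult_left_mono) (auto simp: \<eta>_def)
    then show "C * \<eta> \<le> \<delta> / 4" using C1 by simp
  qed
  obtain x' where x': "x' \<in> c00" "Xnorm ?\<mu> (x - (\<lambda>_. x')) < \<eta>" using N.const_dense[OF x \<eta>(1)] by blast
  obtain w where w: "w \<in> Vset" "?\<mu> w < 1" "Xnorm ?\<mu> (z - (1 / 1) *\<^sub>R N.emb w) < \<eta>"
    using N.ball_approx[OF z \<eta>(1), of 1] by auto
  define z' where "z' = ratvec w"
  have zX: "z \<in> Xcar ?\<mu>" using z by (simp add: unit_ball_def)
  have z': "z' \<in> c00" "tree_norm m z' < 1" "Xnorm ?\<mu> (z - (\<lambda>_. z')) < \<eta>"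
    using w by (auto simp: z'_def tree_seminorm_def N.emb_def)
  have nc: "Xnorm ?\<mu> (\<lambda>_. y) = tree_norm m y" if "y \<in> c00" for y
    using N.Xnorm_const[OF that] mubar_tree[OF that] by simp
  define \<Phi> where "\<Phi> = (\<lambda>f y. f (\<lambda>_::nat. y :: nat \<Rightarrow> real)) ` G"
  have \<Phi>d: "h \<in> dual_space c00 (tree_norm m)" if h: "h \<in> \<Phi>" for h
  proof -
    obtain f where f: "f \<in> G" "h = (\<lambda>y. f (\<lambda>_. y))" using h by (auto simp: \<Phi>_def)
    have fd: "f \<in> dual_space (Xcar ?\<mu>) (Xnorm ?\<mu>)" using f(1) G(2) by blast
    show ?thesis unfolding dual_space_def
    proof (intro CollectI conjI ballI allI exI[of _ C])
      show "h (u + v) = h u + h v" if "u \<in> c00" "v \<in> c00" for u v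
      proof -
        have "(\<lambda>_::nat. u + v) = (\<lambda>_. u) + (\<lambda>_. v)" by (auto simp: fun_eq_iff)
        then show ?thesis using N.X.dual_add[OF fd, of "\<lambda>_. u" "\<lambda>_. v"] that by (simp add: f(2))
      qed
      show "h (c *\<^sub>R u) = c * h u" if "u \<in> c00" for c u
      proof -
        have "(\<lambda>_::nat. c *\<^sub>R u) = c *\<^sub>R (\<lambda>_. u)" by (auto simp: fun_eq_iff scaleR_fun_def)
        then show ?thesis using N.X.dual_scale[OF fd, of "\<lambda>_. u" c] that by (simp add: f(2))
      qed
      show "\<bar>h u\<bar> \<le> C * tree_norm m u" if "u \<in> c00" for u
        using Cf[OF f(1), of "\<lambda>_. u"] nc[OF that] that by (simp add: f(2))
    qed
  qed
  have "finite \<Phi>" using G(1) by (simp add: \<Phi>_def)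
  then obtain y where y: "y \<in> c00" "tree_norm m y = tree_norm m z'"
    "\<And>h. h \<in> \<Phi> \<Longrightarrow> \<bar>h y - h z'\<bar> \<le> \<delta> / 2 * tree_norm m z'"
    "tree_norm m x' + tree_norm m z' - \<epsilon> / 4 < tree_norm m (x' + y)"
    using diffuse_c00[OF m0 x'(1) z'(1), of \<Phi> "\<delta> / 2" "\<epsilon> / 4"] \<Phi>d d e by auto
  show "\<exists>y\<in>N.X.B\<^sub>X. (\<forall>f\<in>G. \<bar>f y - f z\<bar> < \<delta>) \<and> Xnorm ?\<mu> x + Xnorm ?\<mu> z - \<epsilon> < Xnorm ?\<mu> (x + y)"
  proof (intro bexI[of _ "\<lambda>_. y"] conjI ballI)
    show "(\<lambda>_. y) \<in> N.X.B\<^sub>X" using y(1,2) nc z'(2) by (simp add: unit_ball_def)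
    fix f assume f: "f \<in> G"
    have fd: "f \<in> dual_space (Xcar ?\<mu>) (Xnorm ?\<mu>)" using f G(2) by blast
    have "\<bar>f (\<lambda>_. y) - f (\<lambda>_. z')\<bar> \<le> \<delta> / 2 * tree_norm m z'" using y(3)[of "\<lambda>y. f (\<lambda>_. y)"] f by (auto simp: \<Phi>_def)
    also have "\<dots> \<le> \<delta> / 2" using z'(2) d by (intro mult_left_le) auto
    finally have 1: "\<bar>f (\<lambda>_. y) - f (\<lambda>_. z')\<bar> \<le> \<delta> / 2" .
    have "\<bar>f z - f (\<lambda>_. z')\<bar> \<le> C * Xnorm ?\<mu> (z - (\<lambda>_. z'))"
      using Cf[OF f, of "z - (\<lambda>_. z')"] N.X.dual_diff[OF fd zX, of "\<lambda>_. z'"] zX z'(1) by simp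
    also have "\<dots> \<le> C * \<eta>" using z'(3) C1 by (intro mult_left_mono) auto
    finally show "\<bar>f (\<lambda>_. y) - f z\<bar> < \<delta>" using 1 \<eta>(3) d by linarith
  next
    have xs: "Xnorm ?\<mu> x \<le> tree_norm m x' + \<eta>"
      using N.X.N_abs_diff[OF x, of "\<lambda>_. x'"] x' nc[OF x'(1)] by simp
    have zs: "Xnorm ?\<mu> z \<le> tree_norm m z' + \<eta>"
      using N.X.N_abs_diff[OF zX, of "\<lambda>_. z'"] z' nc[OF z'(1)] by simp
    have c: "(\<lambda>_::nat. x') + (\<lambda>_. y) = (\<lambda>_. x' + y)" by (auto simp: fun_eq_iff)
    have xy: "x' + y \<in> c00" using x'(1) y(1) by simp
    have "\<bar>Xnorm ?\<mu> (x + (\<lambda>_. y)) - Xnorm ?\<mu> ((\<lambda>_. x') + (\<lambda>_. y))\<bar> \<le> Xnorm ?\<mu> ((x + (\<lambda>_. y)) - ((\<lambda>_. x') + (\<lambda>_. y)))"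
      using x x'(1) y(1) by (intro N.X.N_abs_diff N.X.add_mem) auto
    also have "(x + (\<lambda>_. y)) - ((\<lambda>_. x') + (\<lambda>_. y)) = x - (\<lambda>_. x')" by simp
    finally have "Xnorm ?\<mu> (x + (\<lambda>_. y)) > tree_norm m (x' + y) - \<eta>"
      unfolding c nc[OF xy] using x'(2) by linarith
    then show "Xnorm ?\<mu> x + Xnorm ?\<mu> z - \<epsilon> < Xnorm ?\<mu> (x + (\<lambda>_. y))" using xs zs y(4) \<eta>(2) by linarith
  qed
qed

end

section \<open>Reduction of \<open>G\<^sub>\<delta>\<close> sets\<close>

text \<open>The function is the distance to the complement. The whole space is treated apart,
  because there the infimum ranges over the empty set.\<close>

lemma metrizable_open_cozero:
  assumes "metrizable_space Y" "openin Y U"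
  obtains h where "continuous_map Y euclideanreal h" "\<And>y. y \<in> topspace Y \<Longrightarrow> h y \<ge> 0"
    "\<And>y. y \<in> topspace Y \<Longrightarrow> h y > 0 \<longleftrightarrow> y \<in> U"
proof -
  obtain M d where Md: "Metric_space M d" "Y = Metric_space.mtopology M d"
    using assms(1) by (auto simp: metrizable_space_def)
  interpret Metric_space M d by (rule Md(1))
  have Y: "Y = mtopology" "topspace Y = M" using Md(2) by auto
  have U: "U \<subseteq> M" "\<And>x. x \<in> U \<Longrightarrow> \<exists>r>0. mball x r \<subseteq> U" using assms(2) unfolding Y(1) openin_mtopology by auto
  show ?thesis
  proof (cases "U = M")
    case True
    show ?thesis by (rule that[of "\<lambda>_. 1"]) (use True Y in auto)
  next
    case False
    then obtain a0 where a0: "a0 \<in> M - U" using U(1) by blast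
    define h where "h x = (INF a\<in>M - U. d x a)" for x
    have bdd: "bdd_below (d x ` (M - U))" for x by (rule bdd_belowI[of _ 0]) auto
    have h0: "h x \<ge> 0" for x unfolding h_def using a0 by (intro cINF_greatest) auto
    have hle: "h x \<le> d x a" if "a \<in> M - U" for x a unfolding h_def using that by (intro cINF_lower[OF bdd])
    have lip: "h x \<le> h y + d x y" if "x \<in> M" "y \<in> M" for x y
    proof -
      have "h x - d x y \<le> h y"
        unfolding h_def[of y]
      proof (rule cINF_greatest)
        show "M - U \<noteq> {}" using a0 by blast
        fix a assume a: "a \<in> M - U"
        then have "d x a \<le> d x y + d y a" using that by (intro triangle) auto
        then show "h x - d x y \<le> d y a" using hle[OF a, of x] by linarith
      qed
      then show ?thesis by simp
    qed
    have "continuous_map Y euclideanreal h"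
      unfolding Y(1) continuous_map_from_metric
    proof (intro conjI ballI allI impI)
      fix a V assume a: "a \<in> M" and V: "openin euclideanreal V \<and> h a \<in> V"
      then obtain e where e: "e > 0" "\<And>z. dist z (h a) < e \<Longrightarrow> z \<in> V" by (metis open_dist open_openin)
      have "h x \<in> V" if "x \<in> M" "d a x < e" for x
      proof (rule e(2))
        show "dist (h x) (h a) < e"
          using lip[OF a that(1)] lip[OF that(1) a] that(2) commute[of a x] by (simp add: dist_real_def)
      qed
      then show "\<exists>r>0. \<forall>x. x \<in> M \<and> d a x < r \<longrightarrow> h x \<in> V" using e(1) by blast
    qed simp
    moreover have "h y > 0 \<longleftrightarrow> y \<in> U" if y: "y \<in> M" for y
    proof
      assume "h y > 0"
      then show "y \<in> U" using hle[of y y] y by force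
    next
      assume "y \<in> U"
      then obtain r where r: "r > 0" "mball y r \<subseteq> U" using U(2) by blast
      have "r \<le> h y" unfolding h_def
      proof (rule cINF_greatest)
        show "M - U \<noteq> {}" using a0 by blast
        fix a assume "a \<in> M - U"
        then have "a \<notin> mball y r" "a \<in> M" using r(2) by auto
        then show "r \<le> d y a" using y by (simp add: in_mball not_less)
      qed
      then show "h y > 0" using r(1) by linarith
    qed
    ultimately show ?thesis using that[of h] h0 Y by auto
  qed
qed

text \<open>A continuous substitute for the number of \<open>n < k\<close> with
  \<open>t n > 0\<close>: such an \<open>n\<close> counts fully once \<open>k * t n \<ge> 1\<close>.
  For nonnegative \<open>t\<close> it tends to infinity if all \<open>t n\<close> are positive and
  stays bounded if only finitely many are.\<close>

definition count_upto :: "(nat \<Rightarrow> real) \<Rightarrow> nat \<Rightarrow> real" where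
  "count_upto t k = (\<Sum>n<k. min 1 (real k * t n))"

text \<open>The factor \<open>1 + (1 / 2) ^ k\<close> forces strict decrease even where the count is
  constant; the 2 in the denominator makes the total mass \<open>mass t 0\<close> equal to
  1.\<close>

definition mass :: "(nat \<Rightarrow> real) \<Rightarrow> nat \<Rightarrow> real" where
  "mass t k = (1 + (1 / 2) ^ k) / (2 * (1 + count_upto t k))"

lemma count_upto_nonneg: "(\<And>n. t n \<ge> 0) \<Longrightarrow> count_upto t k \<ge> 0"
  by (simp add: count_upto_def sum_nonneg)

lemma count_upto_mono:
  assumes "\<And>n. t n \<ge> 0" shows "count_upto t k \<le> count_upto t (Suc k)"
proof -
  have "count_upto t k \<le> (\<Sum>n<k. min 1 (real (Suc k) * t n))" unfolding count_upto_def
    using assms by (intro sum_mono min.mono mult_right_mono) auto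
  also have "\<dots> \<le> count_upto t (Suc k)" unfolding count_upto_def using assms by simp
  finally show ?thesis .
qed

lemma weights_mass:
  assumes t: "\<And>n. t n \<ge> 0" shows "weights (mass t)"
proof
  fix k
  have p: "1 + count_upto t k > 0" for k using count_upto_nonneg[of t k, OF t] by linarith
  show "mass t k > 0" unfolding mass_def using p[of k] by (intro divide_pos_pos add_pos_pos) auto
  show "mass t (Suc k) < mass t k"
    unfolding mass_def
  proof (rule frac_less)
    show "2 * (1 + count_upto t k) \<le> 2 * (1 + count_upto t (Suc k))" using count_upto_mono[of t k] t by simp
    show "0 < 2 * (1 + count_upto t k)" using p[of k] by simp
  qed auto
qed

text \<open>Each index eventually counts fully, so the first \<open>B\<close> indices alone push the
  count up to \<open>B\<close>, for any \<open>B\<close>.\<close>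

lemma mass_tendsto_0:
  assumes t: "\<And>n. t n > 0" shows "mass t \<longlonglongrightarrow> 0"
proof -
  have "filterlim (count_upto t) at_top sequentially"
    unfolding filterlim_at_top
  proof
    fix Z :: real
    obtain B :: nat where B: "Z \<le> real B" using real_arch_simple by blast
    have "eventually (\<lambda>k. 1 \<le> real k * t n) sequentially" for n
    proof -
      obtain K where "1 / t n \<le> real K" using real_arch_simple by blast
      then have "1 \<le> real k * t n" if "k \<ge> K" for k
        using that t[of n] by (simp add: pos_divide_le_eq order_trans[OF _ mult_right_mono])
      then show ?thesis by (auto simp: eventually_sequentially)
    qed
    then have "eventually (\<lambda>k. \<forall>n\<in>{..<B}. 1 \<le> real k * t n) sequentially" by (intro eventually_ball_finite) auto
    moreover have "eventually (\<lambda>k. k \<ge> B) sequentially" by (rule eventually_ge_at_top)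
    ultimately show "eventually (\<lambda>k. Z \<le> count_upto t k) sequentially"
    proof eventually_elim
      case (elim k)
      have "real B = (\<Sum>n<B. min 1 (real k * t n))" using elim(1) by simp
      also have "\<dots> \<le> count_upto t k" unfolding count_upto_def
        using elim(2) t by (intro sum_mono2) (auto simp: less_imp_le)
      finally show ?case using B by linarith
    qed
  qed
  then have "filterlim (\<lambda>k. 2 * (1 + count_upto t k)) at_top sequentially"
    by (intro filterlim_tendsto_pos_mult_at_top[OF tendsto_const] filterlim_tendsto_add_at_top[OF tendsto_const]) auto
  moreover have "(\<lambda>k. 1 + (1 / 2 :: real) ^ k) \<longlonglongrightarrow> 1 + 0" by (intro tendsto_add tendsto_const LIMSEQ_power_zero) simp
  ultimately show ?thesis unfolding mass_def
    by (intro tendsto_divide_0) (auto intro: filterlim_at_top_imp_at_infinity)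
qed

text \<open>At most \<open>n0\<close> indices contribute, so the count increases to a finite limit
  \<open>s\<close> and the masses tend to \<open>1 / (2 * (1 + s))\<close>.\<close>

lemma mass_tendsto_pos:
  assumes t: "\<And>n. t n \<ge> 0" and z: "\<And>n. n \<ge> n0 \<Longrightarrow> t n = 0"
  obtains c where "c > 0" "mass t \<longlonglongrightarrow> c"
proof -
  have le: "count_upto t k \<le> real n0" for k
  proof -
    have "count_upto t k \<le> (\<Sum>n<k. if n < n0 then 1 else 0)" unfolding count_upto_def
      by (intro sum_mono) (auto simp: z)
    also have "\<dots> = (\<Sum>n\<in>{..<k} \<inter> {..<n0}. 1)" by (subst sum.inter_restrict) auto
    also have "\<dots> \<le> real n0" using card_mono[of "{..<n0}" "{..<k} \<inter> {..<n0}"] by simp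
    finally show ?thesis .
  qed
  have "incseq (count_upto t)" using count_upto_mono[of t] t by (intro incseq_SucI) auto
  then obtain s where s: "count_upto t \<longlonglongrightarrow> s" "\<forall>k. count_upto t k \<le> s"
    using incseq_convergent[of "count_upto t" "real n0"] le by auto
  have s0: "s \<ge> 0" using s(2) count_upto_nonneg[of t 0] t order_trans by blast
  have "(\<lambda>k. (1 + (1 / 2 :: real) ^ k) / (2 * (1 + count_upto t k))) \<longlonglongrightarrow> (1 + 0) / (2 * (1 + s))"
    using s0 by (intro tendsto_intros s(1) LIMSEQ_power_zero) auto
  then have "mass t \<longlonglongrightarrow> 1 / (2 * (1 + s))" by (simp add: mass_def[abs_def])
  then show ?thesis using that[of "1 / (2 * (1 + s))"] s0 by simp
qed

lemma continuous_map_weight: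
  assumes "\<And>k. continuous_map Y euclideanreal (\<lambda>y. m y k)"
  shows "continuous_map Y euclideanreal (\<lambda>y. weight (m y) k j)"
proof (induction k arbitrary: j)
  case (Suc k)
  show ?case using assms Suc by (auto intro!: continuous_intros)
qed (simp add: assms)

text \<open>The level at which \<open>x\<close> is a step function does not depend on the weights,
  so the norm is one fixed finite sum, continuous in them.\<close>

lemma continuous_map_tree_norm:
  assumes "\<And>k. continuous_map Y euclideanreal (\<lambda>y. m y k)" "x \<in> c00"
  shows "continuous_map Y euclideanreal (\<lambda>y. tree_norm (m y) x)"
proof -
  obtain k where k: "\<forall>n\<ge>2 ^ k. x n = 0" by (rule c00_level[OF assms(2)])
  show ?thesis unfolding tree_norm_eq[OF k] level_norm_def
    by (intro continuous_map_sum continuous_map_real_mult continuous_map_weight assms(1)) auto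
qed

lemma continuous_map_mass:
  assumes "\<And>n. continuous_map Y euclideanreal (\<lambda>y. t y n)" "\<And>y n. y \<in> topspace Y \<Longrightarrow> t y n \<ge> 0"
  shows "continuous_map Y euclideanreal (\<lambda>y. mass (t y) k)"
  unfolding mass_def
proof (rule continuous_map_real_divide)
  have c: "continuous_map Y euclideanreal (\<lambda>y. count_upto (t y) k)" unfolding count_upto_def
    using assms(1) by (intro continuous_map_sum continuous_map_real_min continuous_map_real_mult) auto
  show "continuous_map Y euclideanreal (\<lambda>y. 2 * (1 + count_upto (t y) k))"
    using c by (intro continuous_map_real_mult continuous_map_add) auto
  show "2 * (1 + count_upto (t y) k) \<noteq> 0" if "y \<in> topspace Y" for y
    using count_upto_nonneg[of "t y" k] assms(2)[OF that] by simp
qed simp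

text \<open>One map serves all five classes: on \<open>C\<close> the masses tend to zero and the
  space is diffuse; off \<open>C\<close> the branch keeps positive mass and even LD2P fails.\<close>

lemma Gdelta_reduction:
  assumes Y: "metrizable_space Y" and C: "gdelta_in Y C"
  obtains F where "continuous_map Y Btop F"
    "\<And>y. y \<in> C \<Longrightarrow> LD2P (Xcar (F y)) (Xnorm (F y)) \<and> SD2P (Xcar (F y)) (Xnorm (F y)) \<and>
      DLD2P (Xcar (F y)) (Xnorm (F y)) \<and> DD2P (Xcar (F y)) (Xnorm (F y)) \<and> Daugavet (Xcar (F y)) (Xnorm (F y))"
    "\<And>y. y \<in> topspace Y \<Longrightarrow> y \<notin> C \<Longrightarrow> \<not> LD2P (Xcar (F y)) (Xnorm (F y)) \<and> \<not> SD2P (Xcar (F y)) (Xnorm (F y)) \<and>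
      \<not> DLD2P (Xcar (F y)) (Xnorm (F y)) \<and> \<not> DD2P (Xcar (F y)) (Xnorm (F y)) \<and> \<not> Daugavet (Xcar (F y)) (Xnorm (F y))"
proof -
  obtain U where U: "\<And>n. openin Y (U n)" "\<And>n. U (Suc n) \<subseteq> U n" "\<Inter> (range U) = C"
    using C unfolding gdelta_in_descending by blast
  have "\<forall>n. \<exists>h. continuous_map Y euclideanreal h \<and> (\<forall>y\<in>topspace Y. h y \<ge> 0 \<and> (h y > 0 \<longleftrightarrow> y \<in> U n))"
  proof
    fix n
    obtain h where "continuous_map Y euclideanreal h" "\<And>y. y \<in> topspace Y \<Longrightarrow> h y \<ge> 0"
      "\<And>y. y \<in> topspace Y \<Longrightarrow> h y > 0 \<longleftrightarrow> y \<in> U n" using metrizable_open_cozero[OF Y U(1)] by blast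
    then show "\<exists>h. continuous_map Y euclideanreal h \<and> (\<forall>y\<in>topspace Y. h y \<ge> 0 \<and> (h y > 0 \<longleftrightarrow> y \<in> U n))" by blast
  qed
  then obtain h where h: "\<And>n. continuous_map Y euclideanreal (h n)"
    "\<And>n y. y \<in> topspace Y \<Longrightarrow> h n y \<ge> 0" "\<And>n y. y \<in> topspace Y \<Longrightarrow> h n y > 0 \<longleftrightarrow> y \<in> U n" by metis
  define t where "t y n = h n y" for y n
  have t0: "t y n \<ge> 0" if "y \<in> topspace Y" for y n using h(2)[OF that] by (simp add: t_def)
  define F where "F y = restrict (\<lambda>v. tree_norm (mass (t y)) (ratvec v)) Vset" for y
  have W: "weights (mass (t y))" if "y \<in> topspace Y" for y by (rule weights_mass) (rule t0[OF that])
  have FT: "F y = weights.tree_seminorm (mass (t y))" if "y \<in> topspace Y" for y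
    using weights.tree_seminorm_def[OF W[OF that]] by (simp add: F_def)
  have FB: "F y \<in> Bset" if "y \<in> topspace Y" for y
    using weights.tree_seminorm_Bset[OF W[OF that]] FT[OF that] by simp
  have cm: "continuous_map Y euclideanreal (\<lambda>y. mass (t y) k)" for k
    by (rule continuous_map_mass) (use h(1) t0 in \<open>auto simp: t_def\<close>)
  show ?thesis
  proof (rule that)
    have "continuous_map Y euclideanreal (\<lambda>y. F y v)" if "v \<in> Vset" for v
      using continuous_map_tree_norm[of Y "\<lambda>y. mass (t y)", OF cm ratvec_mem[OF that]] that by (simp add: F_def)
    then have "continuous_map Y RV F" unfolding RV_def continuous_map_componentwise
      by (auto simp: F_def)
    then show "continuous_map Y Btop F" unfolding Btop_def continuous_map_in_subtopology using FB by auto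
  next
    fix y assume y: "y \<in> C"
    then have yt: "y \<in> topspace Y" using gdelta_in_subset[OF C] by blast
    interpret weights "mass (t y)" by (rule W[OF yt])
    have "t y n > 0" for n using y U(3) h(3)[OF yt] by (auto simp: t_def)
    then have "N.X.diffuse" by (intro diffuse_tree mass_tendsto_0)
    then show "LD2P (Xcar (F y)) (Xnorm (F y)) \<and> SD2P (Xcar (F y)) (Xnorm (F y)) \<and>
      DLD2P (Xcar (F y)) (Xnorm (F y)) \<and> DD2P (Xcar (F y)) (Xnorm (F y)) \<and> Daugavet (Xcar (F y)) (Xnorm (F y))"
      unfolding FT[OF yt] using N.X.diffuse_imp by blast
  next
    fix y assume yt: "y \<in> topspace Y" and y: "y \<notin> C"
    interpret weights "mass (t y)" by (rule W[OF yt])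
    obtain n0 where n0: "y \<notin> U n0" using y U(3) by blast
    have "t y n = 0" if "n \<ge> n0" for n
    proof -
      \<comment> \<open>The sets decrease, so missing \<open>U n0\<close> makes all later
        \<open>h n\<close> vanish at \<open>y\<close>; only finitely many indices can then be
        counted.\<close>
      have "U n \<subseteq> U n0" using that by (rule lift_Suc_antimono_le[of U, OF U(2)])
      then have "\<not> h n y > 0" using n0 h(3)[OF yt] by blast
      then show ?thesis using h(2)[OF yt, of n] by (simp add: t_def)
    qed
    then obtain c where "c > 0" "mass (t y) \<longlonglongrightarrow> c" using mass_tendsto_pos[of "t y" n0] t0[OF yt] by blast
    then have "\<not> LD2P (Xcar tree_seminorm) (Xnorm tree_seminorm)" by (rule not_LD2P_tree)
    then show "\<not> LD2P (Xcar (F y)) (Xnorm (F y)) \<and> \<not> SD2P (Xcar (F y)) (Xnorm (F y)) \<and>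
      \<not> DLD2P (Xcar (F y)) (Xnorm (F y)) \<and> \<not> DD2P (Xcar (F y)) (Xnorm (F y)) \<and> \<not> Daugavet (Xcar (F y)) (Xnorm (F y))"
      unfolding FT[OF yt] using N.X.not_LD2P_imp by blast
  qed
qed

theorem theorem4p3:
  shows "Gdelta_complete TYPE('y) Btop {\<mu> \<in> Bset. LD2P (Xcar \<mu>) (Xnorm \<mu>)} \<and>
         Gdelta_complete TYPE('y) Btop {\<mu> \<in> Bset. SD2P (Xcar \<mu>) (Xnorm \<mu>)} \<and>
         Gdelta_complete TYPE('y) Btop {\<mu> \<in> Bset. DLD2P (Xcar \<mu>) (Xnorm \<mu>)} \<and>
         Gdelta_complete TYPE('y) Btop {\<mu> \<in> Bset. DD2P (Xcar \<mu>) (Xnorm \<mu>)} \<and>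
         Gdelta_complete TYPE('y) Btop {\<mu> \<in> Bset. Daugavet (Xcar \<mu>) (Xnorm \<mu>)}"
proof -
  have hard: "\<exists>F. continuous_map Y Btop F \<and> C = {y \<in> topspace Y. F y \<in> {\<mu> \<in> Bset. P (Xcar \<mu>) (Xnorm \<mu>)}}"
    if Y: "Polish_space Y \<and> zero_dimensional Y \<and> gdelta_in Y C" and P: "P \<in> {LD2P, SD2P, DLD2P, DD2P, Daugavet}"
    for Y :: "'y topology" and C P
  proof -
    have m: "metrizable_space Y" and C: "gdelta_in Y C"
      using Y completely_metrizable_imp_metrizable_space by (auto simp: Polish_space_def)
    obtain F where F: "continuous_map Y Btop F"
      "\<And>y. y \<in> C \<Longrightarrow> LD2P (Xcar (F y)) (Xnorm (F y)) \<and> SD2P (Xcar (F y)) (Xnorm (F y)) \<and>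
        DLD2P (Xcar (F y)) (Xnorm (F y)) \<and> DD2P (Xcar (F y)) (Xnorm (F y)) \<and> Daugavet (Xcar (F y)) (Xnorm (F y))"
      "\<And>y. y \<in> topspace Y \<Longrightarrow> y \<notin> C \<Longrightarrow> \<not> LD2P (Xcar (F y)) (Xnorm (F y)) \<and> \<not> SD2P (Xcar (F y)) (Xnorm (F y)) \<and>
        \<not> DLD2P (Xcar (F y)) (Xnorm (F y)) \<and> \<not> DD2P (Xcar (F y)) (Xnorm (F y)) \<and> \<not> Daugavet (Xcar (F y)) (Xnorm (F y))"
      using Gdelta_reduction[OF m C] by blast
    have "F y \<in> Bset" if "y \<in> topspace Y" for y
      using continuous_map_image_subset_topspace[OF F(1)] that by (auto simp: topspace_Btop)
    moreover have "P (Xcar (F y)) (Xnorm (F y)) \<longleftrightarrow> y \<in> C" if "y \<in> topspace Y" for y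
      using F(2)[of y] F(3)[OF that] P by blast
    ultimately have "C = {y \<in> topspace Y. F y \<in> {\<mu> \<in> Bset. P (Xcar \<mu>) (Xnorm \<mu>)}}"
      using gdelta_in_subset[OF C] by blast
    then show ?thesis using F(1) by blast
  qed
  show ?thesis
    unfolding Gdelta_complete_def
    by (intro conjI allI impI hard gdelta_LD2P gdelta_SD2P gdelta_DLD2P gdelta_DD2P gdelta_Daugavet) auto
qed

end
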